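(* The problem EQUITABLE TREE COLORING, restricted to input graphs that are disjoint unions of split graphs and parameterized by the number of colors $k$, is $W[1]$-hard.
   Context: All graphs are finite, simple and undirected. An equitable tree-$k$-coloring of a graph $G$ is a map $c:V(G)\to\{1,\dots,k\}$ such that each $c^{-1}(i)$ induces a forest, and $\big||c^{-1}(i)|-|c^{-1}(j)|\big|\le 1$ for all $1\le i<j\le k$. EQUITABLE TREE COLORING: given a graph $G$ and a positive integer $k$, decide whether $G$ has an equitable tree-$k$-coloring. A split graph is a graph whose vertex set can be partitioned into a clique and an independent set. $W[1]$-hardness is with respect to parameterized (FPT) reductions. *)

theory Defs
  imports Main
begin

section \<open>Graphs and equitable tree colorings\<close>

type_synonym 'a graph = "'a set \<times> 'a set set"

definition simple_graph :: "'a graph \<Rightarrow> bool" where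
  "simple_graph G \<longleftrightarrow> finite (fst G) \<and> (\<forall>e\<in>snd G. e \<subseteq> fst G \<and> card e = 2)"

definition induced :: "'a graph \<Rightarrow> 'a set \<Rightarrow> 'a graph" where
  "induced G S = (fst G \<inter> S, {e \<in> snd G. e \<subseteq> S})"

definition cycle :: "'a graph \<Rightarrow> 'a list \<Rightarrow> bool" where
  "cycle G vs \<longleftrightarrow> 3 \<le> length vs \<and> distinct vs \<and> set vs \<subseteq> fst G \<and>
     (\<forall>i<length vs. {vs ! i, vs ! (Suc i mod length vs)} \<in> snd G)"

definition forest :: "'a graph \<Rightarrow> bool" where
  "forest G \<longleftrightarrow> \<not> (\<exists>vs. cycle G vs)"

definition equitable_tree_coloring :: "'a graph \<Rightarrow> nat \<Rightarrow> ('a \<Rightarrow> nat) \<Rightarrow> bool" where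
  "equitable_tree_coloring G k c \<longleftrightarrow>
     c ` fst G \<subseteq> {1..k} \<and>
     (\<forall>i\<in>{1..k}. forest (induced G {v \<in> fst G. c v = i})) \<and>
     (\<forall>i\<in>{1..k}. \<forall>j\<in>{1..k}. i < j \<longrightarrow>
        \<bar>int (card {v \<in> fst G. c v = i}) - int (card {v \<in> fst G. c v = j})\<bar> \<le> 1)"

definition clique :: "'a graph \<Rightarrow> 'a set \<Rightarrow> bool" where
  "clique G S \<longleftrightarrow> S \<subseteq> fst G \<and> (\<forall>u\<in>S. \<forall>v\<in>S. u \<noteq> v \<longrightarrow> {u, v} \<in> snd G)"

definition independent :: "'a graph \<Rightarrow> 'a set \<Rightarrow> bool" where
  "independent G S \<longleftrightarrow> S \<subseteq> fst G \<and> (\<forall>u\<in>S. \<forall>v\<in>S. {u, v} \<notin> snd G)"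

definition split_graph :: "'a graph \<Rightarrow> bool" where
  "split_graph G \<longleftrightarrow> simple_graph G \<and>
     (\<exists>C I. C \<union> I = fst G \<and> C \<inter> I = {} \<and> clique G C \<and> independent G I)"

definition disjoint_union_of_split_graphs :: "'a graph \<Rightarrow> bool" where
  "disjoint_union_of_split_graphs G \<longleftrightarrow> simple_graph G \<and>
     (\<exists>\<H>. (\<forall>H\<in>\<H>. split_graph H) \<and> pairwise (\<lambda>H H'. disjnt (fst H) (fst H')) \<H> \<and>
        G = (\<Union>H\<in>\<H>. fst H, \<Union>H\<in>\<H>. snd H))"


section \<open>Algorithms\<close>

text \<open>
  The machine model is a random access machine with addition and (truncated) subtraction,
  programmed with structured control flow. The memory is divided into arrays, of which a program
  mentions only finitely many. Every executed command costs one unit; the expressions that occur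
  in a program have bounded size, so that this is the usual uniform cost up to a constant factor.
  As there is no multiplication, numbers computed in \<open>t\<close> steps have \<open>O(t)\<close> more bits than the
  input numbers, and the model is polynomially equivalent to Turing machines.
\<close>

type_synonym memory = "nat \<Rightarrow> nat \<Rightarrow> nat"

datatype expr = Const nat | Load nat expr | Plus expr expr | Minus expr expr

fun eval_expr :: "expr \<Rightarrow> memory \<Rightarrow> nat" where
  "eval_expr (Const n) s = n"
| "eval_expr (Load a e) s = s a (eval_expr e s)"
| "eval_expr (Plus e e') s = eval_expr e s + eval_expr e' s"
| "eval_expr (Minus e e') s = eval_expr e s - eval_expr e' s"

datatype com = Skip | Store nat expr expr | Seq com com | Cond expr com com | While expr com

inductive exec :: "com \<Rightarrow> memory \<Rightarrow> nat \<Rightarrow> memory \<Rightarrow> bool" where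
  Skip: "exec Skip s 1 s"
| Store: "exec (Store a e e') s 1 (s(a := (s a)(eval_expr e s := eval_expr e' s)))"
| Seq: "exec c s t s' \<Longrightarrow> exec c' s' t' s'' \<Longrightarrow> exec (Seq c c') s (t + t') s''"
| CondTrue: "eval_expr b s \<noteq> 0 \<Longrightarrow> exec c s t s' \<Longrightarrow> exec (Cond b c c') s (Suc t) s'"
| CondFalse: "eval_expr b s = 0 \<Longrightarrow> exec c' s t s' \<Longrightarrow> exec (Cond b c c') s (Suc t) s'"
| WhileTrue: "eval_expr b s \<noteq> 0 \<Longrightarrow> exec c s t s' \<Longrightarrow> exec (While b c) s' t' s'' \<Longrightarrow>
    exec (While b c) s (Suc (t + t')) s''"
| WhileFalse: "eval_expr b s = 0 \<Longrightarrow> exec (While b c) s 1 s"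

lemma exec_deterministic:
  assumes "exec c s t s'" "exec c s u s''"
  shows "t = u \<and> s' = s''"
  using assms
proof (induction arbitrary: u s'' rule: exec.induct)
  case (Skip s)
  then show ?case by (auto elim: exec.cases)
next
  case (Store a e e' s)
  then show ?case by (auto elim: exec.cases)
next
  case (Seq c s t s' c' t' r)
  from Seq.prems show ?case by cases (use Seq.IH in blast)
next
  case (CondTrue b s c t s' c')
  from CondTrue.prems show ?case by cases (use CondTrue in blast)+
next
  case (CondFalse b s c' t s' c)
  from CondFalse.prems show ?case by cases (use CondFalse in blast)+
next
  case (WhileTrue b s c t s' t' r)
  from WhileTrue.prems show ?case by cases (use WhileTrue in blast)+
next
  case (WhileFalse b s c)
  from WhileFalse.prems show ?case by cases (use WhileFalse in auto)
qed


section \<open>Parameterized problems and reductions\<close>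

text \<open>An input consists of a bit string and its parameter.\<close>

type_synonym input = "bool list \<times> nat"
type_synonym problem = "input set"

text \<open>
  The parameter is held in cell 0 of array 0 and the string in array 1, the bits being represented
  by 1 and 2. Blank cells are 0. In particular, a string produced by a program that runs for
  \<open>t\<close> steps is at most \<open>t\<close> symbols longer than the input string.
\<close>

definition symbol :: "bool list \<Rightarrow> nat \<Rightarrow> nat" where
  "symbol x i = (if i < length x then if x ! i then 2 else 1 else 0)"

definition initial_memory :: "input \<Rightarrow> memory" where
  "initial_memory y = (\<lambda>a i. if a = 0 \<and> i = 0 then snd y
     else if a = 1 then symbol (fst y) i else 0)"

definition holds_output :: "memory \<Rightarrow> input \<Rightarrow> bool" where
  "holds_output s y \<longleftrightarrow> s 0 0 = snd y \<and> (\<forall>i\<le>length (fst y). s 1 i = symbol (fst y) i)"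

lemma holds_output_unique:
  assumes "holds_output s y" "holds_output s z"
  shows "y = z"
proof -
  have *: "length (fst y) \<le> length (fst z)" if "holds_output s y" "holds_output s z" for y z
  proof (rule ccontr)
    assume "\<not> length (fst y) \<le> length (fst z)"
    then have "symbol (fst y) (length (fst z)) = symbol (fst z) (length (fst z))"
      using that unfolding holds_output_def by (metis le_refl nat_le_linear)
    then show False
      using \<open>\<not> length (fst y) \<le> length (fst z)\<close> by (auto simp: symbol_def split: if_splits)
  qed
  then have len: "length (fst y) = length (fst z)"
    using assms by (simp add: order_antisym)
  have "fst y ! i = fst z ! i" if "i < length (fst y)" for i
  proof -
    have "symbol (fst y) i = symbol (fst z) i"
      using assms that len unfolding holds_output_def by (metis less_imp_le)
    then show ?thesis using that len by (auto simp: symbol_def split: if_splits)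
  qed
  then have "fst y = fst z" using len by (simp add: nth_equalityI)
  moreover have "snd y = snd z" using assms by (simp add: holds_output_def)
  ultimately show ?thesis by (simp add: prod_eq_iff)
qed

definition computes_in_time :: "com \<Rightarrow> (input \<Rightarrow> input) \<Rightarrow> (input \<Rightarrow> nat) \<Rightarrow> bool" where
  "computes_in_time c r T \<longleftrightarrow>
     (\<forall>y. \<exists>t s. exec c (initial_memory y) t s \<and> t \<le> T y \<and> holds_output s (r y))"

definition computable :: "(nat \<Rightarrow> nat) \<Rightarrow> bool" where
  "computable f \<longleftrightarrow> (\<exists>c. \<forall>n. \<exists>t s. exec c (initial_memory ([], n)) t s \<and> s 0 0 = f n)"

text \<open>The successor in the time bound only matters for the empty string.\<close>

definition fpt_reduction :: "(input \<Rightarrow> input) \<Rightarrow> problem \<Rightarrow> problem \<Rightarrow> bool" where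
  "fpt_reduction r P Q \<longleftrightarrow>
     (\<forall>y. y \<in> P \<longleftrightarrow> r y \<in> Q) \<and>
     (\<exists>g. computable g \<and> (\<forall>x k. snd (r (x, k)) \<le> g k)) \<and>
     (\<exists>c f d. computable f \<and> computes_in_time c r (\<lambda>(x, k). f k * Suc (length x) ^ d))"

text \<open>
  Reducibility to the problem \<open>Q\<close> restricted to the inputs in \<open>I\<close>: the reduction must produce
  inputs from \<open>I\<close> only.
\<close>

definition fpt_reducible :: "problem \<Rightarrow> problem \<Rightarrow> input set \<Rightarrow> bool" where
  "fpt_reducible P Q I \<longleftrightarrow> (\<exists>r. fpt_reduction r P Q \<and> range r \<subseteq> I)"


section \<open>Boolean circuits and the W-hierarchy\<close>

text \<open>
  A circuit is an acyclic graph of gates, listed in a topological order; the last gate is the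
  output. Gates refer to their predecessors by position.
\<close>

datatype gate = InputGate | NotGate nat | AndGate "nat set" | OrGate "nat set"

type_synonym circuit = "gate list"

fun preds :: "gate \<Rightarrow> nat set" where
  "preds InputGate = {}"
| "preds (NotGate i) = {i}"
| "preds (AndGate A) = A"
| "preds (OrGate A) = A"

definition wf_circuit :: "circuit \<Rightarrow> bool" where
  "wf_circuit C \<longleftrightarrow> C \<noteq> [] \<and>
     (\<forall>j<length C. preds (C ! j) \<subseteq> {..<j} \<and>
        (\<forall>A. C ! j = AndGate A \<or> C ! j = OrGate A \<longrightarrow> 2 \<le> card A))"

definition input_gates :: "circuit \<Rightarrow> nat set" where
  "input_gates C = {j. j < length C \<and> C ! j = InputGate}"

text \<open>
  The value of gate \<open>j\<close> when exactly the input gates in \<open>S\<close> are true. The tests \<open>i < j\<close> serve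
  termination and hold in every well-formed circuit.
\<close>

function gate_value :: "circuit \<Rightarrow> nat set \<Rightarrow> nat \<Rightarrow> bool" where
  "gate_value C S j = (case C ! j of
     InputGate \<Rightarrow> j \<in> S
   | NotGate i \<Rightarrow> i < j \<longrightarrow> \<not> gate_value C S i
   | AndGate A \<Rightarrow> \<forall>i\<in>{i \<in> A. i < j}. gate_value C S i
   | OrGate A \<Rightarrow> \<exists>i\<in>{i \<in> A. i < j}. gate_value C S i)"
  by pat_completeness auto
termination by (relation "measure (\<lambda>(C, S, j). j)") auto

declare gate_value.simps [simp del]

definition output_path :: "circuit \<Rightarrow> nat list \<Rightarrow> bool" where
  "output_path C p \<longleftrightarrow> p \<noteq> [] \<and> hd p \<in> input_gates C \<and> last p = length C - 1 \<and>
     successively (\<lambda>i j. i \<in> preds (C ! j)) p"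

definition depth_at_most :: "circuit \<Rightarrow> nat \<Rightarrow> bool" where
  "depth_at_most C d \<longleftrightarrow> (\<forall>p. output_path C p \<longrightarrow> length p - 1 \<le> d)"

definition weft_at_most :: "circuit \<Rightarrow> nat \<Rightarrow> bool" where
  "weft_at_most C t \<longleftrightarrow>
     (\<forall>p. output_path C p \<longrightarrow> length (filter (\<lambda>j. 2 < card (preds (C ! j))) p) \<le> t)"

text \<open>Each gate is encoded by two bits for its kind and a row of the adjacency matrix.\<close>

fun gate_kind :: "gate \<Rightarrow> bool list" where
  "gate_kind InputGate = [False, False]"
| "gate_kind (NotGate i) = [False, True]"
| "gate_kind (AndGate A) = [True, False]"
| "gate_kind (OrGate A) = [True, True]"

definition circuit_code :: "circuit \<Rightarrow> bool list" where
  "circuit_code C =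
     concat (map (\<lambda>g. gate_kind g @ map (\<lambda>i. i \<in> preds g) [0..<length C]) C)"

lemma length_circuit_code: "length (circuit_code C) = length C * (length C + 2)"
proof -
  have "length (gate_kind g) = 2" for g by (cases g) auto
  then have "length (concat (map (\<lambda>g. gate_kind g @ map (\<lambda>i. i \<in> preds g) [0..<n]) D))
      = length D * (n + 2)" for n D
    by (induction D) (auto simp: algebra_simps)
  then show ?thesis by (simp add: circuit_code_def)
qed

lemma circuit_code_inject:
  assumes "wf_circuit C" "wf_circuit D" "circuit_code C = circuit_code D"
  shows "C = D"
proof -
  have len: "length C = length D"
  proof (rule ccontr)
    assume "length C \<noteq> length D"
    have mono: "m * (m + 2) < n * (n + 2)" if "m < n" for m n :: nat
      using that by (intro mult_strict_mono) auto
    have "length C * (length C + 2) \<noteq> length D * (length D + 2)"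
      using \<open>length C \<noteq> length D\<close> mono by (metis less_irrefl linorder_neqE_nat)
    then show False using assms(3) length_circuit_code by metis
  qed
  define n where "n = length C"
  define row where "row g = gate_kind g @ map (\<lambda>i. i \<in> preds g) [0..<n]" for g
  have kind: "length (gate_kind g) = 2" for g by (cases g) auto
  have "concat (map row C) = concat (map row D)"
    using assms(3) len by (simp add: circuit_code_def row_def[abs_def] n_def)
  then have rows: "map row C = map row D"
    using len by (subst (asm) concat_eq_concat_iff) (auto simp: row_def kind set_zip)
  have "C ! j = D ! j" if j: "j < n" for j
  proof -
    have "row (C ! j) = row (D ! j)"
      using rows j len by (metis n_def nth_map)
    then have k: "gate_kind (C ! j) = gate_kind (D ! j)"
      and "map (\<lambda>i. i \<in> preds (C ! j)) [0..<n] = map (\<lambda>i. i \<in> preds (D ! j)) [0..<n]"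
      by (simp_all add: row_def kind append_eq_append_conv del: map_eq_conv)
    then have r: "\<forall>i<n. i \<in> preds (C ! j) \<longleftrightarrow> i \<in> preds (D ! j)"
      by simp
    have "preds (C ! j) \<subseteq> {..<n}" "preds (D ! j) \<subseteq> {..<n}"
      using assms(1,2) j len unfolding wf_circuit_def n_def by fastforce+
    then have "preds (C ! j) = preds (D ! j)" using r by blast
    then show ?thesis using k by (cases "C ! j"; cases "D ! j") auto
  qed
  then show ?thesis using len by (simp add: n_def nth_equalityI)
qed

definition weighted_circuit_sat :: problem where
  "weighted_circuit_sat = {(circuit_code C, k) | C k. wf_circuit C \<and>
     (\<exists>S \<subseteq> input_gates C. card S = k \<and> gate_value C S (length C - 1))}"

definition weft_depth_inputs :: "nat \<Rightarrow> nat \<Rightarrow> input set" where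
  "weft_depth_inputs t d =
     {(circuit_code C, k) | C k. wf_circuit C \<and> weft_at_most C t \<and> depth_at_most C d}"

definition W_class :: "nat \<Rightarrow> problem set" where
  "W_class t = {P. \<exists>d\<ge>1. fpt_reducible P weighted_circuit_sat (weft_depth_inputs t d)}"

text \<open>Hardness for W[t] of the problem \<open>Q\<close> restricted to the inputs in \<open>I\<close>.\<close>

definition W_hard :: "nat \<Rightarrow> problem \<Rightarrow> input set \<Rightarrow> bool" where
  "W_hard t Q I \<longleftrightarrow> (\<forall>P\<in>W_class t. fpt_reducible P Q I)"


section \<open>The coloring problem\<close>

text \<open>Input graphs have vertex set \<open>{..<n}\<close> and are given by their adjacency matrix, row by row.\<close>

definition input_graph :: "nat graph \<Rightarrow> bool" where
  "input_graph G \<longleftrightarrow> simple_graph G \<and> fst G = {..<card (fst G)}"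

definition graph_code :: "nat graph \<Rightarrow> bool list" where
  "graph_code G = (let n = card (fst G) in
     map (\<lambda>p. {p div n, p mod n} \<in> snd G) [0..<n * n])"

lemma graph_code_inject:
  assumes "input_graph G" "input_graph H" "graph_code G = graph_code H"
  shows "G = H"
proof -
  define n where "n = card (fst G)"
  have "length (graph_code G) = length (graph_code H)" using assms(3) by simp
  then have n: "card (fst H) = n"
    by (simp add: graph_code_def Let_def n_def) (metis power2_eq_square power2_eq_iff_nonneg zero_le)
  have fst: "fst G = {..<n}" "fst H = {..<n}"
    using assms(1,2) n by (auto simp: input_graph_def n_def)
  have adj: "{u, v} \<in> snd G \<longleftrightarrow> {u, v} \<in> snd H" if "u < n" "v < n" for u v
  proof -
    have "u * n + v < Suc u * n" using that by simp
    also have "\<dots> \<le> n * n" using that by (intro mult_le_mono1) simp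
    finally have p: "u * n + v < n * n" .
    have "graph_code G ! (u * n + v) = graph_code H ! (u * n + v)" using assms(3) by simp
    then show ?thesis using p that n by (simp add: graph_code_def Let_def n_def[symmetric])
  qed
  have edge: "\<exists>u v. e = {u, v} \<and> u < n \<and> v < n"
    if "e \<in> snd K" "input_graph K" "fst K = {..<n}" for e K
    using that unfolding input_graph_def simple_graph_def by (fastforce simp: card_2_iff)
  have "snd G = snd H"
    using adj edge[OF _ assms(1) fst(1)] edge[OF _ assms(2) fst(2)] by blast
  then show ?thesis using fst by (simp add: prod_eq_iff)
qed

text \<open>The parameter is the number of colors.\<close>

definition EQUITABLE_TREE_COLORING :: problem where
  "EQUITABLE_TREE_COLORING = {(graph_code G, k) | G k. input_graph G \<and> 1 \<le> k \<and>
     (\<exists>c. equitable_tree_coloring G k c)}"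

definition disjoint_split_inputs :: "input set" where
  "disjoint_split_inputs = {(graph_code G, k) | G k. input_graph G \<and> 1 \<le> k \<and>
     disjoint_union_of_split_graphs G}"

end

theory Submission imports Defs begin

text \<open>
  Let a circuit of weft 1 and depth \<open>d\<close> have \<open>n\<close> gates, and let \<open>s\<^sub>1 < \<dots> < s\<^sub>k\<close> be the true inputs. An input is
  false iff it lies strictly between two consecutive \<open>s\<^sub>j\<close>, so the value of a gate below which
  all gates are small is certified by at most \<open>2\<^sup>d\<close> of the intervals \<open>[s\<^sub>j, s\<^sub>j\<^sub>+\<^sub>1)\<close>. If in addition one
  guesses a bounded set of claims about gates that explains why the output is true, then the circuit is satisfied
  iff a polynomial-time check succeeds for every choice of \<open>2\<^sup>d\<close> intervals.
  This is a system of equations between polynomially many values of \<open>poly(k)\<close> unknowns, and it becomes a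
  vector subset sum problem of dimension \<open>poly(k)\<close> with numbers in unary.

  For a vector sum problem in dimension \<open>D\<close>, use \<open>K = D + 1\<close> colors. A clique of \<open>2K\<close> vertices gets every color twice,
  and \<open>w\<close> pendant vertices adjacent to all clique vertices except \<open>v\<close> must have the color of \<open>v\<close>; so each clique
  distributes \<open>2K\<close> weights to the colors in pairs. Let the weights of a clique mark the vertices
  and edge midpoints of a convex \<open>K\<close>-gon. Prescribing the right sum for every color forces color \<open>p\<close> to take
  the midpoint of the \<open>p\<close>-th edge and one of its two ends, and then the whole clique is
  colored in one of two ways, namely by the first or by the second end of each edge. The
  difference between the two ways is an arbitrary vector, so the cliques encode a subset sum.
\<close>

section \<open>An expression language for lower elementary functions\<close>

text \<open>The obstacle is a gate of unbounded fan-in: that none of its predecessors has a certain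
  value is not a bounded set of facts. A violation is one, however. A path has a single large gate,
  below it every gate is small, and so a wrong value there follows from at most \<open>2 ^ d\<close>
  intervals. The claim at a large gate is therefore replaced by the absence of a refutation from any
  choice of \<open>2 ^ d\<close> intervals, and there are only \<open>(k + 1) ^ 2 ^ d\<close>
  choices. The claims leading from the output down to large gates form a tree whose size depends on
  \<open>d\<close> alone, so a number below a polynomial in \<open>n\<close> encodes them. Convexity
  forces the cliques for this reason: an affine functional that vanishes on edge \<open>p\<close>
  and is nonnegative on the polygon has total 0 over color \<open>p\<close>, because its total
  depends only on the prescribed sums of coordinates. So every mark of color \<open>p\<close> lies
  on edge \<open>p\<close>. Coordinates and vector entries are packed into one weight as digits to a
  large base.\<close>

text \<open>
  With bounded sums instead of recursion all values are polynomially bounded, so naive evaluation by nested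
  loops takes polynomial time. Variables are de Bruijn indices, and \<open>Inp\<close> reads the input string.
\<close>

datatype arith = Cst nat | Var nat | Inp arith | Bin bool arith arith | Sum arith arith

primrec lval :: "arith \<Rightarrow> (nat \<Rightarrow> nat) \<Rightarrow> (nat \<Rightarrow> nat) \<Rightarrow> nat" where
  "lval (Cst c) I \<sigma> = c"
| "lval (Var i) I \<sigma> = \<sigma> i"
| "lval (Inp e) I \<sigma> = I (lval e I \<sigma>)"
| "lval (Bin p d e) I \<sigma> = (if p then lval d I \<sigma> + lval e I \<sigma> else lval d I \<sigma> - lval e I \<sigma>)"
| "lval (Sum d e) I \<sigma> = (\<Sum>i<lval d I \<sigma>. lval e I (case_nat i \<sigma>))"

text \<open>
  Array \<open>a\<close> is used as a stack: variable \<open>i\<close> is stored in the cell \<open>\<rho> i < f\<close>, and the result is left in cell \<open>f\<close>.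
  The input string is in array \<open>b\<close>.
\<close>

primrec compile :: "nat \<Rightarrow> nat \<Rightarrow> arith \<Rightarrow> (nat \<Rightarrow> nat) \<Rightarrow> nat \<Rightarrow> com" where
  "compile a b (Cst c) \<rho> f = Store a (Const f) (Const c)"
| "compile a b (Var i) \<rho> f = Store a (Const f) (Load a (Const (\<rho> i)))"
| "compile a b (Inp e) \<rho> f = Seq (compile a b e \<rho> f) (Store a (Const f) (Load b (Load a (Const f))))"
| "compile a b (Bin p d e) \<rho> f = Seq (compile a b d \<rho> f) (Seq (compile a b e \<rho> (Suc f))
     (Store a (Const f) ((if p then Plus else Minus) (Load a (Const f)) (Load a (Const (Suc f))))))"
| "compile a b (Sum d e) \<rho> f = Seq (compile a b d \<rho> (f + 1)) (Seq (Store a (Const f) (Const 0))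
     (Seq (Store a (Const (f + 2)) (Const 0))
     (While (Minus (Load a (Const (f + 1))) (Load a (Const (f + 2))))
       (Seq (compile a b e (case_nat (f + 2) \<rho>) (f + 3))
       (Seq (Store a (Const f) (Plus (Load a (Const f)) (Load a (Const (f + 3)))))
            (Store a (Const (f + 2)) (Plus (Load a (Const (f + 2))) (Const 1))))))))"

primrec ctime :: "arith \<Rightarrow> (nat \<Rightarrow> nat) \<Rightarrow> (nat \<Rightarrow> nat) \<Rightarrow> nat" where
  "ctime (Cst c) I \<sigma> = 1"
| "ctime (Var i) I \<sigma> = 1"
| "ctime (Inp e) I \<sigma> = ctime e I \<sigma> + 1"
| "ctime (Bin p d e) I \<sigma> = ctime d I \<sigma> + (ctime e I \<sigma> + 1)"
| "ctime (Sum d e) I \<sigma> = ctime d I \<sigma> + (1 + (1 +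
     (1 + (\<Sum>i<lval d I \<sigma>. Suc (ctime e I (case_nat i \<sigma>) + (1 + 1))))))"

lemma exec_Store: "s' = s(a := (s a)(eval_expr e s := eval_expr e' s)) \<Longrightarrow> exec (Store a e e') s 1 s'"
  using exec.Store by simp

text \<open>In nested sums the cost of a round depends on its index, hence the exact cost function
  \<open>T\<close> in place of a uniform bound.\<close>

lemma exec_While_count:
  assumes step: "\<And>i s. i < n \<Longrightarrow> Inv i s \<Longrightarrow> eval_expr b s \<noteq> 0 \<and> (\<exists>s'. exec c s (T i) s' \<and> Inv (Suc i) s')"
    and stop: "\<And>s. Inv n s \<Longrightarrow> eval_expr b s = 0"
    and init: "Inv 0 s"
  shows "\<exists>s'. exec (While b c) s (1 + (\<Sum>i<n. Suc (T i))) s' \<and> Inv n s'"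
proof -
  \<comment> \<open>Induction on the number \<open>m\<close> of rounds that remain, because
    \<open>WhileTrue\<close> splits off the first round.\<close>
  have "\<exists>s'. exec (While b c) s (1 + (\<Sum>i\<in>{n - m..<n}. Suc (T i))) s' \<and> Inv n s'"
    if "m \<le> n" "Inv (n - m) s" for m s
    using that
  proof (induction m arbitrary: s)
    case 0
    then have "exec (While b c) s 1 s" using stop WhileFalse by simp
    then show ?case using 0 by auto
  next
    case (Suc m)
    have lt: "n - Suc m < n" and eq: "Suc (n - Suc m) = n - m" using Suc.prems by auto
    obtain s' where s': "eval_expr b s \<noteq> 0" "exec c s (T (n - Suc m)) s'" "Inv (n - m) s'"
      using step[OF lt Suc.prems(2)] eq by auto
    obtain s'' where s'': "exec (While b c) s' (1 + (\<Sum>i\<in>{n - m..<n}. Suc (T i))) s''" "Inv n s''"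
      using Suc.IH[OF _ s'(3)] Suc.prems by auto
    have "(\<Sum>i\<in>{n - Suc m..<n}. Suc (T i)) = Suc (T (n - Suc m)) + (\<Sum>i\<in>{n - m..<n}. Suc (T i))"
      using lt eq by (metis sum.atLeast_Suc_lessThan)
    then show ?case using WhileTrue[OF s'(1,2) s''(1)] s''(2) by (auto simp: algebra_simps)
  qed
  from this[of n s] init show ?thesis by (simp add: atLeast0LessThan)
qed

text \<open>The stack discipline carries the induction: cells below \<open>f\<close> hold variables
  and partial results and survive, cells from \<open>f\<close> on are scratch. Distinct arrays keep
  the string intact for \<open>Inp\<close>.\<close>

lemma compile_correct:
  assumes "\<And>i. \<rho> i < f \<and> s a (\<rho> i) = \<sigma> i" and "s b = I" and "a \<noteq> b"
  shows "\<exists>s'. exec (compile a b e \<rho> f) s (ctime e I \<sigma>) s' \<and> s' a f = lval e I \<sigma> \<and>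
    (\<forall>c. c \<noteq> a \<longrightarrow> s' c = s c) \<and> (\<forall>i<f. s' a i = s a i)"
  using assms(1,2)
proof (induction e arbitrary: \<rho> f s \<sigma>)
  case (Cst c)
  show ?case by (unfold compile.simps ctime.simps, rule exI, rule conjI, rule exec_Store, rule refl) simp
next
  case (Var i)
  show ?case by (unfold compile.simps ctime.simps, rule exI, rule conjI, rule exec_Store, rule refl) (simp add: Var)
next
  case (Inp e)
  obtain s1 where s1: "exec (compile a b e \<rho> f) s (ctime e I \<sigma>) s1" "s1 a f = lval e I \<sigma>"
    "\<forall>c. c \<noteq> a \<longrightarrow> s1 c = s c" "\<forall>i<f. s1 a i = s a i"
    using Inp.IH[of \<rho> f s \<sigma>] Inp.prems by blast
  show ?case
    by (unfold compile.simps ctime.simps, rule exI, rule conjI, rule exec.Seq[OF s1(1)], rule exec_Store, rule refl)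
      (use s1 assms(3) Inp.prems in auto)
next
  case (Bin p d e)
  obtain s1 where s1: "exec (compile a b d \<rho> f) s (ctime d I \<sigma>) s1" "s1 a f = lval d I \<sigma>"
    "\<forall>c. c \<noteq> a \<longrightarrow> s1 c = s c" "\<forall>i<f. s1 a i = s a i"
    using Bin.IH(1)[of \<rho> f s \<sigma>] Bin.prems by blast
  have "\<And>i. \<rho> i < Suc f \<and> s1 a (\<rho> i) = \<sigma> i" "s1 b = I"
    using s1 Bin.prems assms(3) by (auto simp: less_SucI)
  then obtain s2 where s2: "exec (compile a b e \<rho> (Suc f)) s1 (ctime e I \<sigma>) s2"
    "s2 a (Suc f) = lval e I \<sigma>" "\<forall>c. c \<noteq> a \<longrightarrow> s2 c = s1 c" "\<forall>i<Suc f. s2 a i = s1 a i"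
    using Bin.IH(2)[of \<rho> "Suc f" s1 \<sigma>] by blast
  show ?case
    by (unfold compile.simps ctime.simps, rule exI, rule conjI, rule exec.Seq[OF s1(1)], rule exec.Seq[OF s2(1)], rule exec_Store, rule refl)
      (use s1 s2 in auto)
next
  case (Sum d e)
  define n where "n = lval d I \<sigma>"
  have "\<And>i. \<rho> i < f + 1 \<and> s a (\<rho> i) = \<sigma> i" using Sum.prems by (auto simp: less_SucI)
  then obtain s1 where s1: "exec (compile a b d \<rho> (f + 1)) s (ctime d I \<sigma>) s1" "s1 a (f + 1) = n"
    "\<forall>c. c \<noteq> a \<longrightarrow> s1 c = s c" "\<forall>i<f + 1. s1 a i = s a i"
    using Sum.IH(1)[of \<rho> "f + 1" s \<sigma>] Sum.prems n_def by blast
  define s2 where "s2 = s1(a := (s1 a)(f := 0))"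
  define s3 where "s3 = s2(a := (s2 a)(f + 2 := 0))"
  have e2: "exec (Store a (Const f) (Const 0)) s1 1 s2" by (rule exec_Store) (simp add: s2_def)
  have e3: "exec (Store a (Const (f + 2)) (Const 0)) s2 1 s3" by (rule exec_Store) (simp add: s3_def)
  define Inv where "Inv = (\<lambda>i r. r a f = (\<Sum>j<i. lval e I (case_nat j \<sigma>)) \<and> r a (f + 1) = n \<and>
    r a (f + 2) = i \<and> (\<forall>c. c \<noteq> a \<longrightarrow> r c = s c) \<and> (\<forall>i<f. r a i = s a i))"
  let ?b = "Minus (Load a (Const (f + 1))) (Load a (Const (f + 2)))"
  let ?body = "Seq (compile a b e (case_nat (f + 2) \<rho>) (f + 3))
       (Seq (Store a (Const f) (Plus (Load a (Const f)) (Load a (Const (f + 3)))))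
            (Store a (Const (f + 2)) (Plus (Load a (Const (f + 2))) (Const 1))))"
  have "\<exists>s'. exec (While ?b ?body) s3 (1 + (\<Sum>i<n. Suc (ctime e I (case_nat i \<sigma>) + (1 + 1)))) s' \<and> Inv n s'"
  proof (rule exec_While_count)
    fix i r assume i: "i < n" and r: "Inv i r"
    have pre: "\<And>j. case_nat (f + 2) \<rho> j < f + 3 \<and> r a (case_nat (f + 2) \<rho> j) = case_nat i \<sigma> j"
      using r Sum.prems by (auto simp: Inv_def trans_less_add1 split: nat.splits)
    have "r b = I" using r Sum.prems assms(3) by (auto simp: Inv_def)
    then obtain r1 where r1: "exec (compile a b e (case_nat (f + 2) \<rho>) (f + 3)) r (ctime e I (case_nat i \<sigma>)) r1"
      "r1 a (f + 3) = lval e I (case_nat i \<sigma>)" "\<forall>c. c \<noteq> a \<longrightarrow> r1 c = r c" "\<forall>j<f + 3. r1 a j = r a j"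
      using Sum.IH(2)[of "case_nat (f + 2) \<rho>" "f + 3" r "case_nat i \<sigma>"] pre by blast
    have "eval_expr ?b r \<noteq> 0" using i r by (simp add: Inv_def)
    moreover have "\<exists>s'. exec ?body r (ctime e I (case_nat i \<sigma>) + (1 + 1)) s' \<and> Inv (Suc i) s'"
      by (rule exI, rule conjI, rule exec.Seq[OF r1(1)], rule exec.Seq, (rule exec_Store, rule refl)+)
        (use r r1 in \<open>auto simp: Inv_def\<close>)
    ultimately show "eval_expr ?b r \<noteq> 0 \<and> (\<exists>s'. exec ?body r (ctime e I (case_nat i \<sigma>) + (1 + 1)) s' \<and> Inv (Suc i) s')"
      by blast
  next
    fix r assume "Inv n r" then show "eval_expr ?b r = 0" by (simp add: Inv_def)
  next
    show "Inv 0 s3" using s1 by (auto simp: Inv_def s3_def s2_def)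
  qed
  then obtain s4 where s4: "exec (While ?b ?body) s3 (1 + (\<Sum>i<n. Suc (ctime e I (case_nat i \<sigma>) + (1 + 1)))) s4" "Inv n s4"
    by blast
  have "exec (compile a b (Sum d e) \<rho> f) s (ctime (Sum d e) I \<sigma>) s4"
    unfolding compile.simps ctime.simps n_def[symmetric]
    by (rule exec.Seq[OF s1(1) exec.Seq[OF e2 exec.Seq[OF e3 s4(1)]]])
  then show ?case using s4(2) by (auto simp: Inv_def n_def)
qed

section \<open>Polynomial bounds for values and running times\<close>

lemma le_power_of_mult:
  fixes X :: nat
  assumes "T \<le> c * X ^ e" "2 \<le> X"
  shows "T \<le> X ^ (c + e)"
proof -
  have "c \<le> X ^ c" using assms(2) by (meson less_exp less_imp_le order_trans power_mono zero_le)
  then show ?thesis using assms(1) by (simp add: power_add) (meson mult_le_mono1 order_trans)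
qed

text \<open>Only a sum extends the environment, by an index below a polynomially bounded limit, and
  polynomials are closed under composition. The degree is chosen before \<open>I\<close>,
  \<open>\<sigma>\<close> and \<open>X\<close>, so it is uniform over all inputs.\<close>

lemma lval_ctime_bound:
  "\<exists>d. \<forall>I \<sigma> X. 2 \<le> X \<longrightarrow> (\<forall>i. I i \<le> X) \<longrightarrow> (\<forall>i. \<sigma> i \<le> X) \<longrightarrow> lval e I \<sigma> \<le> X ^ d \<and> ctime e I \<sigma> \<le> X ^ d"
proof (induction e)
  case (Cst c)
  show ?case
  proof (intro exI allI impI)
    fix I \<sigma> :: "nat \<Rightarrow> nat" and X :: nat assume X: "2 \<le> X"
    have "c \<le> X ^ (c + 0)" by (rule le_power_of_mult) (use X in auto)
    moreover have "1 \<le> X ^ c" using X by simp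
    ultimately show "lval (Cst c) I \<sigma> \<le> X ^ c \<and> ctime (Cst c) I \<sigma> \<le> X ^ c" by simp
  qed
next
  case (Var i)
  show ?case by (rule exI[of _ 1]) auto
next
  case (Inp e)
  then obtain d where d: "\<And>I \<sigma> X. 2 \<le> X \<Longrightarrow> (\<forall>i. I i \<le> X) \<Longrightarrow> (\<forall>i. \<sigma> i \<le> X) \<Longrightarrow> lval e I \<sigma> \<le> X ^ d \<and> ctime e I \<sigma> \<le> X ^ d"
    by blast
  show ?case
  proof (intro exI allI impI)
    fix I \<sigma> :: "nat \<Rightarrow> nat" and X :: nat assume X: "2 \<le> X" and I: "\<forall>i. I i \<le> X" and s: "\<forall>i. \<sigma> i \<le> X"
    have "1 \<le> X ^ d" using X by simp
    then have "ctime (Inp e) I \<sigma> \<le> 2 * X ^ d" using d[OF X I s] by simp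
    then have "ctime (Inp e) I \<sigma> \<le> X ^ (2 + d)" using le_power_of_mult X by blast
    moreover have "X \<le> X ^ (2 + d)" using X by (simp add: self_le_power)
    ultimately show "lval (Inp e) I \<sigma> \<le> X ^ (2 + d) \<and> ctime (Inp e) I \<sigma> \<le> X ^ (2 + d)"
      using I by (auto intro: order_trans)
  qed
next
  case (Bin p e1 e2)
  then obtain d1 d2 where d: "\<And>I \<sigma> X. 2 \<le> X \<Longrightarrow> (\<forall>i. I i \<le> X) \<Longrightarrow> (\<forall>i. \<sigma> i \<le> X) \<Longrightarrow> lval e1 I \<sigma> \<le> X ^ d1 \<and> ctime e1 I \<sigma> \<le> X ^ d1"
    "\<And>I \<sigma> X. 2 \<le> X \<Longrightarrow> (\<forall>i. I i \<le> X) \<Longrightarrow> (\<forall>i. \<sigma> i \<le> X) \<Longrightarrow> lval e2 I \<sigma> \<le> X ^ d2 \<and> ctime e2 I \<sigma> \<le> X ^ d2"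
    by blast
  show ?case
  proof (intro exI allI impI)
    fix I \<sigma> :: "nat \<Rightarrow> nat" and X :: nat assume X: "2 \<le> X" and I: "\<forall>i. I i \<le> X" and s: "\<forall>i. \<sigma> i \<le> X"
    have *: "X ^ d1 \<le> X ^ (d1 + d2)" "X ^ d2 \<le> X ^ (d1 + d2)" "1 \<le> X ^ (d1 + d2)" using X by (auto intro: power_increasing)
    have "lval (Bin p e1 e2) I \<sigma> \<le> 3 * X ^ (d1 + d2)" "ctime (Bin p e1 e2) I \<sigma> \<le> 3 * X ^ (d1 + d2)"
      using d[OF X I s] * unfolding lval.simps ctime.simps by (auto split: if_splits)
    then show "lval (Bin p e1 e2) I \<sigma> \<le> X ^ (3 + (d1 + d2)) \<and> ctime (Bin p e1 e2) I \<sigma> \<le> X ^ (3 + (d1 + d2))"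
      using le_power_of_mult X by blast
  qed
next
  case (Sum e1 e2)
  then obtain d1 d2 where d: "\<And>I \<sigma> X. 2 \<le> X \<Longrightarrow> (\<forall>i. I i \<le> X) \<Longrightarrow> (\<forall>i. \<sigma> i \<le> X) \<Longrightarrow> lval e1 I \<sigma> \<le> X ^ d1 \<and> ctime e1 I \<sigma> \<le> X ^ d1"
    "\<And>I \<sigma> X. 2 \<le> X \<Longrightarrow> (\<forall>i. I i \<le> X) \<Longrightarrow> (\<forall>i. \<sigma> i \<le> X) \<Longrightarrow> lval e2 I \<sigma> \<le> X ^ d2 \<and> ctime e2 I \<sigma> \<le> X ^ d2"
    by blast
  define E where "E = d1 + Suc d1 * d2"
  show ?case
  proof (intro exI allI impI)
    fix I \<sigma> :: "nat \<Rightarrow> nat" and X :: nat assume X: "2 \<le> X" and I: "\<forall>i. I i \<le> X" and s: "\<forall>i. \<sigma> i \<le> X"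
    \<comment> \<open>\<open>?Y\<close> bounds the old environment and the new index together; the
      successor in the exponent gives \<open>X \<le> ?Y\<close> even for
      \<open>d1 = 0\<close>.\<close>
    let ?n = "lval e1 I \<sigma>" and ?Y = "X ^ Suc d1"
    have n: "?n \<le> X ^ d1" "ctime e1 I \<sigma> \<le> X ^ d1" using d(1)[OF X I s] by auto
    have XY: "X \<le> ?Y" using X by (simp add: self_le_power)
    have Y: "2 \<le> ?Y" "\<forall>i. I i \<le> ?Y" using X XY I by (auto intro: order_trans)
    have dY: "X ^ d1 \<le> ?Y" using X by (intro power_increasing) auto
    have b: "lval e2 I (case_nat i \<sigma>) \<le> ?Y ^ d2 \<and> ctime e2 I (case_nat i \<sigma>) \<le> ?Y ^ d2" if "i < ?n" for i
    proof -
      have "i \<le> ?Y" using that n(1) dY by linarith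
      then have "\<forall>j. case_nat i \<sigma> j \<le> ?Y"
        using s XY by (metis nat.case_eq_if order_trans)
      then show ?thesis using d(2)[OF Y] by blast
    qed
    have YE: "X ^ d1 * ?Y ^ d2 = X ^ E" by (simp only: E_def power_add power_mult)
    have P1: "1 \<le> ?Y ^ d2" "1 \<le> X ^ E" "X ^ d1 \<le> X ^ E" using X by (auto simp: E_def intro: power_increasing)
    have "(\<Sum>i<?n. lval e2 I (case_nat i \<sigma>)) \<le> (\<Sum>i<?n. ?Y ^ d2)" using b by (intro sum_mono) auto
    also have "\<dots> = ?n * ?Y ^ d2" by simp
    also have "\<dots> \<le> X ^ E" unfolding YE[symmetric] using n by (intro mult_le_mono1) auto
    finally have v: "lval (Sum e1 e2) I \<sigma> \<le> 8 * X ^ E" by simp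
    have "(\<Sum>i<?n. Suc (ctime e2 I (case_nat i \<sigma>) + (1 + 1))) \<le> (\<Sum>i<?n. 4 * ?Y ^ d2)"
    proof (intro sum_mono)
      fix i assume "i \<in> {..<?n}"
      then have "ctime e2 I (case_nat i \<sigma>) \<le> ?Y ^ d2" using b by auto
      then show "Suc (ctime e2 I (case_nat i \<sigma>) + (1 + 1)) \<le> 4 * ?Y ^ d2" using P1(1) by linarith
    qed
    also have "\<dots> = 4 * (?n * ?Y ^ d2)" by simp
    also have "\<dots> \<le> 4 * X ^ E" unfolding YE[symmetric] using n by (intro mult_le_mono) auto
    finally have "ctime (Sum e1 e2) I \<sigma> \<le> 8 * X ^ E" using n(2) P1 unfolding ctime.simps by linarith
    then show "lval (Sum e1 e2) I \<sigma> \<le> X ^ (8 + E) \<and> ctime (Sum e1 e2) I \<sigma> \<le> X ^ (8 + E)"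
      using v le_power_of_mult X by blast
  qed
qed


section \<open>Running programs after each other\<close>

text \<open>Arrays from this index on are never touched, so they are fresh memory for a program that
  runs afterwards.\<close>

primrec write_bound :: "com \<Rightarrow> nat" where
  "write_bound Skip = 0"
| "write_bound (Store a e e') = Suc a"
| "write_bound (Seq c c') = max (write_bound c) (write_bound c')"
| "write_bound (Cond b c c') = max (write_bound c) (write_bound c')"
| "write_bound (While b c) = write_bound c"

lemma exec_frame: "exec c s t s' \<Longrightarrow> write_bound c \<le> a \<Longrightarrow> s' a = s a"
  by (induction rule: exec.induct) auto

text \<open>A step stores into at most one cell. This bounds the length of an output, since the
  output cells beyond the end of the input were blank before.\<close>

lemma exec_card_changes:
  "exec c s t s' \<Longrightarrow> finite {i. s' a i \<noteq> s a i} \<and> card {i. s' a i \<noteq> s a i} \<le> t"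
proof (induction rule: exec.induct)
  case (Store b e e' s)
  have "{i. (s(b := (s b)(eval_expr e s := eval_expr e' s))) a i \<noteq> s a i} \<subseteq> {eval_expr e s}"
    by (auto split: if_splits)
  from finite_subset[OF this] card_mono[OF _ this] show ?case by simp
next
  case (Seq c s t s' c' t' s'')
  have sub: "{i. s'' a i \<noteq> s a i} \<subseteq> {i. s' a i \<noteq> s a i} \<union> {i. s'' a i \<noteq> s' a i}" by auto
  then have "card {i. s'' a i \<noteq> s a i} \<le> card ({i. s' a i \<noteq> s a i} \<union> {i. s'' a i \<noteq> s' a i})"
    using Seq.IH by (intro card_mono) auto
  also have "\<dots> \<le> t + t'" using Seq.IH card_Un_le by (meson add_mono le_trans)
  finally show ?case using sub Seq.IH finite_subset by blast
next
  case (WhileTrue b s c t s' t' s'')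
  have sub: "{i. s'' a i \<noteq> s a i} \<subseteq> {i. s' a i \<noteq> s a i} \<union> {i. s'' a i \<noteq> s' a i}" by auto
  then have "card {i. s'' a i \<noteq> s a i} \<le> card ({i. s' a i \<noteq> s a i} \<union> {i. s'' a i \<noteq> s' a i})"
    using WhileTrue.IH by (intro card_mono) auto
  also have "\<dots> \<le> t + t'" using WhileTrue.IH card_Un_le by (meson add_mono le_trans)
  finally show ?case using sub WhileTrue.IH finite_subset by fastforce
qed auto

lemma exec_output_length:
  assumes "exec c (initial_memory (x, k)) t s" "holds_output s (x', k')"
  shows "length x' \<le> length x + t"
proof -
  let ?C = "{i. s 1 i \<noteq> initial_memory (x, k) 1 i}"
  have "{length x..<length x'} \<subseteq> ?C"
    using assms(2) by (auto simp: holds_output_def initial_memory_def symbol_def)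
  then have "card {length x..<length x'} \<le> card ?C"
    using exec_card_changes[OF assms(1)] by (intro card_mono) auto
  then show ?thesis using exec_card_changes[OF assms(1), of 1] unfolding card_atLeastLessThan by linarith
qed

text \<open>Every program expects its argument in array 0; renaming arrays lets a second program run
  without disturbing the argument and result of the first.\<close>

primrec shift_expr :: "nat \<Rightarrow> expr \<Rightarrow> expr" where
  "shift_expr m (Const n) = Const n"
| "shift_expr m (Load a e) = Load (a + m) (shift_expr m e)"
| "shift_expr m (Plus e e') = Plus (shift_expr m e) (shift_expr m e')"
| "shift_expr m (Minus e e') = Minus (shift_expr m e) (shift_expr m e')"

primrec shift_com :: "nat \<Rightarrow> com \<Rightarrow> com" where
  "shift_com m Skip = Skip"
| "shift_com m (Store a e e') = Store (a + m) (shift_expr m e) (shift_expr m e')"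
| "shift_com m (Seq c c') = Seq (shift_com m c) (shift_com m c')"
| "shift_com m (Cond b c c') = Cond (shift_expr m b) (shift_com m c) (shift_com m c')"
| "shift_com m (While b c) = While (shift_expr m b) (shift_com m c)"

definition shift_memory :: "nat \<Rightarrow> memory \<Rightarrow> memory \<Rightarrow> memory" where
  "shift_memory m r s = (\<lambda>a. if a < m then r a else s (a - m))"

lemma eval_shift: "eval_expr (shift_expr m e) (shift_memory m r s) = eval_expr e s"
  by (induction e) (auto simp: shift_memory_def)

lemma exec_shift: "exec c s t s' \<Longrightarrow> exec (shift_com m c) (shift_memory m r s) t (shift_memory m r s')"
proof (induction rule: exec.induct)
  case (Store a e e' s)
  show ?case unfolding shift_com.simps
    by (rule exec_Store) (auto simp: eval_shift[unfolded shift_memory_def] shift_memory_def fun_eq_iff)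
qed (auto intro: exec.intros exec.intros[unfolded One_nat_def] simp: eval_shift)

definition definable :: "((nat \<Rightarrow> nat) \<Rightarrow> (nat \<Rightarrow> nat) \<Rightarrow> nat) \<Rightarrow> bool" where
  "definable F \<longleftrightarrow> (\<exists>e. \<forall>I \<sigma>. lval e I \<sigma> = F I \<sigma>)"

text \<open>Each program receives its own copy of the argument, at the bottom of its own range of
  arrays. The lemma builds the computable bounds of a composed reduction from those of the given
  one.\<close>

lemma computable_definable:
  assumes "computable f" "computable g" "definable (\<lambda>I \<sigma>. h (\<sigma> 0) (\<sigma> 1))"
  shows "computable (\<lambda>n. h (f n) (g n))"
proof -
  obtain cf where cf: "\<And>n. \<exists>t s. exec cf (initial_memory ([], n)) t s \<and> s 0 0 = f n"
    using assms(1) by (auto simp: computable_def)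
  obtain cg where cg: "\<And>n. \<exists>t s. exec cg (initial_memory ([], n)) t s \<and> s 0 0 = g n"
    using assms(2) by (auto simp: computable_def)
  obtain e where e: "\<And>I \<sigma>. lval e I \<sigma> = h (\<sigma> 0) (\<sigma> 1)"
    using assms(3) by (auto simp: definable_def)
  \<comment> \<open>The lower bound 2 protects array 1, which holds the result of \<open>cf\<close>,
    from the second program.\<close>
  define m where "m = max 2 (write_bound (shift_com 1 cf))"
  define a where "a = max (Suc m) (write_bound (shift_com m cg))"
  define P where "P = Seq (Store 1 (Const 0) (Load 0 (Const 0))) (Seq (shift_com 1 cf)
    (Seq (Store m (Const 0) (Load 0 (Const 0))) (Seq (shift_com m cg)
    (Seq (Store a (Const 0) (Load 1 (Const 0))) (Seq (Store a (Const 1) (Load m (Const 0)))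
    (Seq (compile a (Suc a) e (\<lambda>i. min i 2) 3) (Store 0 (Const 0) (Load a (Const 3)))))))))"
  have "\<exists>t s. exec P (initial_memory ([], n)) t s \<and> s 0 0 = h (f n) (g n)" for n
  proof -
    define s0 where "s0 = initial_memory ([], n)"
    have s0: "s0 = (\<lambda>a i. if a = 0 \<and> i = 0 then n else 0)"
      by (auto simp: s0_def initial_memory_def symbol_def fun_eq_iff)
    define s1 where "s1 = s0(1 := (s0 1)(0 := n))"
    have x1: "exec (Store 1 (Const 0) (Load 0 (Const 0))) s0 1 s1"
      by (rule exec_Store) (simp add: s1_def s0)
    have "s1 = shift_memory 1 s0 s0" by (auto simp: s1_def shift_memory_def s0 fun_eq_iff)
    moreover obtain t1 r1 where r1: "exec cf s0 t1 r1" "r1 0 0 = f n" using cf s0_def by blast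
    ultimately have x2: "exec (shift_com 1 cf) s1 t1 (shift_memory 1 s0 r1)" using exec_shift by metis
    define s2 where "s2 = shift_memory 1 s0 r1"
    have s2: "s2 1 0 = f n" "s2 0 0 = n" by (simp_all add: s2_def shift_memory_def r1 s0)
    have s2z: "s2 b = (\<lambda>_. 0)" if "m \<le> b" for b
    proof -
      have "s2 b = s1 b" using exec_frame[OF x2, of b] that by (simp add: m_def s2_def)
      then show ?thesis using that by (auto simp: m_def s1_def s0)
    qed
    define s3 where "s3 = s2(m := (s2 m)(0 := n))"
    have x3: "exec (Store m (Const 0) (Load 0 (Const 0))) s2 1 s3"
      by (rule exec_Store) (simp add: s3_def s2)
    have "s3 = shift_memory m s2 s0"
      using s2z by (auto simp: s3_def shift_memory_def s0 fun_eq_iff)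
    moreover obtain t2 r2 where r2: "exec cg s0 t2 r2" "r2 0 0 = g n" using cg s0_def by blast
    ultimately have x4: "exec (shift_com m cg) s3 t2 (shift_memory m s2 r2)" using exec_shift by metis
    define s4 where "s4 = shift_memory m s2 r2"
    have s4: "s4 m 0 = g n" "s4 1 0 = f n" using s2 r2 by (auto simp: s4_def shift_memory_def m_def)
    have s4z: "s4 b = (\<lambda>_. 0)" if "a \<le> b" for b
    proof -
      have "s4 b = s3 b" using exec_frame[OF x4, of b] that by (simp add: a_def s4_def)
      then show ?thesis using that s2z[of b] by (auto simp: a_def s3_def)
    qed
    define s5 where "s5 = s4(a := (s4 a)(0 := f n))"
    have ma: "m < a" "1 < a" by (auto simp: a_def m_def)
    have x5: "exec (Store a (Const 0) (Load 1 (Const 0))) s4 1 s5"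
      by (rule exec_Store) (simp add: s5_def s4[unfolded One_nat_def])
    define s6 where "s6 = s5(a := (s5 a)(1 := g n))"
    have x6: "exec (Store a (Const 1) (Load m (Const 0))) s5 1 s6"
      by (rule exec_Store) (use ma s4 in \<open>simp add: s6_def s5_def\<close>)
    define \<sigma> where "\<sigma> = (\<lambda>i::nat. if i = 0 then f n else if i = 1 then g n else (0::nat))"
    have "\<And>i. min i 2 < 3 \<and> s6 a (min i 2) = \<sigma> i"
      using s4z[of a] by (auto simp: s6_def s5_def \<sigma>_def min_def)
    then obtain s7 where s7: "exec (compile a (Suc a) e (\<lambda>i. min i 2) 3) s6 (ctime e (s6 (Suc a)) \<sigma>) s7"
      "s7 a 3 = lval e (s6 (Suc a)) \<sigma>"
      using compile_correct[of "\<lambda>i. min i 2" 3 s6 a \<sigma> "Suc a" "s6 (Suc a)" e] by auto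
    have v: "s7 a 3 = h (f n) (g n)" using s7(2) e by (simp add: \<sigma>_def)
    have "exec (Store 0 (Const 0) (Load a (Const 3))) s7 1 (s7(0 := (s7 0)(0 := s7 a 3)))"
      by (rule exec_Store) simp
    note run = exec.Seq[OF x1 exec.Seq[OF x2[folded s2_def] exec.Seq[OF x3 exec.Seq[OF x4[folded s4_def]
          exec.Seq[OF x5 exec.Seq[OF x6 exec.Seq[OF s7(1) this]]]]]]]
    show ?thesis unfolding P_def s0_def[symmetric] by (rule exI, rule exI, rule conjI, rule run) (simp add: v)
  qed
  then show ?thesis unfolding computable_def by blast
qed

text \<open>
  The input is first moved to array \<open>b\<close>, since the output replaces it. Cells 0, 1 and 2 of array \<open>a\<close> hold the
  position in the output, the parameter and the input length; cell 3 stays 0 and stands for all other variables.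
\<close>

definition transducer :: "nat \<Rightarrow> nat \<Rightarrow> arith \<Rightarrow> arith \<Rightarrow> arith \<Rightarrow> com" where
  "transducer a b eK eL eB =
    Seq (While (Load 1 (Load a (Const 2)))
          (Seq (Store b (Load a (Const 2)) (Load 1 (Load a (Const 2))))
               (Store a (Const 2) (Plus (Load a (Const 2)) (Const 1)))))
    (Seq (Store a (Const 1) (Load 0 (Const 0)))
    (Seq (compile a b eK (\<lambda>i. min i 3) 4)
    (Seq (Store 0 (Const 0) (Load a (Const 4)))
    (Seq (compile a b eL (\<lambda>i. min i 3) 5)
    (Seq (While (Minus (Load a (Const 5)) (Load a (Const 0)))
          (Seq (compile a b eB (\<lambda>i. min i 3) 6)
          (Seq (Store 1 (Load a (Const 0)) (Plus (Const 1) (Load a (Const 6))))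
               (Store a (Const 0) (Plus (Load a (Const 0)) (Const 1))))))
    (Store 1 (Load a (Const 0)) (Const 0)))))))"

lemma transducer_exec:
  assumes a: "a = Suc b" "1 < b" and s: "holds_output s (x, k)" "s a = (\<lambda>_. 0)" "s b = (\<lambda>_. 0)"
    and I: "I = symbol x"
    and \<sigma>: "\<sigma> = (\<lambda>p i. if i = 0 then p else if i = 1 then k else if i = 2 then length x else (0::nat))"
    and K: "lval eK I (\<sigma> 0) = K" and L: "lval eL I (\<sigma> 0) = L"
    and B: "\<And>p. p < L \<Longrightarrow> lval eB I (\<sigma> p) = of_bool (\<beta> p)"
  shows "\<exists>s'. exec (transducer a b eK eL eB) s
      ((1 + (\<Sum>i<length x. Suc (1 + 1))) + (1 + (ctime eK I (\<sigma> 0) + (1 + (ctime eL I (\<sigma> 0) +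
       ((1 + (\<Sum>p<L. Suc (ctime eB I (\<sigma> p) + (1 + 1)))) + 1)))))) s' \<and>
      holds_output s' (map \<beta> [0..<L], K)"
proof -
  let ?n = "length x"
  have s1: "s 0 0 = k" "\<And>i. i \<le> ?n \<Longrightarrow> s 1 i = I i" using s(1) I by (auto simp: holds_output_def)
  have Ipos: "I i \<noteq> 0" if "i < ?n" for i using that by (simp add: I symbol_def)
  have I0: "I i = 0" if "i \<ge> ?n" for i using that by (simp add: I symbol_def)
  define c1 where "c1 = Seq (Store b (Load a (Const 2)) (Load 1 (Load a (Const 2))))
     (Store a (Const 2) (Plus (Load a (Const 2)) (Const 1)))"
  \<comment> \<open>Copying stops at the first blank, which \<open>holds_output\<close> guarantees
    right after the last symbol.\<close>
  define J where "J = (\<lambda>i r. r a = (\<lambda>_. 0)(2 := i) \<and> (\<forall>j<i. r b j = I j) \<and> (\<forall>j\<ge>i. r b j = 0) \<and> r 0 = s 0 \<and> r 1 = s 1)"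
  have "\<exists>s'. exec (While (Load 1 (Load a (Const 2))) c1) s (1 + (\<Sum>i<?n. Suc (1 + 1))) s' \<and> J ?n s'"
  proof (rule exec_While_count)
    fix i r assume i: "i < ?n" and r: "J i r"
    have "exec c1 r (1 + 1) (r(b := (r b)(i := I i), a := (r a)(2 := i + 1)))"
      unfolding c1_def
      by (rule exec.Seq, (rule exec_Store, rule refl)+, rule exec_Store)
        (use i r s1 a in \<open>auto simp: J_def\<close>)
    moreover have "J (Suc i) (r(b := (r b)(i := I i), a := (r a)(2 := i + 1)))"
      using r a by (auto simp: J_def less_Suc_eq)
    moreover have "eval_expr (Load 1 (Load a (Const 2))) r \<noteq> 0"
      using r i s1(2)[of i] Ipos[OF i] by (simp add: J_def)
    ultimately show "eval_expr (Load 1 (Load a (Const 2))) r \<noteq> 0 \<and> (\<exists>s'. exec c1 r (1 + 1) s' \<and> J (Suc i) s')"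
      by blast
  next
    fix r assume "J ?n r" then show "eval_expr (Load 1 (Load a (Const 2))) r = 0"
      using s1(2)[of ?n] I0[of ?n] by (simp add: J_def)
  next
    show "J 0 s" using s by (auto simp: J_def)
  qed
  then obtain r1 where x1: "exec (While (Load 1 (Load a (Const 2))) c1) s (1 + (\<Sum>i<?n. Suc (1 + 1))) r1" and r1: "J ?n r1"
    by blast
  have r1b: "r1 b = I" using r1 I0 by (auto simp: J_def fun_eq_iff) (metis not_le)
  define r2 where "r2 = r1(a := (r1 a)(1 := k))"
  have x2: "exec (Store a (Const 1) (Load 0 (Const 0))) r1 1 r2"
    by (rule exec_Store) (use r1 s1 in \<open>simp add: J_def r2_def\<close>)
  have ab: "a \<noteq> b" "a \<noteq> 0" "a \<noteq> 1" "b \<noteq> 0" "b \<noteq> 1" using a by auto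
  have p2: "\<And>i. min i 3 < 4 \<and> r2 a (min i 3) = \<sigma> 0 i"
    using r1 by (auto simp: r2_def \<sigma> J_def min_def)
  have b2: "r2 b = I" using r1b a by (simp add: r2_def)
  obtain r3 where x3: "exec (compile a b eK (\<lambda>i. min i 3) 4) r2 (ctime eK I (\<sigma> 0)) r3"
    and r3: "r3 a 4 = K" "\<forall>c. c \<noteq> a \<longrightarrow> r3 c = r2 c" "\<forall>i<4. r3 a i = r2 a i"
    using compile_correct[of "\<lambda>i. min i 3" 4 r2 a "\<sigma> 0" b I eK] p2 b2 ab K by blast
  define r4 where "r4 = r3(0 := (r3 0)(0 := K))"
  have x4: "exec (Store 0 (Const 0) (Load a (Const 4))) r3 1 r4"
    by (rule exec_Store) (use r3 in \<open>simp add: r4_def\<close>)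
  have r4a: "\<forall>i<4. r4 a i = r2 a i" using r3 ab by (auto simp: r4_def)
  have p4: "\<And>i. min i 3 < 5 \<and> r4 a (min i 3) = \<sigma> 0 i" using p2 r4a by (auto simp: min_def)
  have b4: "r4 b = I" using b2 r3 ab by (simp add: r4_def)
  obtain r5 where x5: "exec (compile a b eL (\<lambda>i. min i 3) 5) r4 (ctime eL I (\<sigma> 0)) r5"
    and r5: "r5 a 5 = L" "\<forall>c. c \<noteq> a \<longrightarrow> r5 c = r4 c" "\<forall>i<5. r5 a i = r4 a i"
    using compile_correct[of "\<lambda>i. min i 3" 5 r4 a "\<sigma> 0" b I eL] p4 b4 ab L by blast
  define c6 where "c6 = Seq (compile a b eB (\<lambda>i. min i 3) 6)
          (Seq (Store 1 (Load a (Const 0)) (Plus (Const 1) (Load a (Const 6))))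
               (Store a (Const 0) (Plus (Load a (Const 0)) (Const 1))))"
  define H where "H = (\<lambda>p r. (\<forall>i. r a (min i 3) = \<sigma> p i) \<and> r a 5 = L \<and> r b = I \<and> r 0 0 = K \<and>
     (\<forall>i<p. r 1 i = 1 + of_bool (\<beta> i)))"
  have H0: "r a 0 = p" if "H p r" for p r
  proof -
    have "r a (min 0 3) = \<sigma> p 0" using that unfolding H_def by blast
    then show ?thesis by (simp add: \<sigma>)
  qed
  have "\<exists>s'. exec (While (Minus (Load a (Const 5)) (Load a (Const 0))) c6) r5
     (1 + (\<Sum>p<L. Suc (ctime eB I (\<sigma> p) + (1 + 1)))) s' \<and> H L s'"
  proof (rule exec_While_count)
    fix p r assume p: "p < L" and r: "H p r"
    have r0: "r a 0 = p" using r by (rule H0)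
    have pre: "\<And>i. min i 3 < 6 \<and> r a (min i 3) = \<sigma> p i" using r by (auto simp: H_def min_def)
    obtain q where x: "exec (compile a b eB (\<lambda>i. min i 3) 6) r (ctime eB I (\<sigma> p)) q"
      and q: "q a 6 = of_bool (\<beta> p)" "\<forall>c. c \<noteq> a \<longrightarrow> q c = r c" "\<forall>i<6. q a i = r a i"
      using compile_correct[of "\<lambda>i. min i 3" 6 r a "\<sigma> p" b I eB] pre r ab B[OF p] by (auto simp: H_def)
    have q0: "q a 0 = p" using q(3) r0 by simp
    define q1 where "q1 = q(1 := (q 1)(p := 1 + of_bool (\<beta> p)), a := (q a)(0 := p + 1))"
    have "exec c6 r (ctime eB I (\<sigma> p) + (1 + 1)) q1"
      unfolding c6_def
      by (rule exec.Seq[OF x], rule exec.Seq, (rule exec_Store, rule refl)+, rule exec_Store)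
        (use q q0 ab in \<open>auto simp: q1_def\<close>)
    moreover have "H (Suc p) q1"
    proof -
      have "q1 a (min i 3) = \<sigma> (Suc p) i" for i
      proof (cases "i = 0")
        case True then show ?thesis by (simp add: q1_def \<sigma>)
      next
        case False
        then have "q1 a (min i 3) = q a (min i 3)" by (simp add: q1_def min_def)
        also have "\<dots> = r a (min i 3)" using q(3) by simp
        also have "\<dots> = \<sigma> p i" using r by (simp add: H_def)
        also have "\<dots> = \<sigma> (Suc p) i" using False by (simp add: \<sigma>)
        finally show ?thesis .
      qed
      then show ?thesis using r q ab by (auto simp: H_def q1_def less_Suc_eq)
    qed
    moreover have "eval_expr (Minus (Load a (Const 5)) (Load a (Const 0))) r \<noteq> 0"
      using p r r0 by (simp add: H_def)
    ultimately show "eval_expr (Minus (Load a (Const 5)) (Load a (Const 0))) r \<noteq> 0 \<and>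
      (\<exists>s'. exec c6 r (ctime eB I (\<sigma> p) + (1 + 1)) s' \<and> H (Suc p) s')" by blast
  next
    fix r assume "H L r"
    then have "r a 0 = L" "r a 5 = L" using H0 by (simp_all add: H_def)
    then show "eval_expr (Minus (Load a (Const 5)) (Load a (Const 0))) r = 0" by simp
  next
    have "r5 a (min i 3) = \<sigma> 0 i" for i
      using p4[of i] r5(3) by (metis)
    then show "H 0 r5" using r5 b4 ab by (auto simp: H_def r4_def)
  qed
  then obtain r6 where x6: "exec (While (Minus (Load a (Const 5)) (Load a (Const 0))) c6) r5
     (1 + (\<Sum>p<L. Suc (ctime eB I (\<sigma> p) + (1 + 1)))) r6" and r6: "H L r6" by blast
  have r60: "r6 a 0 = L" using r6 by (rule H0)
  define r7 where "r7 = r6(1 := (r6 1)(L := 0))"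
  \<comment> \<open>The final blank has to be written, because a longer old string may still occupy
    the array.\<close>
  have x7: "exec (Store 1 (Load a (Const 0)) (Const 0)) r6 1 r7"
    by (rule exec_Store) (simp add: r60 r7_def)
  have "holds_output r7 (map \<beta> [0..<L], K)"
    using r6 by (auto simp: holds_output_def r7_def H_def symbol_def)
  moreover note exec.Seq[OF x1 exec.Seq[OF x2 exec.Seq[OF x3 exec.Seq[OF x4 exec.Seq[OF x5 exec.Seq[OF x6 x7]]]]]]
  ultimately show ?thesis unfolding transducer_def c1_def[symmetric] c6_def[symmetric] by blast
qed


section \<open>Definable functions and the composition of reductions\<close>

primrec rename :: "arith \<Rightarrow> (nat \<Rightarrow> nat) \<Rightarrow> arith" where
  "rename (Cst c) \<rho> = Cst c"
| "rename (Var i) \<rho> = Var (\<rho> i)"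
| "rename (Inp e) \<rho> = Inp (rename e \<rho>)"
| "rename (Bin p d e) \<rho> = Bin p (rename d \<rho>) (rename e \<rho>)"
| "rename (Sum d e) \<rho> = Sum (rename d \<rho>) (rename e (case_nat 0 (Suc \<circ> \<rho>)))"

lemma lval_rename: "lval (rename e \<rho>) I \<sigma> = lval e I (\<sigma> \<circ> \<rho>)"
proof (induction e arbitrary: \<rho> \<sigma>)
  case (Sum d e)
  have "case_nat i \<sigma> \<circ> case_nat 0 (Suc \<circ> \<rho>) = case_nat i (\<sigma> \<circ> \<rho>)" for i
    by (auto simp: fun_eq_iff split: nat.splits)
  then show ?case by (simp only: rename.simps lval.simps Sum)
qed auto

text \<open>Inside a bounded sum the index is variable 0 and all other variables move up by one;
  terms from outside enter in this shifted form.\<close>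

lemma definable_shift:
  assumes "definable a"
  shows "definable (\<lambda>I \<sigma>. a I (\<lambda>i. \<sigma> (Suc i)))"
proof -
  obtain e where "\<And>I \<sigma>. lval e I \<sigma> = a I \<sigma>" using assms by (auto simp: definable_def)
  then show ?thesis unfolding definable_def
    by (intro exI[of _ "rename e Suc"]) (simp add: lval_rename comp_def)
qed

section \<open>Closure properties of definable functions and decidable predicates\<close>

lemma definable_const: "definable (\<lambda>I \<sigma>. c)"
  unfolding definable_def by (rule exI[of _ "Cst c"]) simp

lemma definable_var: "definable (\<lambda>I \<sigma>. \<sigma> i)"
  unfolding definable_def by (rule exI[of _ "Var i"]) simp

lemma definable_inp: "definable a \<Longrightarrow> definable (\<lambda>I \<sigma>. I (a I \<sigma>))"
  unfolding definable_def by (metis lval.simps(3))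

lemma definable_add: "definable a \<Longrightarrow> definable b \<Longrightarrow> definable (\<lambda>I \<sigma>. a I \<sigma> + b I \<sigma>)"
  unfolding definable_def using lval.simps(4)[of True] by metis

lemma definable_diff: "definable a \<Longrightarrow> definable b \<Longrightarrow> definable (\<lambda>I \<sigma>. a I \<sigma> - b I \<sigma>)"
  unfolding definable_def using lval.simps(4)[of False] by metis

lemma definable_Suc: "definable a \<Longrightarrow> definable (\<lambda>I \<sigma>. Suc (a I \<sigma>))"
  using definable_add[OF _ definable_const[of 1]] by simp

lemma definable_sum:
  assumes "definable A" "definable (\<lambda>I \<sigma>. B I (\<sigma> 0) (\<lambda>i. \<sigma> (Suc i)))"
  shows "definable (\<lambda>I \<sigma>. \<Sum>i<A I \<sigma>. B I i \<sigma>)"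
proof -
  obtain d e where "\<And>I \<sigma>. lval d I \<sigma> = A I \<sigma>" "\<And>I \<sigma>. lval e I \<sigma> = B I (\<sigma> 0) (\<lambda>i. \<sigma> (Suc i))"
    using assms by (auto simp: definable_def)
  then show ?thesis unfolding definable_def by (intro exI[of _ "Sum d e"]) simp
qed

lemma definable_mult:
  assumes "definable a" "definable b"
  shows "definable (\<lambda>I \<sigma>. a I \<sigma> * b I \<sigma>)"
proof -
  have "definable (\<lambda>I \<sigma>. \<Sum>i<a I \<sigma>. b I \<sigma>)" by (intro definable_sum definable_shift assms)
  then show ?thesis by simp
qed

lemma definable_power: "definable a \<Longrightarrow> definable (\<lambda>I \<sigma>. a I \<sigma> ^ c)"
  by (induction c) (auto intro: definable_const definable_mult)

abbreviation decidable :: "((nat \<Rightarrow> nat) \<Rightarrow> (nat \<Rightarrow> nat) \<Rightarrow> bool) \<Rightarrow> bool" where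
  "decidable P \<equiv> definable (\<lambda>I \<sigma>. of_bool (P I \<sigma>))"

lemma decidable_not:
  assumes "decidable P"
  shows "decidable (\<lambda>I \<sigma>. \<not> P I \<sigma>)"
proof -
  have "(\<lambda>I \<sigma>. of_bool (\<not> P I \<sigma>)) = (\<lambda>I \<sigma>. 1 - of_bool (P I \<sigma>) :: nat)" by (simp add: fun_eq_iff)
  then show ?thesis using definable_diff[OF definable_const[of 1] assms] by simp
qed

lemma decidable_conj: "decidable P \<Longrightarrow> decidable Q \<Longrightarrow> decidable (\<lambda>I \<sigma>. P I \<sigma> \<and> Q I \<sigma>)"
  using definable_mult[of "\<lambda>I \<sigma>. of_bool (P I \<sigma>)" "\<lambda>I \<sigma>. of_bool (Q I \<sigma>)"] by (simp add: of_bool_conj)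

lemma decidable_disj: "decidable P \<Longrightarrow> decidable Q \<Longrightarrow> decidable (\<lambda>I \<sigma>. P I \<sigma> \<or> Q I \<sigma>)"
  using decidable_not[OF decidable_conj[OF decidable_not[of P] decidable_not[of Q]]] by simp

lemma decidable_imp: "decidable P \<Longrightarrow> decidable Q \<Longrightarrow> decidable (\<lambda>I \<sigma>. P I \<sigma> \<longrightarrow> Q I \<sigma>)"
  unfolding imp_conv_disj by (intro decidable_disj decidable_not)

lemma decidable_iff: "decidable P \<Longrightarrow> decidable Q \<Longrightarrow> decidable (\<lambda>I \<sigma>. P I \<sigma> = Q I \<sigma>)"
  unfolding iff_conv_conj_imp by (intro decidable_conj decidable_imp)

lemma decidable_le: "definable a \<Longrightarrow> definable b \<Longrightarrow> decidable (\<lambda>I \<sigma>. a I \<sigma> \<le> b I \<sigma>)"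
proof -
  assume "definable a" "definable b"
  then have "definable (\<lambda>I \<sigma>. 1 - (a I \<sigma> - b I \<sigma>))" by (intro definable_diff definable_const)
  moreover have "(\<lambda>I \<sigma>. 1 - (a I \<sigma> - b I \<sigma>)) = (\<lambda>I \<sigma>. of_bool (a I \<sigma> \<le> b I \<sigma>))"
    by (auto simp: fun_eq_iff of_bool_def)
  ultimately show ?thesis by (simp only:)
qed

lemma decidable_less: "definable a \<Longrightarrow> definable b \<Longrightarrow> decidable (\<lambda>I \<sigma>. a I \<sigma> < b I \<sigma>)"
  using decidable_le[OF definable_Suc] by (simp add: Suc_le_eq)

lemma decidable_eq: "definable a \<Longrightarrow> definable b \<Longrightarrow> decidable (\<lambda>I \<sigma>. a I \<sigma> = (b I \<sigma> :: nat))"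
  unfolding eq_iff[where ?'a = nat] by (intro decidable_conj decidable_le)

lemma decidable_Ex:
  assumes "definable A" "decidable (\<lambda>I \<sigma>. P I (\<sigma> 0) (\<lambda>i. \<sigma> (Suc i)))"
  shows "decidable (\<lambda>I \<sigma>. \<exists>i<A I \<sigma>. P I i \<sigma>)"
proof -
  have "decidable (\<lambda>I \<sigma>. \<not> ((\<Sum>i<A I \<sigma>. of_bool (P I i \<sigma>)) = (0::nat)))"
    by (intro decidable_not decidable_eq definable_sum definable_const assms)
  moreover have "(\<not> ((\<Sum>i<A I \<sigma>. of_bool (P I i \<sigma>)) = (0::nat))) = (\<exists>i<A I \<sigma>. P I i \<sigma>)" for I \<sigma>
    by auto
  ultimately show ?thesis by (simp only:)
qed

lemma decidable_All:
  assumes "definable A" "decidable (\<lambda>I \<sigma>. P I (\<sigma> 0) (\<lambda>i. \<sigma> (Suc i)))"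
  shows "decidable (\<lambda>I \<sigma>. \<forall>i<A I \<sigma>. P I i \<sigma>)"
proof -
  have "decidable (\<lambda>I \<sigma>. \<not> (\<exists>i<A I \<sigma>. \<not> P I i \<sigma>))"
    by (intro decidable_not decidable_Ex assms)
  moreover have "(\<not> (\<exists>i<A I \<sigma>. \<not> P I i \<sigma>)) = (\<forall>i<A I \<sigma>. P I i \<sigma>)" for I \<sigma> by auto
  ultimately show ?thesis by (simp only:)
qed

lemma definable_if:
  assumes "decidable P" "definable a" "definable b"
  shows "definable (\<lambda>I \<sigma>. if P I \<sigma> then a I \<sigma> else b I \<sigma>)"
proof -
  have "definable (\<lambda>I \<sigma>. of_bool (P I \<sigma>) * a I \<sigma> + of_bool (\<not> P I \<sigma>) * b I \<sigma>)"
    by (intro definable_add definable_mult decidable_not assms)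
  moreover have "(\<lambda>I \<sigma>. of_bool (P I \<sigma>) * a I \<sigma> + of_bool (\<not> P I \<sigma>) * b I \<sigma>) =
      (\<lambda>I \<sigma>. if P I \<sigma> then a I \<sigma> else b I \<sigma>)" by (auto simp: fun_eq_iff)
  ultimately show ?thesis by (simp only:)
qed

lemma decidable_if:
  assumes "decidable P" "decidable Q" "decidable R"
  shows "decidable (\<lambda>I \<sigma>. if P I \<sigma> then Q I \<sigma> else R I \<sigma>)"
  using definable_if[OF assms] by (simp only: if_distrib[of of_bool])

text \<open>The quotient counts the positive multiples of \<open>n\<close> up to \<open>m\<close>,
  and counting is a bounded sum.\<close>

lemma div_eq_sum:
  "m div n = (if n = 0 then 0 else \<Sum>i<m. of_bool (Suc i * n \<le> m))" for m n :: nat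
proof (cases "n = 0")
  case False
  have "{i. i < m \<and> Suc i * n \<le> m} = {..<m div n}"
  proof (intro set_eqI)
    fix i
    have "Suc i * n \<le> m \<longleftrightarrow> i < m div n"
      using False by (simp add: less_eq_div_iff_mult_less_eq flip: Suc_le_eq)
    moreover have "i < m div n \<longrightarrow> i < m" using div_le_dividend[of m n] by linarith
    ultimately show "i \<in> {i. i < m \<and> Suc i * n \<le> m} \<longleftrightarrow> i \<in> {..<m div n}" by auto
  qed
  moreover have "(\<Sum>i<m. of_bool (Suc i * n \<le> m)) = card {i. i < m \<and> Suc i * n \<le> m}"
    by (simp add: of_bool_def sum.If_cases Int_def del: mult_Suc)
  ultimately show ?thesis using False by simp
qed simp

lemma definable_div:
  assumes "definable a" "definable b"
  shows "definable (\<lambda>I \<sigma>. a I \<sigma> div b I \<sigma>)"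
  by (subst div_eq_sum) (intro definable_if definable_sum decidable_eq decidable_le definable_mult
    definable_Suc definable_const definable_var assms assms[THEN definable_shift])

lemma definable_mod: "definable a \<Longrightarrow> definable b \<Longrightarrow> definable (\<lambda>I \<sigma>. a I \<sigma> mod b I \<sigma>)"
  unfolding modulo_nat_def by (intro definable_diff definable_mult definable_div)

text \<open>Unrestricted exponentiation outgrows every polynomial, hence is not definable; an
  exponent capped by a constant needs only a finite case distinction.\<close>

lemma definable_power_min:
  assumes "definable a" "definable b"
  shows "definable (\<lambda>I \<sigma>. a I \<sigma> ^ min (b I \<sigma>) c)"
proof (induction c)
  case 0
  show ?case by (simp add: definable_const)
next
  case (Suc c)
  have "definable (\<lambda>I \<sigma>. if b I \<sigma> \<le> c then a I \<sigma> ^ min (b I \<sigma>) c else a I \<sigma> ^ Suc c)"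
    by (intro definable_if decidable_le definable_const definable_power assms Suc.IH)
  moreover have "(if b I \<sigma> \<le> c then a I \<sigma> ^ min (b I \<sigma>) c else a I \<sigma> ^ Suc c) =
      a I \<sigma> ^ min (b I \<sigma>) (Suc c)" for I \<sigma>
    by (cases "b I \<sigma> \<le> c"; cases "b I \<sigma> = Suc c") (auto simp: min_def)
  ultimately show ?case by (simp only:)
qed

lemmas definable_intros =
  definable_const definable_var definable_inp definable_add definable_diff definable_Suc
  definable_mult definable_power definable_div definable_mod definable_if definable_sum
  decidable_not decidable_conj decidable_disj decidable_imp decidable_iff
  decidable_le decidable_less decidable_eq decidable_Ex decidable_All decidable_if

text \<open>The bit expression is evaluated at every output position, and positions range up to a
  polynomially bounded length, so the bounds compose as for a bounded sum.\<close>

lemma transducer_time: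
  "\<exists>E. \<forall>I k n \<sigma> X. 2 \<le> X \<longrightarrow> k \<le> X \<longrightarrow> n \<le> X \<longrightarrow> (\<forall>i::nat. I i \<le> (2::nat)) \<longrightarrow>
     \<sigma> = (\<lambda>p i. if i = 0 then p else if i = 1 then k else if i = 2 then n else (0::nat)) \<longrightarrow>
     (1 + (\<Sum>i<n. Suc (1 + 1))) + (1 + (ctime eK I (\<sigma> 0) + (1 + (ctime eL I (\<sigma> 0) +
       ((1 + (\<Sum>p<lval eL I (\<sigma> 0). Suc (ctime eB I (\<sigma> p) + (1 + 1)))) + 1))))) \<le> X ^ E"
proof -
  obtain dK where K: "\<And>I \<sigma> X. 2 \<le> X \<Longrightarrow> \<forall>i. I i \<le> X \<Longrightarrow> \<forall>i. \<sigma> i \<le> X \<Longrightarrow> ctime eK I \<sigma> \<le> X ^ dK"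
    using lval_ctime_bound[of eK] by blast
  obtain dL where L: "\<And>I \<sigma> X. 2 \<le> X \<Longrightarrow> \<forall>i. I i \<le> X \<Longrightarrow> \<forall>i. \<sigma> i \<le> X \<Longrightarrow> lval eL I \<sigma> \<le> X ^ dL \<and> ctime eL I \<sigma> \<le> X ^ dL"
    using lval_ctime_bound[of eL] by blast
  obtain dB where B: "\<And>I \<sigma> X. 2 \<le> X \<Longrightarrow> \<forall>i. I i \<le> X \<Longrightarrow> \<forall>i. \<sigma> i \<le> X \<Longrightarrow> ctime eB I \<sigma> \<le> X ^ dB"
    using lval_ctime_bound[of eB] by blast
  define E where "E = 1 + dK + dL + Suc dL * dB"
  show ?thesis
  proof (rule exI, intro allI impI)
    fix I :: "nat \<Rightarrow> nat" and k n X :: nat and \<sigma> :: "nat \<Rightarrow> nat \<Rightarrow> nat"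
    assume X: "2 \<le> X" and kn: "k \<le> X" "n \<le> X" and I2: "\<forall>i. I i \<le> 2"
      and \<sigma>: "\<sigma> = (\<lambda>p i. if i = 0 then p else if i = 1 then k else if i = 2 then n else 0)"
    have IX: "\<forall>i. I i \<le> X" using I2 X by (meson le_trans)
    have s0: "\<forall>i. \<sigma> 0 i \<le> X" using kn by (simp add: \<sigma>)
    let ?L = "lval eL I (\<sigma> 0)" and ?Y = "X ^ Suc dL"
    have XY: "X \<le> ?Y" using X by (simp add: self_le_power)
    have dY: "X ^ dL \<le> ?Y" using X by (intro power_increasing) auto
    have b: "Suc (ctime eB I (\<sigma> p) + (1 + 1)) \<le> 4 * ?Y ^ dB" if "p < ?L" for p
    proof -
      have "p \<le> ?Y" using that L[OF X IX s0] dY by linarith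
      then have "\<forall>i. \<sigma> p i \<le> ?Y" using kn XY by (auto simp: \<sigma> intro: le_trans)
      moreover have "2 \<le> ?Y" "\<forall>i. I i \<le> ?Y" using X XY IX by (auto intro: le_trans)
      ultimately have "ctime eB I (\<sigma> p) \<le> ?Y ^ dB" using B by blast
      moreover have "1 \<le> ?Y ^ dB" using X by simp
      ultimately show ?thesis by linarith
    qed
    have P: "X \<le> X ^ E" "X ^ dK \<le> X ^ E" "X ^ dL \<le> X ^ E" "1 \<le> X ^ E" "X ^ dL * ?Y ^ dB \<le> X ^ E"
      using X by (auto simp: E_def self_le_power simp flip: power_mult power_add power_Suc intro!: power_increasing)
    have "(\<Sum>p<?L. Suc (ctime eB I (\<sigma> p) + (1 + 1))) \<le> (\<Sum>p<?L. 4 * ?Y ^ dB)"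
      using b by (intro sum_mono) auto
    also have "\<dots> = 4 * (?L * ?Y ^ dB)" by simp
    also have "\<dots> \<le> 4 * (X ^ dL * ?Y ^ dB)" using L[OF X IX s0] by (intro mult_le_mono) auto
    finally have "(\<Sum>p<?L. Suc (ctime eB I (\<sigma> p) + (1 + 1))) \<le> 4 * X ^ E" using P by linarith
    moreover have "(\<Sum>i<n. Suc (1 + 1)) \<le> 3 * X ^ E" using kn P by simp
    ultimately have "(1 + (\<Sum>i<n. Suc (1 + 1))) + (1 + (ctime eK I (\<sigma> 0) + (1 + (ctime eL I (\<sigma> 0) +
       ((1 + (\<Sum>p<?L. Suc (ctime eB I (\<sigma> p) + (1 + 1)))) + 1))))) \<le> 20 * X ^ E"
      using K[OF X IX s0] L[OF X IX s0] P by linarith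
    then show "(1 + (\<Sum>i<n. Suc (1 + 1))) + (1 + (ctime eK I (\<sigma> 0) + (1 + (ctime eL I (\<sigma> 0) +
       ((1 + (\<Sum>p<?L. Suc (ctime eB I (\<sigma> p) + (1 + 1)))) + 1))))) \<le> X ^ (20 + E)"
      using le_power_of_mult X by blast
  qed
qed

text \<open>The given program is followed by a transducer that reads its output. That output is at
  most as long as input length plus running time, and its parameter is at most \<open>g k\<close>,
  so a polynomial in both stays within FPT time. \<open>K\<close> sees only the old parameter, so
  the new one is bounded computably. The given reduction maps into \<open>I'\<close>, so
  \<open>correct\<close> and \<open>range\<close> speak of such inputs.\<close>

theorem fpt_reducible_definable:
  fixes K :: "nat \<Rightarrow> nat" and L :: "(nat \<Rightarrow> nat) \<Rightarrow> nat \<Rightarrow> nat \<Rightarrow> nat"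
    and B :: "(nat \<Rightarrow> nat) \<Rightarrow> nat \<Rightarrow> nat \<Rightarrow> nat \<Rightarrow> bool"
  defines "red \<equiv> \<lambda>(x, k). (map (\<lambda>p. B (symbol x) p k (length x)) [0..<L (symbol x) k (length x)], K k)"
  assumes reducible: "fpt_reducible P Q' I'"
    and K: "definable (\<lambda>I \<sigma>. K (\<sigma> 1))"
    and L: "definable (\<lambda>I \<sigma>. L I (\<sigma> 1) (\<sigma> 2))"
    and B: "decidable (\<lambda>I \<sigma>. B I (\<sigma> 0) (\<sigma> 1) (\<sigma> 2))"
    and correct: "\<And>y. y \<in> I' \<Longrightarrow> y \<in> Q' \<longleftrightarrow> red y \<in> Q"
    and range: "\<And>y. y \<in> I' \<Longrightarrow> red y \<in> J"
  shows "fpt_reducible P Q J"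
proof -
  obtain r where r: "fpt_reduction r P Q'" "range r \<subseteq> I'" using reducible by (auto simp: fpt_reducible_def)
  obtain g c f d where g: "computable g" "\<And>x k. snd (r (x, k)) \<le> g k"
    and c: "computable f" "computes_in_time c r (\<lambda>(x, k). f k * Suc (length x) ^ d)"
    using r(1) unfolding fpt_reduction_def by blast
  obtain eK where eK: "\<And>I \<sigma>. lval eK I \<sigma> = K (\<sigma> 1)" using K unfolding definable_def by blast
  obtain eL where eL: "\<And>I \<sigma>. lval eL I \<sigma> = L I (\<sigma> 1) (\<sigma> 2)" using L unfolding definable_def by blast
  obtain eB where eB: "\<And>I \<sigma>. lval eB I \<sigma> = of_bool (B I (\<sigma> 0) (\<sigma> 1) (\<sigma> 2))"
    using B unfolding definable_def by blast
  obtain E where E: "\<forall>I k n \<sigma> X. 2 \<le> X \<longrightarrow> k \<le> X \<longrightarrow> n \<le> X \<longrightarrow> (\<forall>i::nat. I i \<le> (2::nat)) \<longrightarrow>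
     \<sigma> = (\<lambda>p i. if i = 0 then p else if i = 1 then k else if i = 2 then n else (0::nat)) \<longrightarrow>
     (1 + (\<Sum>i<n. Suc (1 + 1))) + (1 + (ctime eK I (\<sigma> 0) + (1 + (ctime eL I (\<sigma> 0) +
       ((1 + (\<Sum>p<lval eL I (\<sigma> 0). Suc (ctime eB I (\<sigma> p) + (1 + 1)))) + 1))))) \<le> X ^ E"
    using transducer_time[of eK eL eB] by (rule exE)
  obtain dK where dK: "\<And>I \<sigma> X. 2 \<le> X \<Longrightarrow> \<forall>i. I i \<le> X \<Longrightarrow> \<forall>i. \<sigma> i \<le> X \<Longrightarrow> lval eK I \<sigma> \<le> X ^ dK"
    using lval_ctime_bound[of eK] by blast
  define b where "b = max 2 (write_bound c)"
  define P2 where "P2 = transducer (Suc b) b eK eL eB"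
  define F where "F k = (f k + g k + 3) ^ (E + 2)" for k
  have "definable (\<lambda>I \<sigma>. (\<sigma> 0 + \<sigma> 1 + 3) ^ (E + 2))" by (intro definable_intros)
  from computable_definable[OF c(1) g(1) this] have F: "computable F" by (simp add: F_def[abs_def])
  have "definable (\<lambda>I \<sigma>. (\<sigma> 1 + 2) ^ dK)" by (intro definable_intros)
  from computable_definable[OF c(1) g(1) this] have G: "computable (\<lambda>k. (g k + 2) ^ dK)" .
  have snd_red: "snd (red y) = K (snd y)" for y by (simp add: red_def split: prod.split)
  have bound: "snd ((red \<circ> r) (x, k)) \<le> (g k + 2) ^ dK" for x k
  proof -
    let ?k = "snd (r (x, k))"
    have "lval eK (\<lambda>_. 0) (\<lambda>_. ?k) \<le> (g k + 2) ^ dK"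
      by (rule dK) (use g(2)[of x k] in auto)
    then show ?thesis by (simp add: snd_red eK)
  qed
  have "computes_in_time (Seq c P2) (red \<circ> r) (\<lambda>(x, k). F k * Suc (length x) ^ ((d + 1) * (E + 2)))"
    unfolding computes_in_time_def
  proof
    fix y :: input
    obtain x k where y: "y = (x, k)" by fastforce
    obtain x' k' where r': "r y = (x', k')" by fastforce
    obtain t s where ts: "exec c (initial_memory y) t s" "t \<le> f k * Suc (length x) ^ d" "holds_output s (r y)"
      using c(2) y unfolding computes_in_time_def by fastforce
    have fresh: "s a = (\<lambda>_. 0)" if "a \<ge> b" for a
    proof -
      have "s a = initial_memory y a" using exec_frame[OF ts(1), of a] that by (simp add: b_def)
      then show ?thesis using that by (auto simp: b_def initial_memory_def)
    qed
    define \<sigma> where "\<sigma> = (\<lambda>p i::nat. if i = 0 then p else if i = 1 then k' else if i = 2 then length x' else (0::nat))"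
    define I where "I = symbol x'"
    define L' where "L' = lval eL I (\<sigma> 0)"
    have "L' = L I k' (length x')" "lval eK I (\<sigma> 0) = K k'"
      by (simp_all add: L'_def \<sigma>_def eL eK)
    then have redr: "red (r y) = (map (\<lambda>p. B I p k' (length x')) [0..<L'], lval eK I (\<sigma> 0))"
      by (simp add: red_def r' I_def)
    have b: "1 < b" by (simp add: b_def)
    have vB: "lval eB I (\<sigma> p) = of_bool (B I p k' (length x'))" for p by (simp add: eB \<sigma>_def)
    obtain s' where s': "exec P2 s ((1 + (\<Sum>i<length x'. Suc (1 + 1))) + (1 + (ctime eK I (\<sigma> 0) + (1 + (ctime eL I (\<sigma> 0) +
       ((1 + (\<Sum>p<L'. Suc (ctime eB I (\<sigma> p) + (1 + 1)))) + 1)))))) s'" "holds_output s' (red (r y))"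
      using transducer_exec[where \<beta> = "\<lambda>p. B I p k' (length x')", OF refl b ts(3)[unfolded r'] fresh fresh I_def \<sigma>_def refl refl vB]
      unfolding P2_def redr L'_def by auto
    let ?u = "Suc (length x)" and ?v = "f k + g k + 3"
    \<comment> \<open>One bound for the running time of the first program, the length of its output
      and its parameter; the exponent \<open>d + 1\<close> covers \<open>?u\<close> itself even for
      \<open>d = 0\<close>.\<close>
    let ?Y = "?v * ?u ^ (d + 1)"
    have u: "1 \<le> ?u ^ (d + 1)" "?u \<le> ?u ^ (d + 1)" "?u ^ d \<le> ?u ^ (d + 1)"
      by (rule one_le_power self_le_power power_increasing; simp)+
    have "length x' \<le> length x + t"
      using exec_output_length ts(1,3) y r' by metis
    moreover have "k' \<le> g k" using g(2)[of x k] y r' by simp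
    moreover have "f k * ?u ^ d \<le> f k * ?u ^ (d + 1)" using u by (intro mult_le_mono) auto
    moreover have "g k \<le> g k * ?u ^ (d + 1)" using u(1) by simp
    moreover have "?Y = f k * ?u ^ (d + 1) + g k * ?u ^ (d + 1) + 3 * ?u ^ (d + 1)"
      by (simp only: distrib_right)
    ultimately have Y: "k' \<le> ?Y" "length x' \<le> ?Y" "t \<le> ?Y" "2 \<le> ?Y"
      using ts(2) u by linarith+
    have "\<forall>i. I i \<le> 2" by (simp add: I_def symbol_def)
    from E[rule_format, OF Y(4) Y(1,2) this[rule_format] \<sigma>_def]
    have t2: "(1 + (\<Sum>i<length x'. Suc (1 + 1))) + (1 + (ctime eK I (\<sigma> 0) + (1 + (ctime eL I (\<sigma> 0) +
       ((1 + (\<Sum>p<L'. Suc (ctime eB I (\<sigma> p) + (1 + 1)))) + 1))))) \<le> ?Y ^ E" (is "?t2 \<le> _") unfolding L'_def .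
    have "t + ?t2 \<le> ?Y ^ (E + 1) + ?Y ^ (E + 1)"
    proof (rule add_mono)
      show "t \<le> ?Y ^ (E + 1)" by (rule order_trans[OF Y(3) self_le_power]) (use Y(4) in linarith, simp)
      show "?t2 \<le> ?Y ^ (E + 1)" by (rule order_trans[OF t2 power_increasing]) (simp, use Y(4) in linarith)
    qed
    also have "\<dots> = 2 * ?Y ^ (E + 1)" by simp
    also have "\<dots> \<le> ?Y * ?Y ^ (E + 1)" using Y(4) by (rule mult_le_mono1)
    also have "\<dots> = ?Y ^ (E + 2)" by simp
    also have "\<dots> = F k * ?u ^ ((d + 1) * (E + 2))"
      by (simp only: F_def power_mult_distrib power_mult)
    finally show "\<exists>t s. exec (Seq c P2) (initial_memory y) t s \<and>
        t \<le> (case y of (x, k) \<Rightarrow> F k * Suc (length x) ^ ((d + 1) * (E + 2))) \<and> holds_output s ((red \<circ> r) y)"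
      using exec.Seq[OF ts(1) s'(1)] s'(2) y by auto
  qed
  moreover have "y \<in> P \<longleftrightarrow> (red \<circ> r) y \<in> Q" for y
    using r correct unfolding fpt_reduction_def by (metis comp_apply rangeI subsetD)
  ultimately have "fpt_reduction (red \<circ> r) P Q"
    unfolding fpt_reduction_def using F G bound by blast
  moreover have "range (red \<circ> r) \<subseteq> J" using r(2) range unfolding image_subset_iff comp_apply by (metis rangeI subsetD)
  ultimately show ?thesis unfolding fpt_reducible_def by blast
qed


section \<open>Graphs built from weighted cliques\<close>

definition class_weight :: "nat \<Rightarrow> nat \<Rightarrow> (nat \<Rightarrow> nat) \<Rightarrow> (nat \<Rightarrow> nat) \<Rightarrow> nat \<Rightarrow> nat" where
  "class_weight K n \<omega> col i = (\<Sum>b | b < n * (2 * K) \<and> col b = i. \<omega> b)"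

text \<open>A color on three vertices of a clique gives a triangle, so by counting a clique of
  \<open>2 * K\<close> vertices carries each of the \<open>K\<close> colors exactly twice.\<close>

definition fair :: "nat \<Rightarrow> nat \<Rightarrow> (nat \<Rightarrow> nat) \<Rightarrow> bool" where
  "fair K n col \<longleftrightarrow> (\<forall>b<n * (2 * K). col b < K) \<and>
     (\<forall>j<n. \<forall>i<K. card {r. r < 2 * K \<and> col (j * (2 * K) + r) = i} = 2)"

lemma block_index:
  fixes K n :: nat
  assumes "j < n" "r < 2 * K"
  shows "j * (2 * K) + r < n * (2 * K)" "(j * (2 * K) + r) div (2 * K) = j"
proof -
  have "j * (2 * K) + r < Suc j * (2 * K)" using assms by simp
  also have "\<dots> \<le> n * (2 * K)" using assms by (intro mult_le_mono1) simp
  finally show "j * (2 * K) + r < n * (2 * K)" .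
qed (use assms in simp)

lemma block_split:
  fixes K n :: nat
  assumes "b < n * (2 * K)"
  shows "\<exists>j<n. \<exists>r<2 * K. b = j * (2 * K) + r"
proof -
  have "0 < K" using assms by (cases K) auto
  then have "b div (2 * K) < n" "b mod (2 * K) < 2 * K" using assms by (simp_all add: less_mult_imp_div_less)
  then show ?thesis by (metis div_mult_mod_eq)
qed

lemma sum_blocks:
  fixes K n :: nat
  shows "(\<Sum>b | b < n * (2 * K) \<and> P b. h b) =
    (\<Sum>j<n. \<Sum>r | r < 2 * K \<and> P (j * (2 * K) + r). h (j * (2 * K) + r))"
proof -
  define A where "A j = (\<lambda>r. j * (2 * K) + r) ` {r. r < 2 * K \<and> P (j * (2 * K) + r)}" for j
  have A: "x div (2 * K) = j" if "x \<in> A j" "j < n" for x j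
    using that block_index(2) by (auto simp: A_def)
  have "{b. b < n * (2 * K) \<and> P b} = (\<Union>j\<in>{..<n}. A j)"
    using block_split block_index(1) by (auto simp: A_def) blast
  then have "(\<Sum>b | b < n * (2 * K) \<and> P b. h b) = sum h (\<Union>j\<in>{..<n}. A j)" by simp
  also have "\<dots> = (\<Sum>j<n. sum h (A j))"
  proof (intro sum.UNION_disjoint ballI impI)
    fix j j' assume "j \<in> {..<n}" "j' \<in> {..<n}" "j \<noteq> j'"
    then show "A j \<inter> A j' = {}" using A by blast
  qed (simp_all add: A_def)
  also have "\<dots> = (\<Sum>j<n. \<Sum>r | r < 2 * K \<and> P (j * (2 * K) + r). h (j * (2 * K) + r))"
    by (rule sum.cong[OF refl]) (simp add: A_def sum.reindex)
  finally show ?thesis .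
qed

text \<open>
  Block \<open>b\<close> consists of the clique vertex \<open>hub b\<close> and \<open>\<omega> b\<close> pendant vertices; \<open>2 * K\<close> consecutive blocks form a
  connected component.
\<close>

locale block_graph =
  fixes K n V :: nat and own hub \<omega> :: "nat \<Rightarrow> nat"
  assumes K: "1 \<le> K"
    and own_less: "v < V \<Longrightarrow> own v < n * (2 * K)"
    and hub: "b < n * (2 * K) \<Longrightarrow> hub b < V \<and> own (hub b) = b"
    and card_block: "b < n * (2 * K) \<Longrightarrow> card {v. v < V \<and> own v = b} = Suc (\<omega> b)"
begin

definition is_hub :: "nat \<Rightarrow> bool" where
  "is_hub v \<longleftrightarrow> v = hub (own v)"

definition adjacent :: "nat \<Rightarrow> nat \<Rightarrow> bool" where
  "adjacent u v \<longleftrightarrow> own u div (2 * K) = own v div (2 * K) \<and> own u \<noteq> own v \<and>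
     (is_hub u \<or> is_hub v)"

definition G :: "nat graph" where
  "G = ({..<V}, {{u, v} |u v. u < V \<and> v < V \<and> adjacent u v})"

lemma is_hub_hub: "b < n * (2 * K) \<Longrightarrow> is_hub (hub b)"
  using hub by (simp add: is_hub_def)

lemma adjacent_sym: "adjacent u v \<longleftrightarrow> adjacent v u"
  by (auto simp: adjacent_def)

lemma edge_iff: "{u, v} \<in> snd G \<longleftrightarrow> u < V \<and> v < V \<and> adjacent u v"
  using adjacent_sym by (auto simp: G_def doubleton_eq_iff)

lemma simple: "simple_graph G"
  unfolding simple_graph_def G_def by (auto simp: adjacent_def card_2_iff)

lemma input: "input_graph G"
  using simple by (simp add: input_graph_def G_def)

lemma disjoint_union: "disjoint_union_of_split_graphs G"
proof -
  define S where "S c = {v. v < V \<and> own v div (2 * K) = c}" for c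
  define H where "H c = (S c, {e \<in> snd G. e \<subseteq> S c})" for c
  have "split_graph (H c)" for c
  proof -
    have "simple_graph (H c)" using simple by (auto simp: simple_graph_def H_def S_def)
    moreover have "clique (H c) {v \<in> S c. is_hub v}"
    proof -
      have "adjacent u v" if "u \<in> S c" "v \<in> S c" "is_hub u" "is_hub v" "u \<noteq> v" for u v
        using that by (simp add: adjacent_def S_def is_hub_def) metis
      then show ?thesis by (auto simp: clique_def H_def edge_iff) (auto simp: S_def)
    qed
    moreover have "independent (H c) {v \<in> S c. \<not> is_hub v}"
      by (auto simp: independent_def H_def edge_iff adjacent_def)
    moreover have "{v \<in> S c. is_hub v} \<union> {v \<in> S c. \<not> is_hub v} = fst (H c)"
      by (auto simp: H_def)
    ultimately show ?thesis unfolding split_graph_def by blast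
  qed
  moreover have "pairwise (\<lambda>H H'. disjnt (fst H) (fst H')) (range H)"
    by (auto simp: pairwise_def H_def S_def disjnt_def)
  moreover have "G = (\<Union>H\<in>range H. fst H, \<Union>H\<in>range H. snd H)"
  proof (rule prod_eqI)
    show "fst G = fst (\<Union>H\<in>range H. fst H, \<Union>H\<in>range H. snd H)" by (auto simp: G_def H_def S_def)
    have "\<exists>c. e \<subseteq> S c" if "e \<in> snd G" for e
      using that by (auto simp: G_def S_def adjacent_def)
    then show "snd G = snd (\<Union>H\<in>range H. fst H, \<Union>H\<in>range H. snd H)" by (auto simp: H_def)
  qed
  ultimately show ?thesis unfolding disjoint_union_of_split_graphs_def using simple by blast
qed

text \<open>Hubs contribute \<open>2 * n\<close> to every color class, so balanced class sizes mean
  balanced weights.\<close>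

lemma class_card:
  assumes "fair K n col" "i < K"
  shows "card {v. v < V \<and> col (own v) = i} = 2 * n + class_weight K n \<omega> col i"
proof -
  let ?B = "{b. b < n * (2 * K) \<and> col b = i}"
  have "{v. v < V \<and> col (own v) = i} = (\<Union>b\<in>?B. {v. v < V \<and> own v = b})"
    using own_less by auto
  then have "card {v. v < V \<and> col (own v) = i} = (\<Sum>b\<in>?B. card {v. v < V \<and> own v = b})"
    by (simp only:, intro card_UN_disjoint) auto
  also have "\<dots> = (\<Sum>b\<in>?B. 1 + \<omega> b)" using card_block by (intro sum.cong) auto
  also have "\<dots> = card ?B + class_weight K n \<omega> col i" by (simp only: sum.distrib class_weight_def) simp
  also have "card ?B = 2 * n"
    using sum_blocks[where P = "\<lambda>b. col b = i" and h = "\<lambda>_. 1 :: nat" and n = n and K = K] assms by (simp add: fair_def)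
  finally show ?thesis .
qed

text \<open>Excludes monochromatic cycles, since such a cycle would meet three blocks of one
  component.\<close>

lemma no_three:
  assumes "fair K n col" "x < n * (2 * K)" "y < n * (2 * K)" "z < n * (2 * K)"
    "x div (2 * K) = y div (2 * K)" "x div (2 * K) = z div (2 * K)" "col x = col y" "col x = col z"
    "x \<noteq> y" "x \<noteq> z" "y \<noteq> z"
  shows False
proof -
  let ?j = "x div (2 * K)" and ?m = "\<lambda>u. u mod (2 * K)"
  have "?j < n" "col x < K" using assms by (auto simp: fair_def less_mult_imp_div_less)
  then have c: "card {r. r < 2 * K \<and> col (?j * (2 * K) + r) = col x} = 2" using assms(1) by (simp add: fair_def)
  have m: "?j * (2 * K) + ?m u = u" if "u div (2 * K) = ?j" for u using that by (metis div_mult_mod_eq)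
  have "{?m x, ?m y, ?m z} \<subseteq> {r. r < 2 * K \<and> col (?j * (2 * K) + r) = col x}"
    using m[of x, OF refl] m[of y, OF assms(5)[symmetric]] m[of z, OF assms(6)[symmetric]] assms(7,8) K
    by simp
  from card_mono[OF _ this] have "card {?m x, ?m y, ?m z} \<le> 2" unfolding c by simp
  moreover have "?m u \<noteq> ?m v" if "u div (2 * K) = v div (2 * K)" "u \<noteq> v" for u v
    using that by (metis div_mult_mod_eq)
  then have "?m x \<noteq> ?m y" "?m x \<noteq> ?m z" "?m y \<noteq> ?m z"
    using assms(5,6,9-) by simp_all
  ultimately show False by simp
qed

lemma colorable_iff:
  "(\<exists>c. equitable_tree_coloring G K c) \<longleftrightarrow>
   (\<exists>col. fair K n col \<and> (\<forall>i<K. \<forall>j<K. \<bar>int (class_weight K n \<omega> col i) - int (class_weight K n \<omega> col j)\<bar> \<le> 1))"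
proof
  assume "\<exists>c. equitable_tree_coloring G K c"
  then obtain c where etc: "equitable_tree_coloring G K c" by blast
  have c: "c v \<in> {1..K}" if "v < V" for v
    using etc that unfolding equitable_tree_coloring_def G_def by fastforce
  have forest: "forest (induced G {v \<in> fst G. c v = i})" if "i \<in> {1..K}" for i
    using etc that unfolding equitable_tree_coloring_def by blast
  have eq: "\<bar>int (card {v \<in> fst G. c v = i}) - int (card {v \<in> fst G. c v = j})\<bar> \<le> 1"
    if "i \<in> {1..K}" "j \<in> {1..K}" "i < j" for i j
    using etc that unfolding equitable_tree_coloring_def by blast
  have triangle: False if "x < V" "y < V" "z < V" "adjacent x y" "adjacent y z" "adjacent z x"
    "c x = c y" "c y = c z" for x y z
  proof -
    have d: "distinct [x, y, z]" using that by (auto simp: adjacent_def)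
    have "cycle (induced G {v \<in> fst G. c v = c x}) [x, y, z]"
      unfolding cycle_def
    proof (intro conjI allI impI)
      fix i assume "i < length [x, y, z]"
      then have "i = 0 \<or> i = 1 \<or> i = 2" by auto
      then show "{[x, y, z] ! i, [x, y, z] ! (Suc i mod length [x, y, z])} \<in> snd (induced G {v \<in> fst G. c v = c x})"
        using that by (auto simp: induced_def edge_iff) (auto simp: G_def)
    qed (use d that in \<open>auto simp: induced_def G_def\<close>)
    then show False using forest[OF c[OF that(1)]] unfolding forest_def by blast
  qed
  \<comment> \<open>The colors of the problem start at 1, those of blocks at 0.\<close>
  define col where "col b = c (hub b) - 1" for b
  have col: "c (hub b) = Suc (col b)" "col b < K" if "b < n * (2 * K)" for b
    using c[of "hub b"] hub[OF that] by (auto simp: col_def)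
  have le2: "card {r. r < 2 * K \<and> col (j * (2 * K) + r) = i} \<le> 2" if "j < n" "i < K" for i j
  proof (rule ccontr)
    assume "\<not> ?thesis"
    then have "3 \<le> card {r. r < 2 * K \<and> col (j * (2 * K) + r) = i}" by simp
    then obtain T where T: "T \<subseteq> {r. r < 2 * K \<and> col (j * (2 * K) + r) = i}" "card T = 3"
      by (meson obtain_subset_with_card_n)
    then obtain x y z where xyz: "T = {x, y, z}" "x \<noteq> y" "x \<noteq> z" "y \<noteq> z"
      by (auto simp: card_3_iff)
    have r: "r < 2 * K" "col (j * (2 * K) + r) = i" if "r \<in> {x, y, z}" for r using T xyz that by auto
    define h where "h r = hub (j * (2 * K) + r)" for r
    have h: "h r < V" "own (h r) = j * (2 * K) + r" "c (h r) = Suc i" if "r \<in> {x, y, z}" for r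
      using hub[OF block_index(1)[OF \<open>j < n\<close> r(1)[OF that]]] col(1)[OF block_index(1)[OF \<open>j < n\<close> r(1)[OF that]]]
        r(2)[OF that] by (auto simp: h_def)
    have "adjacent (h r) (h s)" if "r \<in> {x, y, z}" "s \<in> {x, y, z}" "r \<noteq> s" for r s
      using h[OF that(1)] h[OF that(2)] that(3) r(1)[OF that(1)] r(1)[OF that(2)] block_index(2)[OF \<open>j < n\<close>]
        is_hub_hub[OF block_index(1)[OF \<open>j < n\<close> r(1)[OF that(1)]]]
      unfolding adjacent_def by (simp add: h_def)
    then show False using triangle[of "h x" "h y" "h z"] h xyz by simp
  qed
  \<comment> \<open>No color exceeds two and the counts add up to \<open>2 * K\<close>, so none
    falls short.\<close>
  have two: "card {r. r < 2 * K \<and> col (j * (2 * K) + r) = i} = 2" if "j < n" "i < K" for i j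
  proof (rule ccontr)
    assume "\<not> ?thesis"
    then have "card {r. r < 2 * K \<and> col (j * (2 * K) + r) = i} < 2" using le2[OF that] by simp
    then have "(\<Sum>i<K. card {r. r < 2 * K \<and> col (j * (2 * K) + r) = i}) < (\<Sum>i<K. 2)"
      using le2[OF that(1)] that(2) by (intro sum_strict_mono_ex1) auto
    moreover have "(\<Sum>i<K. card {r. r < 2 * K \<and> col (j * (2 * K) + r) = i}) =
        card (\<Union>i<K. {r. r < 2 * K \<and> col (j * (2 * K) + r) = i})"
      by (intro card_UN_disjoint[symmetric]) auto
    moreover have "(\<Union>i<K. {r. r < 2 * K \<and> col (j * (2 * K) + r) = i}) = {..<2 * K}"
      using col(2) block_index(1)[OF that(1)] by auto
    ultimately show False by simp
  qed
  have fair: "fair K n col" using col(2) two by (simp add: fair_def)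
  \<comment> \<open>If \<open>v\<close> had a color other than that of its hub, then the two hubs of
    that color would form a triangle with \<open>v\<close>.\<close>
  have pend: "c v = Suc (col (own v))" if v: "v < V" for v
  proof -
    let ?b = "own v" and ?i = "c v - 1"
    have b: "?b < n * (2 * K)" using own_less v .
    then obtain j r where j: "j < n" "r < 2 * K" "?b = j * (2 * K) + r" using block_split by blast
    have i: "?i < K" "c v = Suc ?i" using c[OF v] by auto
    have "card {r. r < 2 * K \<and> col (j * (2 * K) + r) = ?i} = 2" using two j(1) i by blast
    then obtain x y where xy: "{r. r < 2 * K \<and> col (j * (2 * K) + r) = ?i} = {x, y}" "x \<noteq> y"
      by (auto simp: card_2_iff)
    have "col ?b = ?i"
    proof (rule ccontr)
      assume ne: "col ?b \<noteq> ?i"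
      have x: "x < 2 * K" "col (j * (2 * K) + x) = ?i" and y: "y < 2 * K" "col (j * (2 * K) + y) = ?i" using xy by auto
      let ?x = "j * (2 * K) + x" and ?y = "j * (2 * K) + y"
      have ix: "?x < n * (2 * K)" "?x div (2 * K) = j" "?y < n * (2 * K)" "?y div (2 * K) = j" "?b div (2 * K) = j"
        using block_index j x(1) y(1) by auto
      have hx: "hub ?x < V" "own (hub ?x) = ?x" "c (hub ?x) = c v"
        using hub[OF ix(1)] col(1)[OF ix(1)] x(2) i(2) by auto
      have hy: "hub ?y < V" "own (hub ?y) = ?y" "c (hub ?y) = c v"
        using hub[OF ix(3)] col(1)[OF ix(3)] y(2) i(2) by auto
      have "?b \<noteq> ?x" "?b \<noteq> ?y" using ne x(2) y(2) by metis+
      then show False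
        using triangle[of v "hub ?x" "hub ?y"] hx hy v ix xy(2) is_hub_hub[OF ix(1)] is_hub_hub[OF ix(3)] by (simp add: adjacent_def)
    qed
    then show ?thesis using i(2) by simp
  qed
  have "{v \<in> fst G. c v = Suc i} = {v. v < V \<and> col (own v) = i}" for i
    using pend by (auto simp: G_def)
  then have w: "card {v \<in> fst G. c v = Suc i} = 2 * n + class_weight K n \<omega> col i" if "i < K" for i
    using class_card[OF fair that] by simp
  have "\<bar>int (class_weight K n \<omega> col i) - int (class_weight K n \<omega> col j)\<bar> \<le> 1" if "i < K" "j < K" for i j
  proof (cases i j rule: linorder_cases)
    case less then show ?thesis using eq[of "Suc i" "Suc j"] that w by simp
  next
    case greater then show ?thesis using eq[of "Suc j" "Suc i"] that w by simp
  qed simp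
  then show "\<exists>col. fair K n col \<and> (\<forall>i<K. \<forall>j<K. \<bar>int (class_weight K n \<omega> col i) - int (class_weight K n \<omega> col j)\<bar> \<le> 1)"
    using fair by blast
next
  assume "\<exists>col. fair K n col \<and> (\<forall>i<K. \<forall>j<K. \<bar>int (class_weight K n \<omega> col i) - int (class_weight K n \<omega> col j)\<bar> \<le> 1)"
  then obtain col where fair: "fair K n col" and w: "\<And>i j. i < K \<Longrightarrow> j < K \<Longrightarrow> \<bar>int (class_weight K n \<omega> col i) - int (class_weight K n \<omega> col j)\<bar> \<le> 1"
    by blast
  define c where "c v = Suc (col (own v))" for v
  have "{v \<in> fst G. c v = Suc i} = {v. v < V \<and> col (own v) = i}" for i
    by (auto simp: G_def c_def)
  then have card: "card {v \<in> fst G. c v = Suc i} = 2 * n + class_weight K n \<omega> col i" if "i < K" for i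
    using class_card[OF fair that] by simp
  have "forest (induced G {v \<in> fst G. c v = i})" for i
    unfolding forest_def
  proof
    assume "\<exists>vs. cycle (induced G {v \<in> fst G. c v = i}) vs"
    then obtain vs where len: "3 \<le> length vs" and dist: "distinct vs"
      and sub: "set vs \<subseteq> fst (induced G {v \<in> fst G. c v = i})"
      and ed: "\<And>k. k < length vs \<Longrightarrow> {vs ! k, vs ! (Suc k mod length vs)} \<in> snd (induced G {v \<in> fst G. c v = i})"
      unfolding cycle_def by blast
    have v: "vs ! k < V" "own (vs ! k) < n * (2 * K)" "Suc (col (own (vs ! k))) = i" if "k < length vs" for k
    proof -
      have "vs ! k \<in> fst (induced G {v \<in> fst G. c v = i})" using sub nth_mem[OF that] by blast
      then show "vs ! k < V" "own (vs ! k) < n * (2 * K)" "Suc (col (own (vs ! k))) = i"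
        using own_less by (simp_all add: induced_def G_def c_def)
    qed
    have adj: "adjacent (vs ! k) (vs ! (Suc k mod length vs))" if "k < length vs" for k
      using ed[OF that] by (simp add: induced_def edge_iff)
    show False
    \<comment> \<open>Three consecutive hubs on a cycle are distinct vertices of a clique. A pendant
      vertex has only hubs as neighbours, and with its two neighbours on the cycle it occupies three
      blocks.\<close>
    proof (cases "\<forall>k<length vs. is_hub (vs ! k)")
      case True
      have l: "0 < length vs" "1 < length vs" "2 < length vs" using len by linarith+
      then have "Suc 0 mod length vs = 1" "Suc 1 mod length vs = 2" by simp_all
      then have a: "adjacent (vs ! 0) (vs ! 1)" "adjacent (vs ! 1) (vs ! 2)"
        using adj[OF l(1)] adj[OF l(2)] by simp_all
      have "vs ! 0 \<noteq> vs ! 2" using dist l by (simp add: nth_eq_iff_index_eq)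
      then have "own (vs ! 0) \<noteq> own (vs ! 2)"
        using True l unfolding is_hub_def by metis
      then show False
        using no_three[OF fair v(2)[OF l(1)] v(2)[OF l(2)] v(2)[OF l(3)]] v(3)[OF l(1)] v(3)[OF l(2)] v(3)[OF l(3)] a
        unfolding adjacent_def by simp
    next
      case False
      then obtain k where k: "k < length vs" "\<not> is_hub (vs ! k)" by blast
      \<comment> \<open>The cyclic predecessor of position \<open>k\<close>.\<close>
      define l where "l = (if k = 0 then length vs - 1 else k - 1)"
      define m where "m = Suc k mod length vs"
      have lm: "l < length vs" "m < length vs" "Suc l mod length vs = k" "l \<noteq> m"
        using k len by (auto simp: l_def m_def mod_Suc)
      have a: "adjacent (vs ! l) (vs ! k)" "adjacent (vs ! k) (vs ! m)"
        using adj[OF lm(1)] adj[OF k(1)] lm by (auto simp: m_def)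
      then have "is_hub (vs ! l)" "is_hub (vs ! m)"
        using k(2) by (auto simp: adjacent_def)
      moreover have "vs ! l \<noteq> vs ! m" using dist lm by (simp add: nth_eq_iff_index_eq)
      ultimately have "own (vs ! l) \<noteq> own (vs ! m)" unfolding is_hub_def by metis
      then show False
        using no_three[OF fair v(2)[OF k(1)] v(2)[OF lm(1)] v(2)[OF lm(2)]] a v(3)[OF k(1)] v(3)[OF lm(1)] v(3)[OF lm(2)]
        by (simp add: adjacent_def)
    qed
  qed
  moreover have "c ` fst G \<subseteq> {1..K}"
    using fair own_less by (auto simp: G_def c_def fair_def Suc_le_eq)
  moreover have "\<bar>int (card {v \<in> fst G. c v = i}) - int (card {v \<in> fst G. c v = j})\<bar> \<le> 1"
    if ij: "i \<in> {1..K}" "j \<in> {1..K}" for i j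
  proof -
    obtain i' j' where "i = Suc i'" "j = Suc j'" "i' < K" "j' < K" using ij by (cases i; cases j) auto
    then show ?thesis using card[of i'] card[of j'] w[of i' j'] by simp
  qed
  ultimately show "\<exists>c. equitable_tree_coloring G K c"
    unfolding equitable_tree_coloring_def by blast
qed

end


section \<open>From vector sums to weighted cliques\<close>

definition nxt :: "nat \<Rightarrow> nat \<Rightarrow> nat" where
  "nxt D p = (if p = D then 0 else Suc p)"

text \<open>
  In each clique, block \<open>2 * j\<close> is marked with the vertex \<open>(2j, 2j\<^sup>2)\<close> of a convex polygon with \<open>D + 1\<close> vertices, and block
  \<open>2 * j + 1\<close> with the midpoint of the edge from there to the next vertex. Only the polygon vertices carry a value, the
  partial sum \<open>vco\<close>, so that moving along edge \<open>p < D\<close> adds coordinate \<open>p\<close> of the vector.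
\<close>

definition xco :: "nat \<Rightarrow> nat \<Rightarrow> nat" where
  "xco D r = (if r mod 2 = 0 then 2 * (r div 2) else r div 2 + nxt D (r div 2))"

definition fco :: "nat \<Rightarrow> nat \<Rightarrow> nat" where
  "fco D r = (if r mod 2 = 0 then 2 * (r div 2)\<^sup>2 else (r div 2)\<^sup>2 + (nxt D (r div 2))\<^sup>2)"

definition vco :: "(nat \<Rightarrow> nat \<Rightarrow> nat) \<Rightarrow> nat \<Rightarrow> nat \<Rightarrow> nat" where
  "vco vec c r = (if r mod 2 = 0 then \<Sum>p<r div 2. vec c p else 0)"

text \<open>Exceeds whatever can occur as a lower or middle digit: the double sum bounds the values
  and first coordinates that any color collects and, together with \<open>\<tau>\<close>, the
  prescribed values; \<open>4 * N * Suc D\<close> bounds the prescribed first coordinates. The top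
  digit may be arbitrarily large.\<close>

definition radix :: "(nat \<Rightarrow> nat \<Rightarrow> nat) \<Rightarrow> (nat \<Rightarrow> nat) \<Rightarrow> nat \<Rightarrow> nat \<Rightarrow> nat" where
  "radix vec \<tau> N D = Suc ((\<Sum>c<N. \<Sum>r<2 * Suc D. vco vec c r + xco D r) + (\<Sum>p<D. \<tau> p) + 4 * N * Suc D)"

text \<open>The digits are the carried value, the first and the second coordinate, so that one
  equation between totals is three equations between digits.\<close>

definition item :: "(nat \<Rightarrow> nat \<Rightarrow> nat) \<Rightarrow> (nat \<Rightarrow> nat) \<Rightarrow> nat \<Rightarrow> nat \<Rightarrow> nat \<Rightarrow> nat \<Rightarrow> nat" where
  "item vec \<tau> N D c r = vco vec c r + radix vec \<tau> N D * (xco D r + radix vec \<tau> N D * fco D r)"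

text \<open>
  The total of \<open>h\<close> over the blocks of color \<open>p\<close> if that color takes all midpoints of edge \<open>p\<close>, its
  first end in \<open>N - m\<close> cliques and its second end in the \<open>m\<close> selected ones.
\<close>

definition intended :: "(nat \<Rightarrow> nat) \<Rightarrow> nat \<Rightarrow> nat \<Rightarrow> nat \<Rightarrow> nat \<Rightarrow> nat" where
  "intended h N D m p = N * h (2 * p + 1) + (N - m) * h (2 * p) + m * h (2 * nxt D p)"

text \<open>What color \<open>p\<close> has to collect from the item cliques. Its value digit is the
  total carried by the first ends of edge \<open>p\<close> plus \<open>\<tau> p\<close>, since
  moving to the second end in a selected clique adds coordinate \<open>p\<close> of its
  vector.\<close>

definition capacity :: "(nat \<Rightarrow> nat \<Rightarrow> nat) \<Rightarrow> (nat \<Rightarrow> nat) \<Rightarrow> nat \<Rightarrow> nat \<Rightarrow> nat \<Rightarrow> nat \<Rightarrow> nat" where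
  "capacity vec \<tau> N D m p = (\<Sum>c<N. vco vec c (2 * p)) + \<tau> p +
     radix vec \<tau> N D * (intended (xco D) N D m p + radix vec \<tau> N D * intended (fco D) N D m p)"

definition all_items :: "(nat \<Rightarrow> nat \<Rightarrow> nat) \<Rightarrow> (nat \<Rightarrow> nat) \<Rightarrow> nat \<Rightarrow> nat \<Rightarrow> nat" where
  "all_items vec \<tau> N D = (\<Sum>c<N. \<Sum>r<2 * Suc D. item vec \<tau> N D c r)"

definition all_capacities :: "(nat \<Rightarrow> nat \<Rightarrow> nat) \<Rightarrow> (nat \<Rightarrow> nat) \<Rightarrow> nat \<Rightarrow> nat \<Rightarrow> nat \<Rightarrow> nat" where
  "all_capacities vec \<tau> N D m = (\<Sum>p<D. capacity vec \<tau> N D m p)"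

text \<open>Large enough that the subtractions in \<open>filler\<close> are exact and twice each of
  the first \<open>Suc D\<close> fillers exceeds the level.\<close>

definition level :: "(nat \<Rightarrow> nat \<Rightarrow> nat) \<Rightarrow> (nat \<Rightarrow> nat) \<Rightarrow> nat \<Rightarrow> nat \<Rightarrow> nat \<Rightarrow> nat" where
  "level vec \<tau> N D m = 2 * (all_items vec \<tau> N D + all_capacities vec \<tau> N D m) + 1"

text \<open>
  One more clique raises the capacities to a common level. Its first \<open>D + 1\<close> weights exceed half of that level, so they
  get different colors, which identifies the colors. The capacity of color \<open>D\<close> is what the other colors leave;
  the formula avoids a truncated subtraction.
\<close>

definition filler :: "(nat \<Rightarrow> nat \<Rightarrow> nat) \<Rightarrow> (nat \<Rightarrow> nat) \<Rightarrow> nat \<Rightarrow> nat \<Rightarrow> nat \<Rightarrow> nat \<Rightarrow> nat" where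
  "filler vec \<tau> N D m r = (if r < D then level vec \<tau> N D m - capacity vec \<tau> N D m r
     else if r = D then level vec \<tau> N D m + all_capacities vec \<tau> N D m - all_items vec \<tau> N D else 0)"

definition block_weight :: "(nat \<Rightarrow> nat \<Rightarrow> nat) \<Rightarrow> (nat \<Rightarrow> nat) \<Rightarrow> nat \<Rightarrow> nat \<Rightarrow> nat \<Rightarrow> nat \<Rightarrow> nat" where
  "block_weight vec \<tau> N D m b = (if b div (2 * Suc D) < N
     then item vec \<tau> N D (b div (2 * Suc D)) (b mod (2 * Suc D))
     else filler vec \<tau> N D m (b mod (2 * Suc D)))"

lemma block_div_mod:
  fixes M :: nat
  assumes "r < M"
  shows "(c * M + r) div M = c" "(c * M + r) mod M = r"
  using assms by simp_all

lemma sum_even_odd: "(\<Sum>r<2 * k. h r) = (\<Sum>p<k. h (2 * p)) + (\<Sum>p<k. h (2 * p + 1 :: nat) :: nat)"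
  by (induction k) auto

lemma two_digits:
  fixes a b a' b' B :: nat
  assumes "a + B * b = a' + B * b'" "a < B" "a' < B"
  shows "a = a' \<and> b = b'"
proof -
  have "a = (a + B * b) mod B" using assms(2) by simp
  also have "\<dots> = (a' + B * b') mod B" by (simp only: assms(1))
  also have "\<dots> = a'" using assms(3) by simp
  finally show ?thesis using assms by auto
qed

text \<open>\<open>m\<close> of the \<open>N\<close> vectors are to be selected. With
  \<open>2 \<le> D\<close> the polygon has at least three vertices, so different edges have
  different pairs of ends.\<close>

locale gadget =
  fixes vec :: "nat \<Rightarrow> nat \<Rightarrow> nat" and \<tau> :: "nat \<Rightarrow> nat" and N D m :: nat
  assumes D: "2 \<le> D" and m: "m \<le> N"
begin

abbreviation "K \<equiv> Suc D"
abbreviation "B \<equiv> radix vec \<tau> N D"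
abbreviation "wt \<equiv> item vec \<tau> N D"
abbreviation "F \<equiv> capacity vec \<tau> N D m"
abbreviation "TOT \<equiv> all_items vec \<tau> N D"
abbreviation "SF \<equiv> all_capacities vec \<tau> N D m"
abbreviation "L \<equiv> level vec \<tau> N D m"
abbreviation "fil \<equiv> filler vec \<tau> N D m"
abbreviation "\<omega> \<equiv> block_weight vec \<tau> N D m"

abbreviation "load \<equiv> class_weight K (Suc N) \<omega>"

text \<open>The polygon vertices lie on a parabola. Vertex \<open>j\<close> is above the line
  through vertices \<open>p\<close> and \<open>p + 1\<close> by twice a product of two consecutive
  integers, and below the closing chord from vertex \<open>D\<close> to vertex 0 by
  \<open>2 * j * (D - j)\<close>; this is half of that height.\<close>

definition side :: "nat \<Rightarrow> nat \<Rightarrow> int" where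
  "side p j = (if p < D then (int j - int p) * (int j - int p - 1) else int j * (int D - int j))"

text \<open>
  An affine functional that vanishes on the line through edge \<open>p\<close> and is nonnegative on the polygon.
\<close>

definition \<phi> :: "nat \<Rightarrow> nat \<Rightarrow> int" where
  "\<phi> p r = (if p < D then int (fco D r) - (2 * int p + 1) * int (xco D r) + 2 * int p * (int p + 1)
     else int D * int (xco D r) - int (fco D r))"

text \<open>\<open>\<phi> p\<close> is affine and a midpoint is the mean of two vertices, so the
  half values at its ends add up; a vertex counts as the midpoint of itself.\<close>

lemma phi_eq: "\<phi> p r = side p (r div 2) + side p (if r mod 2 = 0 then r div 2 else nxt D (r div 2))"
  by (simp add: \<phi>_def side_def xco_def fco_def power2_eq_square algebra_simps)

lemma side_nonneg: "j \<le> D \<Longrightarrow> 0 \<le> side p j"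
  unfolding side_def by (auto simp: zero_le_mult_iff)

lemma side_zero: "j \<le> D \<Longrightarrow> p \<le> D \<Longrightarrow> side p j = 0 \<Longrightarrow> j = p \<or> j = nxt D p"
  by (auto simp: side_def nxt_def split: if_splits)

lemma nxt_le: "p \<le> D \<Longrightarrow> nxt D p \<le> D" by (auto simp: nxt_def)

lemma phi_nonneg: "r < 2 * K \<Longrightarrow> 0 \<le> \<phi> p r"
  unfolding phi_eq using side_nonneg nxt_le by (intro add_nonneg_nonneg) auto

lemma phi_zero:
  assumes "r < 2 * K" "p \<le> D" "\<phi> p r = 0"
  shows "r \<in> {2 * p, 2 * p + 1, 2 * nxt D p}"
proof -
  let ?j = "r div 2"
  let ?j' = "if r mod 2 = 0 then ?j else nxt D ?j"
  have j: "?j \<le> D" "?j' \<le> D" using assms(1) nxt_le by auto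
  then have "side p ?j = 0" "side p ?j' = 0"
    using assms(3) side_nonneg[OF j(1), of p] side_nonneg[OF j(2), of p] unfolding phi_eq by linarith+
  then have c: "?j = p \<or> ?j = nxt D p" "?j' = p \<or> ?j' = nxt D p"
    using side_zero j assms(2) by blast+
  have r: "r = 2 * ?j + r mod 2" by simp
  show ?thesis
  proof (cases "r mod 2 = 0")
    case True
    then have "r = 2 * ?j" using r by linarith
    then show ?thesis using c(1) by auto
  next
    case False
    then have "r = 2 * ?j + 1" using r by linarith
    \<comment> \<open>The ends of edge \<open>?j\<close> both lie on edge \<open>p\<close>; as the
      polygon has at least three vertices, the edges coincide.\<close>
    moreover have "?j = p" using c False assms(2) D by (auto simp: nxt_def split: if_splits)
    ultimately show ?thesis by simp
  qed
qed

section \<open>Capacities and the average load\<close>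

lemma capacity_le: "p < D \<Longrightarrow> F p \<le> SF"
  unfolding all_capacities_def by (rule member_le_sum) auto

text \<open>The last filler is chosen so that \<open>L\<close> is the exact average load of the
  \<open>K\<close> colors, which leaves balanced loads no choice but to equal
  \<open>L\<close>.\<close>

lemma sum_filler: "(\<Sum>r<2 * K. fil r) + TOT = K * L"
proof -
  have "(\<Sum>r<2 * K. fil r) = (\<Sum>r<K. fil r)"
    by (rule sum.mono_neutral_right) (auto simp: filler_def)
  also have "\<dots> = (\<Sum>r<D. L - F r) + (L + SF - TOT)"
    by (simp add: filler_def)
  finally have *: "(\<Sum>r<2 * K. fil r) = (\<Sum>r<D. L - F r) + (L + SF - TOT)" .
  have "(\<Sum>r<D. L - F r) + SF = D * L"
  proof -
    have "(\<Sum>r<D. L - F r) + SF = (\<Sum>r<D. (L - F r) + F r)"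
      by (simp add: sum.distrib all_capacities_def)
    also have "\<dots> = (\<Sum>r<D. L)"
      using capacity_le by (intro sum.cong) (force simp: level_def)+
    finally show ?thesis by simp
  qed
  moreover have "TOT \<le> L" by (simp add: level_def)
  ultimately show ?thesis unfolding * by simp
qed

lemma weight_blocks:
  assumes "c < N" "r < 2 * K"
  shows "\<omega> (c * (2 * K) + r) = wt c r"
  unfolding block_weight_def block_div_mod[OF assms(2)] using assms(1) by simp

lemma weight_filler: "r < 2 * K \<Longrightarrow> \<omega> (N * (2 * K) + r) = fil r"
  unfolding block_weight_def by (simp only: block_div_mod) simp

lemma class_weight_eq:
  "load col i =
    (\<Sum>c<N. \<Sum>r | r < 2 * K \<and> col (c * (2 * K) + r) = i. wt c r) +
    (\<Sum>r | r < 2 * K \<and> col (N * (2 * K) + r) = i. fil r)"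
  unfolding class_weight_def sum_blocks sum.lessThan_Suc
  by (intro arg_cong2[where f = "(+)"] sum.cong) (use weight_blocks weight_filler in \<open>auto simp del: mult_Suc_right\<close>)

lemma sum_class_weights:
  assumes "fair K (Suc N) col"
  shows "(\<Sum>i<K. load col i) = K * L"
proof -
  have "(\<Sum>i<K. load col i) = (\<Sum>i<K. \<Sum>b | b < Suc N * (2 * K) \<and> col b = i. \<omega> b)"
    by (simp add: class_weight_def)
  also have "\<dots> = (\<Sum>b\<in>(\<Union>i<K. {b. b < Suc N * (2 * K) \<and> col b = i}). \<omega> b)"
    by (rule sum.UNION_disjoint[symmetric]) auto
  also have "(\<Union>i<K. {b. b < Suc N * (2 * K) \<and> col b = i}) = {b. b < Suc N * (2 * K) \<and> True}"
    using assms by (auto simp: fair_def)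
  also have "(\<Sum>b | b < Suc N * (2 * K) \<and> True. \<omega> b) = (\<Sum>c<N. \<Sum>r<2 * K. wt c r) + (\<Sum>r<2 * K. fil r)"
    unfolding sum_blocks sum.lessThan_Suc
    by (intro arg_cong2[where f = "(+)"] sum.cong) (use weight_blocks weight_filler in \<open>auto simp del: mult_Suc_right\<close>)
  also have "\<dots> = K * L" using sum_filler by (simp add: all_items_def add.commute)
  finally show ?thesis .
qed

lemma sum_item:
  "(\<Sum>c<N. \<Sum>r\<in>S c. wt c r) = (\<Sum>c<N. \<Sum>r\<in>S c. vco vec c r) +
     B * ((\<Sum>c<N. \<Sum>r\<in>S c. xco D r) + B * (\<Sum>c<N. \<Sum>r\<in>S c. fco D r))"
  by (simp only: item_def sum.distrib sum_distrib_left[symmetric])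

section \<open>From a selection of vectors to a coloring\<close>

lemma solution_imp_coloring:
  assumes A: "A \<subseteq> {..<N}" "card A = m" "\<And>p. p < D \<Longrightarrow> (\<Sum>c\<in>A. vec c p) = \<tau> p"
  shows "\<exists>col. fair K (Suc N) col \<and> (\<forall>i<K. load col i = L)"
proof -
  define prv where "prv j = (if j = 0 then D else j - 1)" for j :: nat
  have prv: "prv j = i \<longleftrightarrow> j = nxt D i" if "i \<le> D" "j \<le> D" for i j
    using that by (auto simp: prv_def nxt_def)
  \<comment> \<open>Color \<open>j\<close> takes midpoint \<open>j\<close>. An unselected clique
    gives vertex \<open>j\<close> to color \<open>j\<close>, as the first end of its edge; a
    selected one gives it to the preceding color, as the second end. In the last clique each color
    gets one filler and one weightless block.\<close>
  define pc where "pc c r = (if c < N then if r mod 2 = 0 \<and> c \<in> A then prv (r div 2) else r div 2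
     else if r < K then r else r - K)" for c r
  define col where "col b = pc (b div (2 * K)) (b mod (2 * K))" for b
  have col: "col (c * (2 * K) + r) = pc c r" if "r < 2 * K" for c r
    using that by (simp add: col_def del: mult_Suc_right)
  have S: "{r. r < 2 * K \<and> col (c * (2 * K) + r) = i} = {r. r < 2 * K \<and> pc c r = i}" for c i
    using col by auto
  have S1: "{r. r < 2 * K \<and> pc c r = i} = {2 * i + 1, if c \<in> A then 2 * nxt D i else 2 * i}" if i: "i < K" and c: "c < N" for c i
  proof -
    have "r < 2 * K \<and> pc c r = i \<longleftrightarrow> r \<in> {2 * i + 1, if c \<in> A then 2 * nxt D i else 2 * i}" for r
    proof (cases "r mod 2 = 0")
      case True
      then obtain j where j: "r = 2 * j" by auto
      show ?thesis
      proof (cases "c \<in> A")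
        case True
        have "pc c r = prv j" using c j True by (simp add: pc_def)
        moreover have "r < 2 * K \<longleftrightarrow> j \<le> D" using j by auto
        ultimately show ?thesis using prv[of i j] i j True nxt_le[of i] by auto presburger
      next
        case False
        then show ?thesis using c j i by (auto simp: pc_def)
      qed
    next
      case False
      then obtain j where j: "r = 2 * j + 1" by (metis odd_iff_mod_2_eq_one oddE parity_cases)
      then have "pc c r = j" using c by (simp add: pc_def)
      moreover have "r \<noteq> 2 * nxt D i" "r \<noteq> 2 * i" using j by presburger+
      ultimately show ?thesis using j i by auto
    qed
    then show ?thesis by blast
  qed
  have S2: "{r. r < 2 * K \<and> pc N r = i} = {i, K + i}" if "i < K" for i
    using that by (auto simp: pc_def split: if_splits)
  have less: "pc c r < K" if "r < 2 * K" for c r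
    using that by (auto simp: pc_def prv_def)
  have fair: "fair K (Suc N) col"
    unfolding fair_def
  proof (intro conjI allI impI)
    fix b assume "b < Suc N * (2 * K)"
    then show "col b < K" using less by (simp add: col_def)
  next
    fix c i assume c: "c < Suc N" and i: "i < K"
    show "card {r. r < 2 * K \<and> col (c * (2 * K) + r) = i} = 2"
    proof (cases "c < N")
      case True
      have "2 * i + 1 \<noteq> 2 * nxt D i" by presburger
      then show ?thesis using S1[OF i True] unfolding S by (auto simp: card_2_iff)
    next
      case False
      then have "c = N" using c by simp
      then show ?thesis using S2[OF i] unfolding S by simp
    qed
  qed
  have fin: "finite A" using A(1) finite_subset by blast
  have split: "(\<Sum>c<N. if c \<in> A then f c else g c) = (\<Sum>c\<in>A. f c) + (\<Sum>c\<in>{..<N} - A. g c)" for f g :: "nat \<Rightarrow> nat"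
    using A(1) fin by (subst sum.If_cases) (auto simp: Int_absorb1 Diff_eq)
  have cA: "card ({..<N} - A) = N - m" using A fin by (simp add: card_Diff_subset)
  have low: "load col p = L" if p: "p < D" for p
  proof -
    have np: "nxt D p = Suc p" using p by (simp add: nxt_def)
    have cong: "(\<Sum>c<N. \<Sum>r | r < 2 * K \<and> pc c r = p. h c r) =
        (\<Sum>c<N. h c (2 * p + 1)) + (\<Sum>c\<in>A. h c (2 * nxt D p)) + (\<Sum>c\<in>{..<N} - A. h c (2 * p))" for h :: "nat \<Rightarrow> nat \<Rightarrow> nat"
    proof -
      have "(\<Sum>c<N. \<Sum>r | r < 2 * K \<and> pc c r = p. h c r) =
          (\<Sum>c<N. h c (2 * p + 1) + (if c \<in> A then h c (2 * nxt D p) else h c (2 * p)))"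
      proof (rule sum.cong[OF refl])
        fix c assume "c \<in> {..<N}"
        moreover have "2 * p + 1 \<noteq> 2 * nxt D p" by presburger
        ultimately show "(\<Sum>r | r < 2 * K \<and> pc c r = p. h c r) =
           h c (2 * p + 1) + (if c \<in> A then h c (2 * nxt D p) else h c (2 * p))"
          using p by (subst S1) auto
      qed
      then show ?thesis by (simp add: sum.distrib split)
    qed
    have x: "(\<Sum>c<N. \<Sum>r | r < 2 * K \<and> pc c r = p. h r) = intended h N D m p" for h :: "nat \<Rightarrow> nat"
      unfolding cong by (simp add: intended_def A(2) cA)
    have v: "(\<Sum>c<N. \<Sum>r | r < 2 * K \<and> pc c r = p. vco vec c r) = (\<Sum>c<N. vco vec c (2 * p)) + \<tau> p"
    proof -
      have 1: "vco vec c (2 * p + 1) = 0" "vco vec c (2 * nxt D p) = vco vec c (2 * p) + vec c p" for c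
        by (simp_all add: vco_def np)
      have "(\<Sum>c<N. vco vec c (2 * p)) = (\<Sum>c\<in>A. vco vec c (2 * p)) + (\<Sum>c\<in>{..<N} - A. vco vec c (2 * p))"
        using split[of "\<lambda>c. vco vec c (2 * p)" "\<lambda>c. vco vec c (2 * p)"] by simp
      then show ?thesis unfolding cong 1 by (simp add: sum.distrib A(3)[OF p])
    qed
    have "(\<Sum>c<N. \<Sum>r | r < 2 * K \<and> pc c r = p. wt c r) = F p"
      unfolding sum_item capacity_def v x ..
    moreover have "(\<Sum>r | r < 2 * K \<and> pc N r = p. fil r) = L - F p"
      using p by (subst S2) (auto simp: filler_def)
    moreover have "F p \<le> L" using capacity_le[OF p] by (simp add: level_def)
    ultimately show ?thesis unfolding class_weight_eq S by simp
  qed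
  \<comment> \<open>The last color gets what the others leave of the total
    \<open>K * L\<close>.\<close>
  have "load col D = L"
    using sum_class_weights[OF fair] low by simp
  then show ?thesis using low fair less_Suc_eq by metis
qed

section \<open>From a coloring to a selection of vectors\<close>

lemma big_filler: "p < K \<Longrightarrow> L < 2 * fil p"
  using capacity_le[of p] by (auto simp: filler_def level_def)

lemma phi_intended: "p \<le> D \<Longrightarrow> \<phi> p (2 * p + 1) = 0 \<and> \<phi> p (2 * p) = 0 \<and> \<phi> p (2 * nxt D p) = 0"
  unfolding phi_eq by (auto simp: side_def nxt_def)

text \<open>\<open>nxt D\<close> permutes the vertices, so over all colors it makes no difference
  which ends are taken. Hence the coordinate sums of color \<open>D\<close>, which has no capacity
  of its own, follow from those of the others.\<close>

lemma sum_intended: "(\<Sum>p<K. intended h N D m p) = N * (\<Sum>r<2 * K. h r)"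
proof -
  have "(\<Sum>p<K. h (2 * nxt D p)) = (\<Sum>p<D. h (2 * Suc p)) + h 0"
    by (simp add: nxt_def)
  also have "\<dots> = (\<Sum>p<K. h (2 * p))" by (subst sum.lessThan_Suc_shift) simp
  finally have n: "(\<Sum>p<K. h (2 * nxt D p)) = (\<Sum>p<K. h (2 * p))" .
  have "(\<Sum>p<K. intended h N D m p) =
      N * (\<Sum>p<K. h (2 * p + 1)) + (N - m) * (\<Sum>p<K. h (2 * p)) + m * (\<Sum>p<K. h (2 * nxt D p))"
    unfolding intended_def sum.distrib sum_distrib_left ..
  also have "\<dots> = N * (\<Sum>p<K. h (2 * p + 1)) + (N - m + m) * (\<Sum>p<K. h (2 * p))"
    unfolding n by (simp only: distrib_right add.assoc)
  also have "N - m + m = N" using m by simp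
  finally show ?thesis by (simp only: sum_even_odd distrib_left add.commute)
qed

lemma xco_le: "r < 2 * K \<Longrightarrow> xco D r \<le> 2 * K"
proof -
  assume "r < 2 * K"
  then have "r div 2 \<le> D" by simp
  with nxt_le[OF this] show ?thesis by (simp add: xco_def)
qed

lemma intended_xco_less: "p \<le> D \<Longrightarrow> intended (xco D) N D m p < B"
proof -
  assume p: "p \<le> D"
  have "intended (xco D) N D m p \<le> N * (2 * K) + (N - m) * (2 * K) + m * (2 * K)"
    unfolding intended_def using p nxt_le[OF p] by (intro add_mono mult_le_mono2 xco_le) auto
  also have "\<dots> = N * (2 * K) + (N - m + m) * (2 * K)" by (simp only: distrib_right add.assoc)
  also have "\<dots> = 4 * N * K" using m by simp
  also have "\<dots> < B" unfolding radix_def by simp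
  finally show ?thesis .
qed

lemma coloring_imp_solution:
  assumes fair: "fair K (Suc N) col" and w: "\<And>i. i < K \<Longrightarrow> load col i = L"
  shows "\<exists>A\<subseteq>{..<N}. card A = m \<and> (\<forall>p<D. (\<Sum>c\<in>A. vec c p) = \<tau> p)"
proof -
  \<comment> \<open>Colors are interchangeable; \<open>q p\<close> is the color that plays the role
    of \<open>p\<close>, recognized by filler block \<open>p\<close>.\<close>
  define q where "q p = col (N * (2 * K) + p)" for p
  have less: "col (c * (2 * K) + r) < K" if "c < Suc N" "r < 2 * K" for c r
    using fair block_index(1)[OF that] by (simp only: fair_def)
  have q_less: "q p < K" if "p < 2 * K" for p using less[OF _ that, of N] by (simp add: q_def)
  have filL: "(\<Sum>r | r < 2 * K \<and> q r = i. fil r) \<le> L" if "i < K" for i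
    using w[OF that] unfolding class_weight_eq q_def by linarith
  have inj: "p = p'" if p: "p < K" "p' < K" "q p = q p'" for p p'
  proof (rule ccontr)
    assume ne: "p \<noteq> p'"
    have "fil p + fil p' = (\<Sum>r\<in>{p, p'}. fil r)" using ne by simp
    also have "\<dots> \<le> (\<Sum>r | r < 2 * K \<and> q r = q p. fil r)"
      using p by (intro sum_mono2) auto
    also have "\<dots> \<le> L" using filL q_less p by simp
    finally show False using big_filler[OF p(1)] big_filler[OF p(2)] by linarith
  qed
  define R where "R c p = {r. r < 2 * K \<and> col (c * (2 * K) + r) = q p}" for c p
  have card_R: "card (R c p) = 2" if "c < N" "p < K" for c p
    using fair that q_less[of p] by (simp add: R_def fair_def)
  have R_sub: "R c p \<subseteq> {..<2 * K}" for c p by (auto simp: R_def)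
  have fin: "finite (R c p)" for c p using R_sub finite_subset by blast
  have disj: "R c p \<inter> R c p' = {}" if "p < K" "p' < K" "p \<noteq> p'" for c p p'
    using inj that by (auto simp: R_def)
  have cover: "(\<Union>p<K. R c p) = {..<2 * K}" if "c < N" for c
  proof (rule card_subset_eq)
    have "card (\<Union>p<K. R c p) = (\<Sum>p<K. card (R c p))"
      using fin disj by (intro card_UN_disjoint) auto
    then show "card (\<Union>p<K. R c p) = card {..<2 * K}" using card_R[OF that] by simp
  qed (use R_sub in auto)
  have total: "(\<Sum>p<K. \<Sum>c<N. \<Sum>r\<in>R c p. h r) = N * (\<Sum>r<2 * K. h r)" for h :: "nat \<Rightarrow> nat"
  proof -
    have "(\<Sum>p<K. \<Sum>c<N. \<Sum>r\<in>R c p. h r) = (\<Sum>c<N. \<Sum>p<K. \<Sum>r\<in>R c p. h r)" by (rule sum.swap)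
    also have "\<dots> = (\<Sum>c<N. \<Sum>r<2 * K. h r)"
    proof (rule sum.cong[OF refl])
      fix c assume "c \<in> {..<N}"
      then have c: "c < N" by simp
      have "(\<Sum>r\<in>(\<Union>p\<in>{..<K}. R c p). h r) = (\<Sum>p<K. \<Sum>r\<in>R c p. h r)"
        using fin disj by (intro sum.UNION_disjoint) auto
      then show "(\<Sum>p<K. \<Sum>r\<in>R c p. h r) = (\<Sum>r<2 * K. h r)"
        unfolding cover[OF c] by (rule sym)
    qed
    finally show ?thesis by simp
  qed
  \<comment> \<open>Besides filler \<open>p\<close>, color \<open>q p\<close> gets only a weightless
    block of the last clique, so the items supply the difference to \<open>L\<close>.\<close>
  have sum_R: "(\<Sum>c<N. \<Sum>r\<in>R c p. wt c r) = F p" if p: "p < D" for p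
  proof -
    have "(\<Sum>r | r < 2 * K \<and> q r = q p. fil r) = (\<Sum>r\<in>{p}. fil r)"
    proof (rule sum.mono_neutral_right)
      show "\<forall>r\<in>{r. r < 2 * K \<and> q r = q p} - {p}. fil r = 0"
      proof
        fix r assume "r \<in> {r. r < 2 * K \<and> q r = q p} - {p}"
        then have "\<not> r < K" using inj[of r p] p by auto
        then show "fil r = 0" by (simp add: filler_def)
      qed
    qed (use p in auto)
    then have "(\<Sum>c<N. \<Sum>r\<in>R c p. wt c r) + (L - F p) = L"
      using w[OF q_less[of p]] p unfolding class_weight_eq R_def q_def by (simp add: filler_def)
    then show ?thesis using capacity_le[OF p] by (simp add: level_def)
  qed
  define v where "v p = (\<Sum>c<N. \<Sum>r\<in>R c p. vco vec c r)" for p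
  define x where "x p = (\<Sum>c<N. \<Sum>r\<in>R c p. xco D r)" for p
  define f where "f p = (\<Sum>c<N. \<Sum>r\<in>R c p. fco D r)" for p
  have B: "(\<Sum>c<N. \<Sum>r\<in>R c p. h c r) < B" if "\<And>c r. h c r \<le> vco vec c r + xco D r" for h p
  proof -
    have "(\<Sum>c<N. \<Sum>r\<in>R c p. h c r) \<le> (\<Sum>c<N. \<Sum>r<2 * K. vco vec c r + xco D r)"
    proof (rule sum_mono)
      fix c
      have "(\<Sum>r\<in>R c p. h c r) \<le> (\<Sum>r\<in>R c p. vco vec c r + xco D r)" by (intro sum_mono that)
      also have "\<dots> \<le> (\<Sum>r<2 * K. vco vec c r + xco D r)" using R_sub by (intro sum_mono2) auto
      finally show "(\<Sum>r\<in>R c p. h c r) \<le> (\<Sum>r<2 * K. vco vec c r + xco D r)" .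
    qed
    then show ?thesis unfolding radix_def by linarith
  qed
  have vB: "v p < B" for p unfolding v_def by (rule B) simp
  have xB: "x p < B" for p unfolding x_def by (rule B) simp
  have digits: "v p = (\<Sum>c<N. vco vec c (2 * p)) + \<tau> p \<and> x p = intended (xco D) N D m p \<and> f p = intended (fco D) N D m p"
    if p: "p < D" for p
  proof -
    have "v p + B * (x p + B * f p) = (\<Sum>c<N. \<Sum>r\<in>R c p. wt c r)"
      by (simp only: v_def x_def f_def sum_item)
    also have "\<dots> = (\<Sum>c<N. vco vec c (2 * p)) + \<tau> p + B * (intended (xco D) N D m p + B * intended (fco D) N D m p)"
      unfolding sum_R[OF p] capacity_def ..
    finally have e: "v p + B * (x p + B * f p) =
      ((\<Sum>c<N. vco vec c (2 * p)) + \<tau> p) + B * (intended (xco D) N D m p + B * intended (fco D) N D m p)" .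
    have "(\<Sum>c<N. vco vec c (2 * p)) \<le> (\<Sum>c<N. \<Sum>r<2 * K. vco vec c r + xco D r)"
    proof (rule sum_mono)
      fix c
      have "vco vec c (2 * p) \<le> vco vec c (2 * p) + xco D (2 * p)" by simp
      also have "\<dots> \<le> (\<Sum>r<2 * K. vco vec c r + xco D r)"
        using p by (intro member_le_sum[of "2 * p" "{..<2 * K}" "\<lambda>r. vco vec c r + xco D r"]) auto
      finally show "vco vec c (2 * p) \<le> (\<Sum>r<2 * K. vco vec c r + xco D r)" .
    qed
    moreover have "\<tau> p \<le> (\<Sum>p<D. \<tau> p)" using p by (intro member_le_sum) auto
    ultimately have "(\<Sum>c<N. vco vec c (2 * p)) + \<tau> p < B" unfolding radix_def by linarith
    from two_digits[OF e vB this] two_digits[OF _ xB intended_xco_less] p show ?thesis by auto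
  qed
  have digits_D: "(\<Sum>c<N. \<Sum>r\<in>R c D. h r) = intended h N D m D"
    if "\<And>p. p < D \<Longrightarrow> (\<Sum>c<N. \<Sum>r\<in>R c p. h r) = intended h N D m p" for h
  proof -
    have "(\<Sum>p<K. \<Sum>c<N. \<Sum>r\<in>R c p. h r) = (\<Sum>p<K. intended h N D m p)"
      unfolding total sum_intended ..
    then show ?thesis using that by simp
  qed
  have xf: "x p = intended (xco D) N D m p" "f p = intended (fco D) N D m p" if "p \<le> D" for p
    using digits digits_D[of "xco D"] digits_D[of "fco D"] that unfolding x_def f_def
    by (cases "p = D"; simp)+
  have phi0: "\<phi> p r = 0" if p: "p \<le> D" and c: "c < N" and r: "r \<in> R c p" for p c r
  proof -
    have nn: "0 \<le> \<phi> p r" if "r \<in> R c p" for c r using R_sub phi_nonneg that by blast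
    have iN: "int (N - m) = int N - int m" using m by simp
    have z: "int N * \<phi> p (2 * p + 1) + int (N - m) * \<phi> p (2 * p) + int m * \<phi> p (2 * nxt D p) = 0"
      using phi_intended[OF p] by simp
    have cardsum: "(\<Sum>c<N. int (card (R c p))) = 2 * int N" using card_R p by simp
    have "(\<Sum>c<N. \<Sum>r\<in>R c p. \<phi> p r) =
        (if p < D then int (f p) - (2 * int p + 1) * int (x p) + 2 * int p * (int p + 1) * (2 * int N)
         else int D * int (x p) - int (f p))"
    proof -
      \<comment> \<open>The constant term of \<open>\<phi> p\<close> enters once for each of the
        \<open>2 * N\<close> item blocks of the color.\<close>
      have const: "(\<Sum>c<N. \<Sum>r\<in>R c p. C) = C * (2 * int N)" for C :: int
        unfolding cardsum[symmetric] by (simp add: sum_distrib_left mult.commute)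
      show ?thesis
        by (cases "p < D") (simp_all only: \<phi>_def f_def x_def if_True if_False of_nat_sum
          sum.distrib sum_subtractf sum_distrib_left[symmetric] const distrib_right mult.assoc)
    qed
    also have "\<dots> = int N * \<phi> p (2 * p + 1) + int (N - m) * \<phi> p (2 * p) + int m * \<phi> p (2 * nxt D p)"
      unfolding xf[OF p] intended_def \<phi>_def of_nat_add of_nat_mult iN by (simp add: algebra_simps)
    finally have "(\<Sum>c<N. \<Sum>r\<in>R c p. \<phi> p r) = 0" unfolding z .
    then have "\<forall>c\<in>{..<N}. (\<Sum>r\<in>R c p. \<phi> p r) = 0"
      by (subst (asm) sum_nonneg_eq_0_iff) (auto intro: sum_nonneg nn)
    then have "(\<Sum>r\<in>R c p. \<phi> p r) = 0" using c by simp
    then show ?thesis using r fin nn by (subst (asm) sum_nonneg_eq_0_iff) auto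
  qed
  have allowed: "R c p \<subseteq> {2 * p, 2 * p + 1, 2 * nxt D p}" if "p \<le> D" "c < N" for c p
    using phi_zero[OF _ that(1) phi0[OF that]] R_sub by blast
  \<comment> \<open>Some color takes the midpoint of edge \<open>p\<close>, and this midpoint lies
    on no other edge.\<close>
  have odd_in: "2 * p + 1 \<in> R c p" if p: "p \<le> D" and c: "c < N" for p c
  proof -
    have "2 * p + 1 \<in> (\<Union>p<K. R c p)" unfolding cover[OF c] using p by simp
    then obtain p' where p': "p' < K" "2 * p + 1 \<in> R c p'" by blast
    then have "2 * p + 1 \<in> {2 * p', 2 * p' + 1, 2 * nxt D p'}" using allowed[of p' c] c by auto
    then have "p = p'" by auto presburger+
    then show ?thesis using p' by simp
  qed
  have two: "R c p = {2 * p + 1, 2 * p} \<or> R c p = {2 * p + 1, 2 * nxt D p}" if p: "p \<le> D" and c: "c < N" for p c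
  proof -
    have "card (R c p) = 2" using card_R p c by simp
    then obtain a b where ab: "R c p = {a, b}" "a \<noteq> b" by (auto simp: card_2_iff)
    have "\<exists>y. R c p = {2 * p + 1, y} \<and> y \<noteq> 2 * p + 1"
    proof (cases "a = 2 * p + 1")
      case True
      then show ?thesis using ab by auto
    next
      case False
      then have "b = 2 * p + 1" using ab odd_in[OF p c] by simp
      then show ?thesis using ab by (metis insert_commute)
    qed
    then obtain y where y: "R c p = {2 * p + 1, y}" "y \<noteq> 2 * p + 1" by blast
    then show ?thesis using allowed[OF p c] by auto
  qed
  have ne: "nxt D p \<noteq> p" for p using D by (auto simp: nxt_def)
  define A where "A = {c. c < N \<and> 0 \<notin> R c 0}"
  \<comment> \<open>If color 0 keeps vertex 0, then color \<open>D\<close> is left with vertex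
    \<open>D\<close>, hence color \<open>D - 1\<close> with vertex \<open>D - 1\<close>, and so on
    downwards.\<close>
  have outA: "R c p = {2 * p + 1, 2 * p}" if c: "c < N" "c \<notin> A" and p: "p \<le> D" for c p
  proof -
    have z: "0 \<in> R c 0" using c by (auto simp: A_def)
    have "0 \<notin> R c D" using z disj[of 0 D c] D by auto
    then have "R c D = {2 * D + 1, 2 * D}" using two[of D c] c by (auto simp: nxt_def)
    then show ?thesis using p
    proof (induction "D - p" arbitrary: p)
      case 0 then show ?case by simp
    next
      case (Suc d)
      then have "R c (Suc p) = {2 * Suc p + 1, 2 * Suc p}" by simp
      then have "2 * Suc p \<notin> R c p" using disj[of p "Suc p" c] Suc by auto
      then show ?case using two[of p c] c Suc by (auto simp: nxt_def)
    qed
  qed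
  \<comment> \<open>If color 0 takes vertex 1, then color 1 is left with vertex 2, and so on
    upwards, until color \<open>D\<close> takes vertex 0.\<close>
  have inA: "R c p = {2 * p + 1, 2 * nxt D p}" if c: "c \<in> A" and p: "p \<le> D" for c p
    using p
  proof (induction p)
    case 0
    then show ?case using c two[of 0 c] by (auto simp: A_def)
  next
    case (Suc p)
    then have "2 * Suc p \<in> R c p" by (simp add: nxt_def)
    then have "2 * Suc p \<notin> R c (Suc p)" using disj[of p "Suc p" c] Suc by auto
    then show ?case using two[of "Suc p" c] c Suc by (auto simp: A_def)
  qed
  have sub: "A \<subseteq> {..<N}" by (auto simp: A_def)
  have finA: "finite A" using sub finite_subset by blast
  have split: "(\<Sum>c<N. \<Sum>r\<in>R c p. h c r) =
      (\<Sum>c<N. h c (2 * p + 1)) + (\<Sum>c\<in>A. h c (2 * nxt D p)) + (\<Sum>c\<in>{..<N} - A. h c (2 * p))"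
    if p: "p \<le> D" for h :: "nat \<Rightarrow> nat \<Rightarrow> nat" and p
  proof -
    have "(\<Sum>r\<in>R c p. h c r) = h c (2 * p + 1) + (if c \<in> A then h c (2 * nxt D p) else h c (2 * p))"
      if "c < N" for c
    proof (cases "c \<in> A")
      case True
      moreover have "2 * p + 1 \<noteq> 2 * nxt D p" by presburger
      ultimately show ?thesis using inA[OF _ p] by simp
    qed (use outA that p in simp)
    then have "(\<Sum>c<N. \<Sum>r\<in>R c p. h c r) =
        (\<Sum>c<N. h c (2 * p + 1)) + (\<Sum>c<N. if c \<in> A then h c (2 * nxt D p) else h c (2 * p))"
      by (simp add: sum.distrib)
    also have "(\<Sum>c<N. if c \<in> A then h c (2 * nxt D p) else h c (2 * p)) =
        (\<Sum>c\<in>A. h c (2 * nxt D p)) + (\<Sum>c\<in>{..<N} - A. h c (2 * p))"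
      using sub finA by (subst sum.If_cases) (auto simp: Int_absorb1 Diff_eq)
    finally show ?thesis by (simp only: add.assoc)
  qed
  \<comment> \<open>Color 0 takes vertex 0 or vertex 1, with first coordinates 0 and 2, so its sum
    of first coordinates counts \<open>A\<close>.\<close>
  have "x 0 = N * xco D (2 * 0 + 1) + card A * 2"
    unfolding x_def split[OF le0] using D by (simp add: xco_def nxt_def)
  moreover have "x 0 = N * xco D (2 * 0 + 1) + m * 2"
    unfolding xf(1)[OF le0] intended_def using D by (simp add: xco_def nxt_def)
  ultimately have "card A = m" by simp
  moreover have "(\<Sum>c\<in>A. vec c p) = \<tau> p" if p: "p < D" for p
  proof -
    have np: "nxt D p = Suc p" using p by (simp add: nxt_def)
    have 1: "vco vec c (2 * p + 1) = 0" "vco vec c (2 * nxt D p) = vco vec c (2 * p) + vec c p" for c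
      by (simp_all add: vco_def np)
    have "(\<Sum>c<N. vco vec c (2 * p)) = (\<Sum>c\<in>A. vco vec c (2 * p)) + (\<Sum>c\<in>{..<N} - A. vco vec c (2 * p))"
      using sum.subset_diff[OF sub] by (simp add: add.commute)
    moreover have "v p = (\<Sum>c\<in>A. vco vec c (2 * p)) + (\<Sum>c\<in>A. vec c p) + (\<Sum>c\<in>{..<N} - A. vco vec c (2 * p))"
      unfolding v_def split[OF less_imp_le[OF p]] 1 by (simp add: sum.distrib)
    ultimately show ?thesis using digits[OF p] by simp
  qed
  ultimately show ?thesis using sub by blast
qed

text \<open>If one value were below the average \<open>l\<close>, no value could exceed
  \<open>l\<close> and the sum would be too small; dually above.\<close>

lemma constant_if_balanced:
  fixes w :: "nat \<Rightarrow> nat"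
  assumes "(\<Sum>i<k. w i) = k * l" "\<And>i j. i < k \<Longrightarrow> j < k \<Longrightarrow> \<bar>int (w i) - int (w j)\<bar> \<le> 1" "i < k"
  shows "w i = l"
proof (rule ccontr)
  assume "w i \<noteq> l"
  then consider "w i < l" | "l < w i" by linarith
  then show False
  proof cases
    case 1
    have "w j \<le> l" if "j < k" for j using assms(2)[OF that assms(3)] 1 by linarith
    then have "(\<Sum>i<k. w i) < (\<Sum>i<k. l)" using 1 assms(3) by (intro sum_strict_mono_ex1) auto
    then show False using assms(1) by simp
  next
    case 2
    have "l \<le> w j" if "j < k" for j using assms(2)[OF that assms(3)] 2 by linarith
    then have "(\<Sum>i<k. l) < (\<Sum>i<k. w i)" using 2 assms(3) by (intro sum_strict_mono_ex1) auto
    then show False using assms(1) by simp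
  qed
qed

theorem coloring_iff_solution:
  "(\<exists>col. fair K (Suc N) col \<and> (\<forall>i<K. \<forall>j<K.
      \<bar>int (load col i) - int (load col j)\<bar> \<le> 1)) \<longleftrightarrow>
   (\<exists>A\<subseteq>{..<N}. card A = m \<and> (\<forall>p<D. (\<Sum>c\<in>A. vec c p) = \<tau> p))"
proof
  assume "\<exists>col. fair K (Suc N) col \<and> (\<forall>i<K. \<forall>j<K.
      \<bar>int (load col i) - int (load col j)\<bar> \<le> 1)"
  then obtain col where col: "fair K (Suc N) col" and bal: "\<And>i j. i < K \<Longrightarrow> j < K \<Longrightarrow>
      \<bar>int (load col i) - int (load col j)\<bar> \<le> 1" by blast
  show "\<exists>A\<subseteq>{..<N}. card A = m \<and> (\<forall>p<D. (\<Sum>c\<in>A. vec c p) = \<tau> p)"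
    by (rule coloring_imp_solution[OF col constant_if_balanced[OF sum_class_weights[OF col] bal]])
next
  assume "\<exists>A\<subseteq>{..<N}. card A = m \<and> (\<forall>p<D. (\<Sum>c\<in>A. vec c p) = \<tau> p)"
  then obtain A where A: "A \<subseteq> {..<N}" "card A = m" "\<And>p. p < D \<Longrightarrow> (\<Sum>c\<in>A. vec c p) = \<tau> p" by blast
  from solution_imp_coloring[OF A] show "\<exists>col. fair K (Suc N) col \<and> (\<forall>i<K. \<forall>j<K.
      \<bar>int (load col i) - int (load col j)\<bar> \<le> 1)"
    by fastforce
qed

end


section \<open>Local certificates for shallow circuits\<close>

text \<open>A row of the code has \<open>n + 2\<close> bits, the kind first, and a true bit is the
  symbol 2. The first kind bit separates and/or gates from inputs and negations; the second tells or
  from and, and negation from input. So \<open>(b = 1) = kind2 I n g\<close> singles out an or gate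
  that is true or an and gate that is false, where one predecessor decides.\<close>

definition kind1 :: "(nat \<Rightarrow> nat) \<Rightarrow> nat \<Rightarrow> nat \<Rightarrow> bool" where
  "kind1 I n g \<longleftrightarrow> I (g * (n + 2)) = 2"

definition kind2 :: "(nat \<Rightarrow> nat) \<Rightarrow> nat \<Rightarrow> nat \<Rightarrow> bool" where
  "kind2 I n g \<longleftrightarrow> I (g * (n + 2) + 1) = 2"

definition adj :: "(nat \<Rightarrow> nat) \<Rightarrow> nat \<Rightarrow> nat \<Rightarrow> nat \<Rightarrow> bool" where
  "adj I n g i \<longleftrightarrow> I (g * (n + 2) + 2 + i) = 2"

text \<open>
  Three-valued evaluation up to height \<open>h\<close>, where an input gate \<open>g\<close> is true if \<open>g + 1\<close> is the left end of one of
  the \<open>q\<close> intervals, false if it is interior to one, and unknown otherwise. Positions are shifted by one so that 0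
  and \<open>n + 1\<close> can serve as sentinels. The truth value \<open>b\<close> is 0 or 1.
\<close>

primrec cert :: "nat \<Rightarrow> (nat \<Rightarrow> nat) \<Rightarrow> nat \<Rightarrow> nat \<Rightarrow> (nat \<Rightarrow> nat) \<Rightarrow> (nat \<Rightarrow> nat) \<Rightarrow> nat \<Rightarrow> nat \<Rightarrow> bool" where
  "cert 0 I n q lo hi g b \<longleftrightarrow> False"
| "cert (Suc h) I n q lo hi g b \<longleftrightarrow>
    (if \<not> kind1 I n g then
       (if \<not> kind2 I n g then \<exists>l<q. if b = 1 then lo l = Suc g else lo l < Suc g \<and> Suc g < hi l
        else \<exists>i<n. adj I n g i \<and> cert h I n q lo hi i (1 - b))
     else if (b = 1) = kind2 I n g then \<exists>i<n. adj I n g i \<and> cert h I n q lo hi i b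
     else \<forall>i<n. adj I n g i \<longrightarrow> cert h I n q lo hi i b)"

declare cert.simps(2) [simp del]

text \<open>Where all predecessors matter, a large gate may appeal to the absence of a refutation by
  the given \<open>2 ^ d\<close> intervals, as input gates do. For a single choice of intervals this
  proves nothing; the claim becomes binding by being tested for every choice.\<close>

definition justified :: "nat \<Rightarrow> (nat \<Rightarrow> nat) \<Rightarrow> nat \<Rightarrow> (nat \<Rightarrow> nat) \<Rightarrow> (nat \<Rightarrow> nat) \<Rightarrow> (nat \<Rightarrow> nat \<Rightarrow> bool) \<Rightarrow> nat \<Rightarrow> nat \<Rightarrow> bool" where
  "justified d I n lo hi P g b \<longleftrightarrow>
    (if \<not> kind1 I n g then
       (if \<not> kind2 I n g then \<not> cert (Suc d) I n (2 ^ d) lo hi g (1 - b)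
        else \<exists>i<n. adj I n g i \<and> P i (1 - b))
     else if (b = 1) = kind2 I n g then \<exists>i<n. adj I n g i \<and> P i b
     else (\<forall>i<n. adj I n g i \<longrightarrow> P i b) \<or>
       (2 < (\<Sum>i<n. of_bool (adj I n g i) :: nat) \<and>
        (\<forall>i<n. adj I n g i \<longrightarrow> \<not> cert (Suc d) I n (2 ^ d) lo hi i (1 - b))))"

text \<open>The cap \<open>r\<close> is a constant of the reduction and keeps the power definable;
  for \<open>i < r\<close> this is the ordinary digit.\<close>

definition digit :: "nat \<Rightarrow> nat \<Rightarrow> nat \<Rightarrow> nat \<Rightarrow> nat" where
  "digit M r y i = y div M ^ min i r mod M"

text \<open>
  A digit \<open>2 * g + b\<close> of \<open>W\<close> claims that gate \<open>g\<close> has value \<open>b\<close>.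
\<close>

definition claimed :: "nat \<Rightarrow> nat \<Rightarrow> nat \<Rightarrow> nat \<Rightarrow> nat \<Rightarrow> bool" where
  "claimed d n W g b \<longleftrightarrow> (\<exists>i<2 ^ Suc d. digit (2 * n + 2) (2 ^ Suc d) W i = 2 * g + b)"

text \<open>Speaks of the chosen intervals only. Over all choices, the first conjunct says that the
  marks increase.\<close>

definition check :: "nat \<Rightarrow> (nat \<Rightarrow> nat) \<Rightarrow> nat \<Rightarrow> (nat \<Rightarrow> nat) \<Rightarrow> (nat \<Rightarrow> nat) \<Rightarrow> nat \<Rightarrow> bool" where
  "check d I n lo hi W \<longleftrightarrow> (\<forall>l<2 ^ d. lo l < hi l) \<and> claimed d n W (n - 1) 1 \<and>
    (\<forall>g<n. \<forall>b<2. claimed d n W g b \<longrightarrow> justified d I n lo hi (claimed d n W) g b)"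

text \<open>\<open>W\<close> has \<open>2 ^ Suc d\<close> digits, to a base above every
  \<open>2 * g + b\<close>. Marks are at most \<open>n + 1\<close> and fit under the same
  bound.\<close>

definition modulus :: "nat \<Rightarrow> nat \<Rightarrow> nat" where
  "modulus d n = (2 * n + 2) ^ 2 ^ Suc d"

lemma digits_exist:
  fixes B :: nat
  assumes "\<And>i. i < r \<Longrightarrow> f i < B"
  shows "\<exists>y<B ^ r. \<forall>i<r. digit B r y i = f i"
proof -
  have "\<exists>y<B ^ r. \<forall>i<r. y div B ^ i mod B = f i"
    using assms
  proof (induction r arbitrary: f)
    case (Suc r)
    have "\<And>i. i < r \<Longrightarrow> f (Suc i) < B" using Suc.prems by simp
    then obtain y where y: "y < B ^ r" "\<forall>i<r. y div B ^ i mod B = f (Suc i)" using Suc.IH[of "\<lambda>i. f (Suc i)"] by blast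
    have f0: "f 0 < B" using Suc.prems by simp
    have "f 0 + B * y < B * Suc y" using f0 by simp
    also have "\<dots> \<le> B ^ Suc r" unfolding power_Suc using y(1) by (intro mult_le_mono2) simp
    finally have 1: "f 0 + B * y < B ^ Suc r" .
    have "(f 0 + B * y) div B ^ i mod B = f i" if "i < Suc r" for i
      using that f0 y(2) by (cases i) (simp_all add: div_mult2_eq)
    then show ?case using 1 by blast
  qed simp
  then show ?thesis by (auto simp: digit_def)
qed

lemma enumerate_subset:
  assumes "finite T" "card T \<le> q" "T \<subseteq> U" "a \<in> U"
  shows "\<exists>t. (\<forall>l<q. t l \<in> U) \<and> T \<subseteq> t ` {..<q::nat}"
proof -
  obtain e where e: "bij_betw e {..<card T} T" using assms(1) ex_bij_betw_nat_finite atLeast0LessThan by metis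
  define t where "t l = (if l < card T then e l else a)" for l
  have eT: "e ` {..<card T} = T" using e by (simp add: bij_betw_def)
  have "t l \<in> U" for l using assms(3,4) eT by (auto simp: t_def)
  moreover have "T \<subseteq> t ` {..<q}"
  proof
    fix x assume "x \<in> T"
    then obtain l where "l < card T" "x = e l" using eT by auto
    then show "x \<in> t ` {..<q}" using assms(2) by (intro image_eqI[of _ _ l]) (auto simp: t_def)
  qed
  ultimately show ?thesis by blast
qed

lemma concat_nth_uniform:
  assumes "\<And>x. x \<in> set xs \<Longrightarrow> length x = m" "g < length xs" "j < m"
  shows "concat xs ! (g * m + j) = xs ! g ! j"
  using assms
proof (induction xs arbitrary: g)
  case (Cons x xs)
  then show ?case by (cases g) (auto simp: nth_append)
qed simp

lemma symbol_circuit_code: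
  assumes "g < length C" "j < length C + 2"
  shows "symbol (circuit_code C) (g * (length C + 2) + j) = 2 \<longleftrightarrow>
    (gate_kind (C ! g) @ map (\<lambda>i. i \<in> preds (C ! g)) [0..<length C]) ! j"
proof -
  let ?n = "length C"
  let ?rows = "map (\<lambda>g. gate_kind g @ map (\<lambda>i. i \<in> preds g) [0..<?n]) C"
  have k: "length (gate_kind g) = 2" for g by (cases g) auto
  have "circuit_code C ! (g * (?n + 2) + j) = ?rows ! g ! j"
    unfolding circuit_code_def using assms by (intro concat_nth_uniform) (auto simp: k)
  moreover have "g * (?n + 2) + j < length (circuit_code C)"
  proof -
    have "g * (?n + 2) + j < Suc g * (?n + 2)" using assms(2) by simp
    also have "\<dots> \<le> ?n * (?n + 2)" using assms(1) by (intro mult_le_mono1) simp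
    finally show ?thesis by (simp only: length_circuit_code)
  qed
  ultimately show ?thesis using assms(1) by (simp add: symbol_def)
qed

section \<open>Gate values and paths in a circuit of depth \<open>d\<close> and weft 1\<close>

locale shallow_circuit =
  fixes C :: circuit and d :: nat
  assumes wf: "wf_circuit C" and weft: "weft_at_most C 1" and depth: "depth_at_most C d"
begin

abbreviation "n \<equiv> length C"
abbreviation "I \<equiv> symbol (circuit_code C)"
abbreviation "big g \<equiv> 2 < card (preds (C ! g))"

lemma preds_less: "g < n \<Longrightarrow> i \<in> preds (C ! g) \<Longrightarrow> i < g"
  using wf unfolding wf_circuit_def by blast

lemma finite_preds: "g < n \<Longrightarrow> finite (preds (C ! g))"
  using preds_less finite_subset[of _ "{..<g}"] by blast

lemma n_pos: "0 < n" using wf by (simp add: wf_circuit_def)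

lemma kinds:
  assumes "g < n"
  shows "kind1 I n g \<longleftrightarrow> gate_kind (C ! g) ! 0" "kind2 I n g \<longleftrightarrow> gate_kind (C ! g) ! 1"
proof -
  have k: "length (gate_kind g) = 2" for g by (cases g) auto
  show "kind1 I n g \<longleftrightarrow> gate_kind (C ! g) ! 0"
    using symbol_circuit_code[OF assms, of 0] by (simp add: kind1_def nth_append k)
  show "kind2 I n g \<longleftrightarrow> gate_kind (C ! g) ! 1"
    using symbol_circuit_code[OF assms, of 1] by (simp add: kind2_def nth_append k)
qed

lemma adj_iff:
  assumes "g < n" "i < n"
  shows "adj I n g i \<longleftrightarrow> i \<in> preds (C ! g)"
proof -
  have k: "length (gate_kind g) = 2" for g by (cases g) auto
  show ?thesis
    using symbol_circuit_code[OF assms(1), of "2 + i"] assms(2) by (simp add: adj_def nth_append k add.assoc)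
qed

lemma ex_adj: "g < n \<Longrightarrow> (\<exists>i<n. adj I n g i \<and> P i) \<longleftrightarrow> (\<exists>i\<in>preds (C ! g). P i)"
  using adj_iff preds_less by (meson less_trans)

lemma all_adj: "g < n \<Longrightarrow> (\<forall>i<n. adj I n g i \<longrightarrow> P i) \<longleftrightarrow> (\<forall>i\<in>preds (C ! g). P i)"
  using adj_iff preds_less by (meson less_trans)

lemma sum_adj: "g < n \<Longrightarrow> (\<Sum>i<n. of_bool (adj I n g i)) = card (preds (C ! g))"
proof -
  assume g: "g < n"
  have "{i. i < n \<and> adj I n g i} = preds (C ! g)" using adj_iff[OF g] less_trans[OF preds_less[OF g] g] by blast
  moreover have "(\<Sum>i<n. of_bool (adj I n g i)) = card {i. i < n \<and> adj I n g i}"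
    by (simp add: of_bool_def sum.If_cases Int_def)
  ultimately show ?thesis by simp
qed

text \<open>With the truth value as an argument, a true or gate and a false and gate share one rule,
  and so do their duals.\<close>

definition V :: "nat set \<Rightarrow> nat \<Rightarrow> nat \<Rightarrow> bool" where
  "V S g b \<longleftrightarrow> (gate_value C S g \<longleftrightarrow> b = 1)"

lemma gate_cases [case_names input neg ex all]:
  assumes "\<lbrakk>\<not> kind1 I n g; \<not> kind2 I n g\<rbrakk> \<Longrightarrow> thesis" "\<lbrakk>\<not> kind1 I n g; kind2 I n g\<rbrakk> \<Longrightarrow> thesis"
    "\<lbrakk>kind1 I n g; (b = 1) = kind2 I n g\<rbrakk> \<Longrightarrow> thesis" "\<lbrakk>kind1 I n g; (b = 1) \<noteq> kind2 I n g\<rbrakk> \<Longrightarrow> thesis"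
  shows thesis
  using assms by blast

lemma V_flip: "b < 2 \<Longrightarrow> V S g (1 - b) \<longleftrightarrow> \<not> V S g b"
  by (auto simp: V_def less_2_cases_iff)

lemma V_input: "g < n \<Longrightarrow> \<not> kind1 I n g \<Longrightarrow> \<not> kind2 I n g \<Longrightarrow> V S g b \<longleftrightarrow> (g \<in> S \<longleftrightarrow> b = 1)"
  unfolding V_def by (subst gate_value.simps) (cases "C ! g"; simp add: kinds)

lemma V_not:
  assumes "g < n" "\<not> kind1 I n g" "kind2 I n g" "b < 2"
  shows "V S g b \<longleftrightarrow> (\<exists>i\<in>preds (C ! g). V S i (1 - b))"
proof (cases "C ! g")
  case (NotGate i)
  then have "i < g" using preds_less[OF assms(1)] by simp
  then show ?thesis using assms(4) unfolding V_def by (subst gate_value.simps) (auto simp: NotGate less_2_cases_iff)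
qed (use assms in \<open>auto simp: kinds\<close>)

lemma V_ex:
  assumes "g < n" "kind1 I n g" "(b = 1) = kind2 I n g"
  shows "V S g b \<longleftrightarrow> (\<exists>i\<in>preds (C ! g). V S i b)"
proof -
  have A: "{i \<in> preds (C ! g). i < g} = preds (C ! g)" using preds_less[OF assms(1)] by blast
  show ?thesis using assms A unfolding V_def
    by (subst gate_value.simps) (cases "C ! g"; auto simp: kinds)
qed

lemma V_all:
  assumes "g < n" "kind1 I n g" "(b = 1) \<noteq> kind2 I n g"
  shows "V S g b \<longleftrightarrow> (\<forall>i\<in>preds (C ! g). V S i b)"
proof -
  have A: "{i \<in> preds (C ! g). i < g} = preds (C ! g)" using preds_less[OF assms(1)] by blast
  show ?thesis using assms A unfolding V_def
    by (subst gate_value.simps) (cases "C ! g"; auto simp: kinds)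
qed

definition chain :: "nat list \<Rightarrow> bool" where
  "chain p \<longleftrightarrow> p \<noteq> [] \<and> last p = n - 1 \<and> hd p < n \<and> successively (\<lambda>i j. i \<in> preds (C ! j)) p"

text \<open>The wires and large gates already spent between \<open>g\<close> and the output; what is
  left for the gates below is \<open>d - a\<close> and \<open>1 - w\<close>.\<close>

definition on_path :: "nat \<Rightarrow> nat \<Rightarrow> nat \<Rightarrow> bool" where
  "on_path a w g \<longleftrightarrow> (\<exists>p. chain p \<and> hd p = g \<and> length p = Suc a \<and> length (filter big p) = w)"

text \<open>Depth and weft restrict only paths that begin at an input. Every other gate has a
  predecessor, so any path to the output can be prolonged down to an input.\<close>

lemma down_path:
  "g < n \<Longrightarrow> \<exists>p. p \<noteq> [] \<and> hd p \<in> input_gates C \<and> last p = g \<and> successively (\<lambda>i j. i \<in> preds (C ! j)) p"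
proof (induction g rule: less_induct)
  case (less g)
  show ?case
  proof (cases "C ! g = InputGate")
    case True
    then show ?thesis using less.prems by (intro exI[of _ "[g]"]) (simp add: input_gates_def)
  next
    case False
    have "2 \<le> card A" if "C ! g = AndGate A \<or> C ! g = OrGate A" for A
      using wf less.prems that unfolding wf_circuit_def by blast
    then have "preds (C ! g) \<noteq> {}" using False by (cases "C ! g") fastforce+
    then obtain i where i: "i \<in> preds (C ! g)" by blast
    then have "i < g" using preds_less less.prems by blast
    then obtain p where p: "p \<noteq> []" "hd p \<in> input_gates C" "last p = i" "successively (\<lambda>i j. i \<in> preds (C ! j)) p"
      using less by force
    then show ?thesis using i by (intro exI[of _ "p @ [g]"]) (simp add: successively_append_iff)
  qed
qed

lemma on_path_bounds:
  assumes "on_path a w g"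
  shows "a \<le> d" "w \<le> 1" "g < n"
proof -
  obtain p where p: "chain p" "hd p = g" "length p = Suc a" "length (filter big p) = w"
    using assms by (auto simp: on_path_def)
  then show g: "g < n" by (simp add: chain_def)
  obtain r where r: "r \<noteq> []" "hd r \<in> input_gates C" "last r = g" "successively (\<lambda>i j. i \<in> preds (C ! j)) r"
    using down_path[OF g] by blast
  have rb: "r = butlast r @ [g]" using r(1,3) append_butlast_last_id by metis
  have sb: "successively (\<lambda>i j. i \<in> preds (C ! j)) (butlast r) \<and>
      (butlast r \<noteq> [] \<longrightarrow> last (butlast r) \<in> preds (C ! g))"
    using r(4) by (subst (asm) rb) (auto simp: successively_append_iff)
  have hd: "hd (butlast r @ p) \<in> input_gates C"
  proof (cases "butlast r = []")
    case True
    then have "r = [g]" using rb by simp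
    then show ?thesis using r(2) p(2) True by simp
  next
    case False
    then show ?thesis using r(2) by (subst (asm) rb) simp
  qed
  have "output_path C (butlast r @ p)"
    unfolding output_path_def using hd sb p by (auto simp: chain_def successively_append_iff)
  then show "a \<le> d" "w \<le> 1"
    using depth weft p(3,4) unfolding depth_at_most_def weft_at_most_def by fastforce+
qed

lemma on_path_out: "\<exists>w. on_path 0 w (n - 1)"
  unfolding on_path_def chain_def using n_pos by (intro exI[of _ "length (filter big [n - 1])"] exI[of _ "[n - 1]"]) simp

lemma on_path_pred:
  assumes "on_path a w g" "i \<in> preds (C ! g)"
  shows "on_path (Suc a) (w + (if big i then 1 else 0)) i"
proof -
  obtain p where p: "chain p" "hd p = g" "length p = Suc a" "length (filter big p) = w"
    using assms(1) by (auto simp: on_path_def)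
  have "i < n" using preds_less[OF _ assms(2)] p by (fastforce simp: chain_def)
  then have "chain (i # p)" using p assms(2) by (auto simp: chain_def successively_Cons)
  then show ?thesis unfolding on_path_def using p by (intro exI[of _ "i # p"]) auto
qed

lemma on_path_big: "on_path a w g \<Longrightarrow> big g \<Longrightarrow> w = 1"
proof -
  assume r: "on_path a w g" "big g"
  then obtain p where p: "chain p" "hd p = g" "length (filter big p) = w" by (auto simp: on_path_def)
  then have "g \<in> set (filter big p)" using r(2) by (auto simp: chain_def)
  then have "w \<noteq> 0" using p(3) by force
  then show "w = 1" using on_path_bounds(2)[OF r(1)] by simp
qed

text \<open>Also bounds the height: a downward path from \<open>g\<close> has at most
  \<open>h\<close> gates, because the predicate is false at 0.\<close>

primrec small_below :: "nat \<Rightarrow> nat \<Rightarrow> bool" where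
  "small_below 0 g \<longleftrightarrow> False"
| "small_below (Suc h) g \<longleftrightarrow> card (preds (C ! g)) \<le> 2 \<and> (\<forall>i\<in>preds (C ! g). small_below h i)"

lemma small_below_Suc: "small_below h g \<Longrightarrow> small_below (Suc h) g"
  by (induction h arbitrary: g) auto

lemma small_below_mono: "h \<le> h' \<Longrightarrow> small_below h g \<Longrightarrow> small_below h' g"
  by (induction rule: dec_induct) (use small_below_Suc in blast)+

text \<open>The part of the path above \<open>g\<close> has used up the only large gate that weft 1
  allows.\<close>

lemma on_path_small_below: "on_path a 1 g \<Longrightarrow> \<not> big g \<Longrightarrow> small_below (Suc (d - a)) g"
proof (induction "d - a" arbitrary: a g)
  case 0
  have "a \<le> d" using on_path_bounds(1)[OF 0(2)] .
  have "preds (C ! g) = {}"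
  proof (rule ccontr)
    assume "preds (C ! g) \<noteq> {}"
    then obtain i where "i \<in> preds (C ! g)" by blast
    then show False using on_path_bounds(1)[OF on_path_pred[OF 0(2)]] 0(1) by fastforce
  qed
  then show ?case by simp
next
  case (Suc e)
  have "small_below (d - a) i" if i: "i \<in> preds (C ! g)" for i
  proof -
    have r: "on_path (Suc a) (1 + (if big i then 1 else 0)) i" using on_path_pred[OF Suc(3) i] .
    then have nb: "\<not> big i" using on_path_bounds(2) by fastforce
    then have "small_below (Suc (d - Suc a)) i" using Suc(1)[of "Suc a" i] Suc(2) r by simp
    moreover have "Suc (d - Suc a) = d - a" using Suc(2) by simp
    ultimately show ?thesis by simp
  qed
  then show ?case using Suc(4) by simp
qed

lemma child_of_big:
  assumes "on_path a w g" "big g" "i \<in> preds (C ! g)"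
  shows "small_below (Suc d) i"
proof -
  have r: "on_path (Suc a) (1 + (if big i then 1 else 0)) i" using on_path_pred[OF assms(1,3)] on_path_big[OF assms(1,2)] by simp
  then have nb: "\<not> big i" using on_path_bounds(2) by fastforce
  then have "small_below (Suc (d - Suc a)) i" using on_path_small_below r by simp
  then show ?thesis using small_below_mono[of "Suc (d - Suc a)" "Suc d"] by simp
qed

section \<open>Certificates from intervals between marked inputs\<close>

definition marks :: "nat \<Rightarrow> (nat \<Rightarrow> nat) \<Rightarrow> bool" where
  "marks k s \<longleftrightarrow> s 0 = 0 \<and> s (Suc k) = Suc n \<and> (\<forall>j\<le>k. s j < s (Suc j))"

definition marked :: "nat \<Rightarrow> (nat \<Rightarrow> nat) \<Rightarrow> nat set" where
  "marked k s = {g. \<exists>j. 1 \<le> j \<and> j \<le> k \<and> s j = Suc g}"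

lemma marks_mono: "marks k s \<Longrightarrow> i < j \<Longrightarrow> j \<le> Suc k \<Longrightarrow> s i < s j"
proof (induction j)
  case (Suc j)
  have "s j < s (Suc j)" using Suc.prems by (simp add: marks_def)
  then show ?case using Suc by (cases "i = j") auto
qed simp

lemma cert_sound:
  assumes s: "marks k s" and int: "\<And>l. l < q \<Longrightarrow> \<exists>j\<le>k. lo l = s j \<and> hi l = s (Suc j)"
  shows "g < n \<Longrightarrow> b < 2 \<Longrightarrow> cert h I n q lo hi g b \<Longrightarrow> V (marked k s) g b"
proof (induction h arbitrary: g b)
  case (Suc h)
  have pl: "i < n" if "i \<in> preds (C ! g)" for i using preds_less[OF Suc.prems(1) that] Suc.prems(1) by simp
  show ?case
  proof (cases rule: gate_cases[where g = g and b = b])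
    case input
    then obtain l where l: "l < q" "if b = 1 then lo l = Suc g else lo l < Suc g \<and> Suc g < hi l"
      using Suc.prems(3) by (auto simp: cert.simps(2))
    obtain j where j: "j \<le> k" "lo l = s j" "hi l = s (Suc j)" using int[OF l(1)] by blast
    show ?thesis
    proof (cases "b = 1")
      case True
      then have "s j = Suc g" using l j by simp
      moreover have "1 \<le> j" using calculation s by (cases j) (auto simp: marks_def)
      ultimately show ?thesis using V_input[OF Suc.prems(1) input] True j by (auto simp: marked_def)
    next
      case False
      then have gap: "s j < Suc g" "Suc g < s (Suc j)" using l j by auto
      have "g \<notin> marked k s"
      proof
        assume "g \<in> marked k s"
        then obtain i where i: "1 \<le> i" "i \<le> k" "s i = Suc g" by (auto simp: marked_def)
        consider "i \<le> j" | "Suc j \<le> i" by linarith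
        then show False
        proof cases
          case 1
          then have "s i \<le> s j" using marks_mono[OF s, of i j] j(1) by (cases "i = j") auto
          then show False using gap i by simp
        next
          case 2
          then have "s (Suc j) \<le> s i" using marks_mono[OF s, of "Suc j" i] i(2) by (cases "i = Suc j") auto
          then show False using gap i by simp
        qed
      qed
      then show ?thesis using V_input[OF Suc.prems(1) input] False by simp
    qed
  next
    case neg
    then have "\<exists>i\<in>preds (C ! g). cert h I n q lo hi i (1 - b)"
      using Suc.prems(3) ex_adj[OF Suc.prems(1)] by (simp add: cert.simps(2))
    moreover have "1 - b < 2" by simp
    ultimately show ?thesis using V_not[OF Suc.prems(1) neg Suc.prems(2)] Suc.IH pl by blast
  next
    case ex
    then have "\<exists>i\<in>preds (C ! g). cert h I n q lo hi i b"
      using Suc.prems(3) ex_adj[OF Suc.prems(1)] by (simp add: cert.simps(2))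
    then show ?thesis using V_ex[OF Suc.prems(1) ex] Suc.IH pl Suc.prems(2) by blast
  next
    case all
    then have "\<forall>i\<in>preds (C ! g). cert h I n q lo hi i b"
      using Suc.prems(3) all_adj[OF Suc.prems(1)] by (cases "kind2 I n g") (auto simp: cert.simps(2))
    then show ?thesis using V_all[OF Suc.prems(1) all] Suc.IH pl Suc.prems(2) by blast
  qed
qed simp

text \<open>Quantifying over all families that contain the intervals of \<open>T\<close> builds in
  monotonicity, so the certificates of two predecessors merge by a union.\<close>

definition covers :: "(nat \<Rightarrow> nat) \<Rightarrow> nat \<Rightarrow> (nat \<Rightarrow> nat) \<Rightarrow> (nat \<Rightarrow> nat) \<Rightarrow> nat set \<Rightarrow> bool" where
  "covers s q lo hi T \<longleftrightarrow> (\<forall>j\<in>T. \<exists>l<q. lo l = s j \<and> hi l = s (Suc j))"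

lemma find_interval:
  assumes "marks k s" "g < n" "Suc g \<notin> s ` {1..k}"
  shows "\<exists>j\<le>k. s j < Suc g \<and> Suc g < s (Suc j)"
proof -
  define j where "j = Max {j. j \<le> k \<and> s j < Suc g}"
  have fin: "finite {j. j \<le> k \<and> s j < Suc g}" by simp
  have "0 \<in> {j. j \<le> k \<and> s j < Suc g}" using assms(1) by (simp add: marks_def)
  then have j: "j \<le> k" "s j < Suc g" using Max_in[OF fin] unfolding j_def by blast+
  have "Suc g < s (Suc j)"
  proof (cases "j = k")
    case True
    then show ?thesis using assms(1,2) by (simp add: marks_def)
  next
    case False
    then have "Suc j \<le> k" using j by simp
    moreover have "Suc j \<notin> {j. j \<le> k \<and> s j < Suc g}" 
    proof
      assume "Suc j \<in> {j. j \<le> k \<and> s j < Suc g}"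
      from Max_ge[OF fin this] show False unfolding j_def by linarith
    qed
    moreover have "s (Suc j) \<in> s ` {1..k}" using calculation(1) by (intro imageI) simp
    then have "s (Suc j) \<noteq> Suc g" using assms(3) by metis
    ultimately have "\<not> s (Suc j) < Suc g" "s (Suc j) \<noteq> Suc g" by auto
    then show ?thesis by simp
  qed
  then show ?thesis using j by blast
qed

lemma cert_complete_input:
  assumes "marks k s" "g < n" "\<not> kind1 I n g" "\<not> kind2 I n g" "V (marked k s) g b"
  shows "\<exists>T\<subseteq>{..k}. card T = 1 \<and> (\<forall>h q lo hi. covers s q lo hi T \<longrightarrow> cert (Suc h) I n q lo hi g b)"
proof -
  have v: "g \<in> marked k s \<longleftrightarrow> b = 1" using V_input assms by simp
  obtain j where j: "j \<le> k" "if b = 1 then s j = Suc g else s j < Suc g \<and> Suc g < s (Suc j)"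
  proof (cases "b = 1")
    case True
    then show ?thesis using v that by (auto simp: marked_def)
  next
    case False
    then have "Suc g \<notin> s ` {1..k}" using v by (force simp: marked_def)
    then show ?thesis using find_interval[OF assms(1,2)] that False by auto
  qed
  have "cert (Suc h) I n q lo hi g b" if "covers s q lo hi {j}" for h q lo hi
    using that j(2) assms(3,4) by (auto simp: covers_def cert.simps(2))
  moreover have "{j} \<subseteq> {..k}" "card {j} = 1" using j(1) by auto
  ultimately show ?thesis by blast
qed

text \<open>A small gate has at most two predecessors, so each level at most doubles the number of
  intervals.\<close>

lemma cert_complete:
  assumes s: "marks k s"
  shows "g < n \<Longrightarrow> b < 2 \<Longrightarrow> small_below (Suc h) g \<Longrightarrow> V (marked k s) g b \<Longrightarrow>
    \<exists>T\<subseteq>{..k}. card T \<le> 2 ^ h \<and> (\<forall>q lo hi. covers s q lo hi T \<longrightarrow> cert (Suc h) I n q lo hi g b)"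
proof (induction h arbitrary: g b)
  case (0 g b)
  then have "preds (C ! g) = {}" by auto
  then have kinds0: "\<not> kind1 I n g" "\<not> kind2 I n g"
    using wf 0(1) kinds[OF 0(1)] unfolding wf_circuit_def by (cases "C ! g"; force)+
  from cert_complete_input[OF s 0(1) this 0(4)] show ?case by (metis order_refl power_0)
next
  case (Suc h g b)
  have pl: "i < n" if "i \<in> preds (C ! g)" for i using preds_less[OF Suc.prems(1) that] Suc.prems(1) by simp
  have b': "1 - b < 2" by simp
  have sm: "small_below (Suc h) i" if "i \<in> preds (C ! g)" for i using Suc.prems(3) that by simp
  show ?case
  proof (cases rule: gate_cases[where g = g and b = b])
    case input
    from cert_complete_input[OF s Suc.prems(1) this Suc.prems(4)] show ?thesis by (metis one_le_numeral one_le_power)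
  next
    case neg
    then obtain i where i: "i \<in> preds (C ! g)" "V (marked k s) i (1 - b)"
      using V_not[OF Suc.prems(1) neg Suc.prems(2)] Suc.prems(4) by blast
    obtain T where T: "T \<subseteq> {..k}" "card T \<le> 2 ^ h" "\<And>q lo hi. covers s q lo hi T \<Longrightarrow> cert (Suc h) I n q lo hi i (1 - b)"
      using Suc.IH[OF pl[OF i(1)] b' sm[OF i(1)] i(2)] by blast
    have "cert (Suc (Suc h)) I n q lo hi g b" if "covers s q lo hi T" for q lo hi
      unfolding cert.simps(2)[of "Suc h"] ex_adj[OF Suc.prems(1)] using T(3)[OF that] i(1) neg by auto
    moreover have "card T \<le> 2 ^ Suc h" using T(2) by simp
    ultimately show ?thesis using T(1) by blast
  next
    case ex
    then obtain i where i: "i \<in> preds (C ! g)" "V (marked k s) i b"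
      using V_ex[OF Suc.prems(1) ex] Suc.prems(4) by blast
    obtain T where T: "T \<subseteq> {..k}" "card T \<le> 2 ^ h" "\<And>q lo hi. covers s q lo hi T \<Longrightarrow> cert (Suc h) I n q lo hi i b"
      using Suc.IH[OF pl[OF i(1)] Suc.prems(2) sm[OF i(1)] i(2)] by blast
    have "cert (Suc (Suc h)) I n q lo hi g b" if "covers s q lo hi T" for q lo hi
      unfolding cert.simps(2)[of "Suc h"] ex_adj[OF Suc.prems(1)] using T(3)[OF that] i(1) ex by auto
    moreover have "card T \<le> 2 ^ Suc h" using T(2) by simp
    ultimately show ?thesis using T(1) by blast
  next
    case all
    have "\<forall>i\<in>preds (C ! g). \<exists>T\<subseteq>{..k}. card T \<le> 2 ^ h \<and> (\<forall>q lo hi. covers s q lo hi T \<longrightarrow> cert (Suc h) I n q lo hi i b)"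
      using Suc.IH[OF pl Suc.prems(2) sm] V_all[OF Suc.prems(1) all] Suc.prems(4) by blast
    then obtain T where T: "\<And>i. i \<in> preds (C ! g) \<Longrightarrow> T i \<subseteq> {..k} \<and> card (T i) \<le> 2 ^ h \<and>
        (\<forall>q lo hi. covers s q lo hi (T i) \<longrightarrow> cert (Suc h) I n q lo hi i b)" by metis
    let ?U = "\<Union>i\<in>preds (C ! g). T i"
    have "card ?U \<le> (\<Sum>i\<in>preds (C ! g). card (T i))" using finite_preds[OF Suc.prems(1)] by (rule card_UN_le)
    also have "\<dots> \<le> (\<Sum>i\<in>preds (C ! g). 2 ^ h)" using T by (intro sum_mono) blast
    also have "\<dots> = card (preds (C ! g)) * 2 ^ h" by simp
    also have "\<dots> \<le> 2 * 2 ^ h" using Suc.prems(3) by (intro mult_le_mono1) simp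
    finally have c: "card ?U \<le> 2 ^ Suc h" by simp
    have "cert (Suc (Suc h)) I n q lo hi g b" if "covers s q lo hi ?U" for q lo hi
    proof -
      have "covers s q lo hi (T i)" if "i \<in> preds (C ! g)" for i
        using \<open>covers s q lo hi ?U\<close> that unfolding covers_def by blast
      then have "\<forall>i\<in>preds (C ! g). cert (Suc h) I n q lo hi i b" using T by blast
      then show ?thesis
        unfolding cert.simps(2)[of "Suc h"] all_adj[OF Suc.prems(1)] using all by auto
    qed
    then show ?thesis using c T by (intro exI[of _ ?U]) blast
  qed
qed

lemma cert_intervals:
  assumes "marks k s" "g < n" "b < 2" "small_below (Suc d) g" "V (marked k s) g b"
  shows "\<exists>t. (\<forall>l<2 ^ d. t l \<le> k) \<and> cert (Suc d) I n (2 ^ d) (\<lambda>l. s (t l)) (\<lambda>l. s (Suc (t l))) g b"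
proof -
  obtain T where T: "T \<subseteq> {..k}" "card T \<le> 2 ^ d" "\<And>q lo hi. covers s q lo hi T \<Longrightarrow> cert (Suc d) I n q lo hi g b"
    using cert_complete[OF assms] by blast
  have "finite T" using T(1) finite_subset by blast
  then obtain t where t: "\<forall>l<2 ^ d::nat. t l \<in> {..k}" "T \<subseteq> t ` {..<2 ^ d}"
    using enumerate_subset[OF _ T(2,1), of 0] by auto
  then have "covers s (2 ^ d) (\<lambda>l. s (t l)) (\<lambda>l. s (Suc (t l))) T" by (auto simp: covers_def)
  then show ?thesis using T(3) t(1) by auto
qed

text \<open>Induction along the topological order. If an input or a predecessor of a large gate had
  the wrong value, some choice of \<open>2 ^ d\<close> intervals would certify this, against the
  justification for that choice.\<close>

lemma claims_true:
  assumes s: "marks k s"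
    and just: "\<And>t g b. \<forall>l<2 ^ d. t l \<le> k \<Longrightarrow> g < n \<Longrightarrow> b < 2 \<Longrightarrow> P g b \<Longrightarrow>
      justified d I n (\<lambda>l. s (t l)) (\<lambda>l. s (Suc (t l))) P g b"
  shows "on_path a w g \<Longrightarrow> b < 2 \<Longrightarrow> P g b \<Longrightarrow> V (marked k s) g b"
proof (induction g arbitrary: a w b rule: less_induct)
  case (less g)
  have g: "g < n" using on_path_bounds(3)[OF less.prems(1)] .
  have pl: "i < n" "i < g" if "i \<in> preds (C ! g)" for i using preds_less[OF g that] g by simp_all
  have IH: "V (marked k s) i b'" if "i \<in> preds (C ! g)" "b' < 2" "P i b'" for i b'
    using less.IH[OF pl(2)[OF that(1)] on_path_pred[OF less.prems(1) that(1)] that(2,3)] .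
  have b': "1 - b < 2" by simp
  note J = just[OF _ g less.prems(2,3)]
  \<comment> \<open>Where one predecessor decides, the intervals do not enter, so an arbitrary
    choice serves.\<close>
  have J0: "justified d I n (\<lambda>l. s 0) (\<lambda>l. s (Suc 0)) P g b" using J[of "\<lambda>_. 0"] by simp
  show ?case
  proof (cases rule: gate_cases[where g = g and b = b])
    case input
    have "preds (C ! g) = {}" using input kinds[OF g] by (cases "C ! g") auto
    then have sb: "small_below (Suc d) g" by simp
    show ?thesis
    proof (rule ccontr)
      assume "\<not> V (marked k s) g b"
      then have "V (marked k s) g (1 - b)" using V_flip[OF less.prems(2)] by simp
      then obtain t where "\<forall>l<2 ^ d. t l \<le> k" "cert (Suc d) I n (2 ^ d) (\<lambda>l. s (t l)) (\<lambda>l. s (Suc (t l))) g (1 - b)"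
        using cert_intervals[OF s g b' sb] by blast
      then show False using J[of t] input by (simp add: justified_def)
    qed
  next
    case neg
    then show ?thesis
      using J0 IH[OF _ b'] V_not[OF g neg less.prems(2)] unfolding justified_def ex_adj[OF g] by auto
  next
    case ex
    then show ?thesis
      using J0 IH[OF _ less.prems(2)] V_ex[OF g ex] unfolding justified_def ex_adj[OF g] by auto
  next
    case all
    show ?thesis
    proof (cases "\<forall>i\<in>preds (C ! g). P i b")
      case True
      then show ?thesis using IH[OF _ less.prems(2)] V_all[OF g all] by blast
    next
      case False
      \<comment> \<open>The first alternative does not depend on \<open>t\<close> and fails, so the
        second holds for every \<open>t\<close>.\<close>
      have J': "big g \<and> (\<forall>i\<in>preds (C ! g). \<not> cert (Suc d) I n (2 ^ d) (\<lambda>l. s (t l)) (\<lambda>l. s (Suc (t l))) i (1 - b))"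
        if "\<forall>l<2 ^ d. t l \<le> k" for t
        using J[OF that] all False unfolding justified_def all_adj[OF g] sum_adj[OF g] by presburger
      have big: "big g" using J'[of "\<lambda>_. 0"] by simp
      show ?thesis unfolding V_all[OF g all]
      proof (rule ballI, rule ccontr)
        fix i assume i: "i \<in> preds (C ! g)" and "\<not> V (marked k s) i b"
        then have "V (marked k s) i (1 - b)" using V_flip[OF less.prems(2)] by simp
        then obtain t where "\<forall>l<2 ^ d. t l \<le> k" "cert (Suc d) I n (2 ^ d) (\<lambda>l. s (t l)) (\<lambda>l. s (Suc (t l))) i (1 - b)"
          using cert_intervals[OF s pl(1)[OF i] b' child_of_big[OF less.prems(1) big i]] by blast
        then show False using J' i by blast
      qed
    qed
  qed
qed

section \<open>Existence of a bounded set of claims\<close>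

definition intervals :: "nat \<Rightarrow> (nat \<Rightarrow> nat) \<Rightarrow> (nat \<Rightarrow> nat) \<Rightarrow> (nat \<Rightarrow> nat) \<Rightarrow> bool" where
  "intervals k s lo hi \<longleftrightarrow> (\<forall>l<2 ^ d. \<exists>j\<le>k. lo l = s j \<and> hi l = s (Suc j))"

text \<open>Quantifying over every \<open>P\<close> that contains \<open>X\<close>, instead of
  taking \<open>X\<close> itself, keeps justifications valid when sets of claims are united.\<close>

definition explains :: "nat \<Rightarrow> (nat \<Rightarrow> nat) \<Rightarrow> nat \<Rightarrow> nat \<times> nat \<Rightarrow> (nat \<times> nat) set \<Rightarrow> bool" where
  "explains k s m x X \<longleftrightarrow> finite X \<and> card X < 2 ^ m \<and> X \<subseteq> {..<n} \<times> {..<2} \<and> x \<in> X \<and>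
     (\<forall>P lo hi. intervals k s lo hi \<longrightarrow> (\<forall>(i, c)\<in>X. P i c) \<longrightarrow> (\<forall>(i, c)\<in>X. justified d I n lo hi P i c))"

lemma explains_single:
  assumes "g < n" "b < 2" "\<And>P lo hi. intervals k s lo hi \<Longrightarrow> justified d I n lo hi P g b"
  shows "explains k s (Suc m) (g, b) {(g, b)}"
proof -
  have "Suc 0 < 2 * 2 ^ m" using one_le_power[of "2::nat" m] by linarith
  then show ?thesis using assms unfolding explains_def by auto
qed

lemma explains_insert:
  assumes "explains k s m (i, c) X" "g < n" "b < 2" "\<And>P lo hi. P i c \<Longrightarrow> justified d I n lo hi P g b"
  shows "explains k s (Suc m) (g, b) (insert (g, b) X)"
proof -
  have "card (insert (g, b) X) < 2 ^ Suc m" using assms(1) by (simp add: explains_def card_insert_if)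
  then show ?thesis using assms unfolding explains_def by auto
qed

text \<open>The claims form a binary tree: a gate decided by one predecessor has one child, a small
  gate that needs all of them has at most two, and a large one is a leaf, since
  \<open>cert_sound\<close> excludes certificates against true values. With \<open>d - a\<close>
  wires left, this gives fewer than \<open>2 ^ Suc (d - a)\<close> claims.\<close>

lemma claims_exist:
  assumes s: "marks k s"
  shows "on_path a w g \<Longrightarrow> b < 2 \<Longrightarrow> V (marked k s) g b \<Longrightarrow> \<exists>X. explains k s (Suc (d - a)) (g, b) X"
proof (induction "d - a" arbitrary: a w g b rule: less_induct)
  case less
  have g: "g < n" using on_path_bounds(3)[OF less.prems(1)] .
  have pl: "i < n" if "i \<in> preds (C ! g)" for i using preds_less[OF g that] g by simp
  have b': "1 - b < 2" by simp
  have IH: "\<exists>X. explains k s (d - a) (i, c) X"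
    if i: "i \<in> preds (C ! g)" and c: "c < 2" "V (marked k s) i c" for i c
  proof -
    note r = on_path_pred[OF less.prems(1) i]
    have "Suc a \<le> d" using on_path_bounds(1)[OF r] .
    then have "d - Suc a < d - a" "Suc (d - Suc a) = d - a" by auto
    then show ?thesis using less.hyps[OF _ r c] by simp
  qed
  have no_cert: "\<not> cert (Suc d) I n (2 ^ d) lo hi i (1 - b)"
    if "intervals k s lo hi" "i < n" "V (marked k s) i b" for lo hi i
    using cert_sound[OF s _ that(2) b', of "2 ^ d" lo hi "Suc d"] that V_flip[OF less.prems(2)]
    unfolding intervals_def by blast
  show ?case
  proof (cases rule: gate_cases[where g = g and b = b])
    case input
    then have "justified d I n lo hi P g b" if "intervals k s lo hi" for P lo hi
      using no_cert[OF that g less.prems(3)] by (simp add: justified_def)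
    then show ?thesis using explains_single[OF g less.prems(2)] by blast
  next
    case neg
    then obtain i where i: "i \<in> preds (C ! g)" "V (marked k s) i (1 - b)"
      using V_not[OF g neg less.prems(2)] less.prems(3) by blast
    obtain X where "explains k s (d - a) (i, 1 - b) X" using IH[OF i(1) b' i(2)] by blast
    moreover have "justified d I n lo hi P g b" if "P i (1 - b)" for P lo hi
      using that i(1) neg unfolding justified_def ex_adj[OF g] by auto
    ultimately show ?thesis using explains_insert[OF _ g less.prems(2)] by blast
  next
    case ex
    then obtain i where i: "i \<in> preds (C ! g)" "V (marked k s) i b"
      using V_ex[OF g ex] less.prems(3) by blast
    obtain X where "explains k s (d - a) (i, b) X" using IH[OF i(1) less.prems(2) i(2)] by blast
    moreover have "justified d I n lo hi P g b" if "P i b" for P lo hi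
      using that i(1) ex unfolding justified_def ex_adj[OF g] by auto
    ultimately show ?thesis using explains_insert[OF _ g less.prems(2)] by blast
  next
    case all
    have Vi: "V (marked k s) i b" if "i \<in> preds (C ! g)" for i
      using V_all[OF g all] less.prems(3) that by blast
    show ?thesis
    proof (cases "big g")
      case True
      have "justified d I n lo hi P g b" if int: "intervals k s lo hi" for P lo hi
      proof -
        have "\<not> cert (Suc d) I n (2 ^ d) lo hi i (1 - b)" if "i \<in> preds (C ! g)" for i
          using no_cert[OF int pl[OF that] Vi[OF that]] .
        then show ?thesis using all True unfolding justified_def all_adj[OF g] sum_adj[OF g] by auto
      qed
      then show ?thesis using explains_single[OF g less.prems(2)] by blast
    next
      case False
      have "\<forall>i\<in>preds (C ! g). \<exists>X. explains k s (d - a) (i, b) X" using IH[OF _ less.prems(2) Vi] by blast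
      then obtain X where X: "\<forall>i\<in>preds (C ! g). explains k s (d - a) (i, b) (X i)"
        by (rule bchoice[THEN exE])
      let ?U = "\<Union>i\<in>preds (C ! g). X i"
      have fin: "finite ?U" using X finite_preds[OF g] by (simp add: explains_def)
      have "card (X i) \<le> 2 ^ (d - a) - 1" if "i \<in> preds (C ! g)" for i
      proof -
        have "card (X i) < 2 ^ (d - a)" using bspec[OF X that] by (simp add: explains_def)
        then show ?thesis by linarith
      qed
      then have "(\<Sum>i\<in>preds (C ! g). card (X i)) \<le> card (preds (C ! g)) * (2 ^ (d - a) - 1)"
        using sum_bounded_above[of "preds (C ! g)" "\<lambda>i. card (X i)" "2 ^ (d - a) - 1"] by simp
      also have "\<dots> \<le> 2 * (2 ^ (d - a) - 1)" using False by (intro mult_le_mono1) simp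
      finally have "card ?U \<le> 2 * (2 ^ (d - a) - 1)"
        using card_UN_le[OF finite_preds[OF g], of X] by linarith
      moreover have "(1::nat) \<le> 2 ^ (d - a)" by simp
      moreover have "card (insert (g, b) ?U) \<le> Suc (card ?U)" using fin by (simp add: card_insert_if)
      ultimately have c: "card (insert (g, b) ?U) < 2 ^ Suc (d - a)" unfolding power_Suc by linarith
      have j: "justified d I n lo hi P g b" if "\<forall>(i, c)\<in>?U. P i c" for P lo hi
      proof -
        have "\<forall>i\<in>preds (C ! g). P i b" using that X unfolding explains_def by blast
        then show ?thesis using all unfolding justified_def all_adj[OF g] by auto
      qed
      have j': "\<forall>(i, c)\<in>?U. justified d I n lo hi P i c"
        if "intervals k s lo hi" "\<forall>(i, c)\<in>?U. P i c" for P lo hi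
        using X that unfolding explains_def by blast
      have "?U \<subseteq> {..<n} \<times> {..<2}" using X unfolding explains_def by blast
      then have "explains k s (Suc (d - a)) (g, b) (insert (g, b) ?U)"
        using fin c j j' g less.prems(2) unfolding explains_def by auto
      then show ?thesis by blast
    qed
  qed
qed

lemma marks_exist:
  assumes "S \<subseteq> {..<n}" "card S = k"
  shows "\<exists>s. marks k s \<and> marked k s = S"
proof -
  define xs where "xs = sorted_list_of_set S"
  have fin: "finite S" using assms(1) finite_subset by blast
  have xs: "set xs = S" "length xs = k" "sorted_wrt (<) xs"
    using fin assms(2) by (simp_all add: xs_def)
  define s where "s j = (if j = 0 then 0 else if j \<le> k then Suc (xs ! (j - 1)) else Suc n)" for j
  have "s j < s (Suc j)" if jk: "j \<le> k" for j
  proof -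
    consider "j = 0" | "0 < j" "j < k" | "0 < j" "j = k" using jk by linarith
    then show ?thesis
    proof cases
      case 2
      then have "xs ! (j - 1) < xs ! j" using xs by (intro sorted_wrt_nth_less[OF xs(3)]) auto
      then show ?thesis using 2 by (simp add: s_def)
    next
      case 3
      then have "xs ! (j - 1) \<in> S" using nth_mem[of "j - 1" xs] xs by simp
      then show ?thesis using 3 assms(1) by (auto simp: s_def)
    qed (simp add: s_def)
  qed
  then have "marks k s" by (simp add: marks_def s_def)
  moreover have "marked k s = S"
  proof (intro set_eqI iffI)
    fix g assume "g \<in> marked k s"
    then obtain j where "1 \<le> j" "j \<le> k" "g = xs ! (j - 1)" by (auto simp: marked_def s_def)
    then show "g \<in> S" using xs nth_mem[of "j - 1" xs] by auto
  next
    fix g assume "g \<in> S"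
    then obtain j where "j < k" "g = xs ! j" using xs by (metis in_set_conv_nth)
    then show "g \<in> marked k s" by (auto simp: marked_def s_def intro!: exI[of _ "Suc j"])
  qed
  ultimately show ?thesis by blast
qed

lemma card_marked:
  assumes "marks k s"
  shows "card (marked k s) = k"
proof -
  have pos: "0 < s j" if "1 \<le> j" "j \<le> k" for j
    using marks_mono[OF assms, of 0 j] that assms by (simp add: marks_def)
  have "marked k s = (\<lambda>j. s j - 1) ` {1..k}"
    using pos by (force simp: marked_def)
  moreover have "inj_on (\<lambda>j. s j - 1) {1..k}"
  proof (rule linorder_inj_onI)
    fix i j assume "i < j" "i \<in> {1..k}" "j \<in> {1..k}"
    then show "s i - 1 \<noteq> s j - 1" using marks_mono[OF assms, of i j] pos[of i] by auto
  qed auto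
  ultimately show ?thesis by (simp add: card_image)
qed

text \<open>Leaves only conditions on single unknowns and a check on tuples of \<open>W\<close> and
  \<open>2 * 2 ^ d\<close> marks, the shape that vector sums can express.\<close>

lemma satisfiable_iff:
  "(\<exists>S\<subseteq>input_gates C. card S = k \<and> gate_value C S (n - 1)) \<longleftrightarrow>
   (\<exists>s W. W < modulus d n \<and> s 0 = 0 \<and> s (Suc k) = Suc n \<and>
     (\<forall>j\<in>{1..k}. 1 \<le> s j \<and> s j \<le> n \<and> \<not> kind1 I n (s j - 1) \<and> \<not> kind2 I n (s j - 1)) \<and>
     (\<forall>t. (\<forall>l<2 ^ d. t l \<le> k) \<longrightarrow> check d I n (\<lambda>l. s (t l)) (\<lambda>l. s (Suc (t l))) W))"
proof
  assume "\<exists>S\<subseteq>input_gates C. card S = k \<and> gate_value C S (n - 1)"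
  then obtain S where S: "S \<subseteq> input_gates C" "card S = k" "gate_value C S (n - 1)" by blast
  then have "S \<subseteq> {..<n}" by (auto simp: input_gates_def)
  then obtain s where s: "marks k s" "marked k s = S" using marks_exist S(2) by blast
  obtain w where w: "on_path 0 w (n - 1)" using on_path_out by blast
  have "V (marked k s) (n - 1) 1" using S(3) s(2) by (simp add: V_def)
  from claims_exist[OF s(1) w _ this] obtain X where expl: "explains k s (Suc d) (n - 1, 1) X" by auto
  then have X: "finite X" "card X < 2 ^ Suc d" "X \<subseteq> {..<n} \<times> {..<2}" "(n - 1, 1) \<in> X"
    unfolding explains_def by blast+
  \<comment> \<open>Repetitions fill up the \<open>2 ^ Suc d\<close> digits of
    \<open>W\<close>.\<close>
  obtain e where e: "\<forall>l<2 ^ Suc d::nat. e l \<in> X" "X \<subseteq> e ` {..<2 ^ Suc d}"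
    using enumerate_subset[OF X(1) less_imp_le[OF X(2)] subset_refl X(4)] by blast
  have "2 * fst (e l) + snd (e l) < 2 * n + 2" if "l < 2 ^ Suc d" for l
  proof -
    have "e l \<in> {..<n} \<times> {..<2}" using e(1) X(3) that by blast
    then show ?thesis by auto
  qed
  then obtain W where W: "W < (2 * n + 2) ^ 2 ^ Suc d"
    "\<forall>l<2 ^ Suc d. digit (2 * n + 2) (2 ^ Suc d) W l = 2 * fst (e l) + snd (e l)"
    using digits_exist[of "2 ^ Suc d" "\<lambda>l. 2 * fst (e l) + snd (e l)" "2 * n + 2"] by blast
  have claimed: "claimed d n W g b \<longleftrightarrow> (g, b) \<in> X" if b: "b < 2" for g b
  proof
    assume "claimed d n W g b"
    then obtain l where l: "l < 2 ^ Suc d" "2 * fst (e l) + snd (e l) = 2 * g + b"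
      using W(2) by (auto simp: claimed_def)
    have "e l \<in> X" "snd (e l) < 2" using e(1) X(3) l(1) by (blast, fastforce)
    moreover from this l(2) b have "fst (e l) = g" "snd (e l) = b" by presburger+
    ultimately show "(g, b) \<in> X" by (metis prod.collapse)
  next
    assume "(g, b) \<in> X"
    then obtain l where "l < 2 ^ Suc d" "e l = (g, b)" using e(2) by force
    then show "claimed d n W g b" using W(2) unfolding claimed_def by (metis fst_conv snd_conv)
  qed
  have "check d I n (\<lambda>l. s (t l)) (\<lambda>l. s (Suc (t l))) W" if t: "\<forall>l<2 ^ d. t l \<le> k" for t
  proof -
    have A: "\<forall>(i, c)\<in>X. claimed d n W i c" using claimed X(3) by auto
    have "intervals k s (\<lambda>l. s (t l)) (\<lambda>l. s (Suc (t l)))" using t by (auto simp: intervals_def)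
    with A expl have J: "\<forall>(i, c)\<in>X. justified d I n (\<lambda>l. s (t l)) (\<lambda>l. s (Suc (t l))) (claimed d n W) i c"
      unfolding explains_def by presburger
    have "justified d I n (\<lambda>l. s (t l)) (\<lambda>l. s (Suc (t l))) (claimed d n W) g b"
      if "b < 2" "claimed d n W g b" for g b
    proof -
      have "(g, b) \<in> X" using that claimed by simp
      from bspec[OF J this] show ?thesis by simp
    qed
    moreover have "claimed d n W (n - 1) 1" using claimed X(4) by simp
    moreover have "\<forall>l<2 ^ d. s (t l) < s (Suc (t l))" using s(1) t by (simp add: marks_def)
    ultimately show ?thesis unfolding check_def by blast
  qed
  moreover have "1 \<le> s j \<and> s j \<le> n \<and> \<not> kind1 I n (s j - 1) \<and> \<not> kind2 I n (s j - 1)" if j: "j \<in> {1..k}" for j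
  proof -
    have sj: "0 < s j" "s j < Suc n"
      using marks_mono[OF s(1), of 0 j] marks_mono[OF s(1), of j "Suc k"] j s(1) by (auto simp: marks_def)
    have "\<exists>j'. 1 \<le> j' \<and> j' \<le> k \<and> s j' = Suc (s j - 1)" using j sj(1) by auto
    then have "s j - 1 \<in> S" unfolding s(2)[symmetric] marked_def by blast
    then have "s j - 1 < n" "C ! (s j - 1) = InputGate" using S(1) by (auto simp: input_gates_def)
    then show ?thesis using sj kinds[of "s j - 1"] by auto
  qed
  ultimately show "\<exists>s W. W < modulus d n \<and> s 0 = 0 \<and> s (Suc k) = Suc n \<and>
     (\<forall>j\<in>{1..k}. 1 \<le> s j \<and> s j \<le> n \<and> \<not> kind1 I n (s j - 1) \<and> \<not> kind2 I n (s j - 1)) \<and>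
     (\<forall>t. (\<forall>l<2 ^ d. t l \<le> k) \<longrightarrow> check d I n (\<lambda>l. s (t l)) (\<lambda>l. s (Suc (t l))) W)"
    using W(1) s(1) unfolding modulus_def marks_def by blast
next
  assume "\<exists>s W. W < modulus d n \<and> s 0 = 0 \<and> s (Suc k) = Suc n \<and>
     (\<forall>j\<in>{1..k}. 1 \<le> s j \<and> s j \<le> n \<and> \<not> kind1 I n (s j - 1) \<and> \<not> kind2 I n (s j - 1)) \<and>
     (\<forall>t. (\<forall>l<2 ^ d. t l \<le> k) \<longrightarrow> check d I n (\<lambda>l. s (t l)) (\<lambda>l. s (Suc (t l))) W)"
  then obtain s W where s: "s 0 = 0" "s (Suc k) = Suc n"
    and inp: "\<And>j. j \<in> {1..k} \<Longrightarrow> 1 \<le> s j \<and> s j \<le> n \<and> \<not> kind1 I n (s j - 1) \<and> \<not> kind2 I n (s j - 1)"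
    and chk: "\<And>t. (\<forall>l<2 ^ d. t l \<le> k) \<Longrightarrow> check d I n (\<lambda>l. s (t l)) (\<lambda>l. s (Suc (t l))) W"
    by blast
  have "s j < s (Suc j)" if "j \<le> k" for j
  proof -
    \<comment> \<open>Choosing interval \<open>j\<close> throughout yields the order of its two
      ends.\<close>
    have "\<forall>l<2 ^ d::nat. s j < s (Suc j)" using chk[of "\<lambda>_. j"] that unfolding check_def by blast
    moreover have "(0::nat) < 2 ^ d" by simp
    ultimately show ?thesis by blast
  qed
  then have marks: "marks k s" using s by (simp add: marks_def)
  have "marked k s \<subseteq> input_gates C"
  proof
    fix g assume "g \<in> marked k s"
    then obtain j where "1 \<le> j" "j \<le> k" "s j = Suc g" by (auto simp: marked_def)
    then have g: "g < n" "\<not> kind1 I n g" "\<not> kind2 I n g" using inp[of j] by auto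
    then have "C ! g = InputGate" using kinds[OF g(1)] by (cases "C ! g") auto
    then show "g \<in> input_gates C" using g(1) by (simp add: input_gates_def)
  qed
  moreover obtain w where w: "on_path 0 w (n - 1)" using on_path_out by blast
  have "V (marked k s) (n - 1) 1"
  proof (rule claims_true[OF marks _ w, of "claimed d n W"])
    show "justified d I n (\<lambda>l. s (t l)) (\<lambda>l. s (Suc (t l))) (claimed d n W) g b"
      if "\<forall>l<2 ^ d. t l \<le> k" "g < n" "b < 2" "claimed d n W g b" for t g b
      using chk[OF that(1)] that(2-) unfolding check_def by blast
    show "claimed d n W (n - 1) 1" using chk[of "\<lambda>_. 0"] by (simp add: check_def)
  qed simp
  then have "gate_value C (marked k s) (n - 1)" by (simp add: V_def)
  ultimately show "\<exists>S\<subseteq>input_gates C. card S = k \<and> gate_value C S (n - 1)"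
    using card_marked[OF marks] by blast
qed

end


section \<open>From circuits to vector sums\<close>

text \<open>
  The unknowns are \<open>s\<^sub>0, \<dots>, s\<^sub>k\<^sub>+\<^sub>1\<close> and the claims \<open>W\<close> (group \<open>k + 2\<close>), and, for every choice \<open>t\<close> of \<open>2\<^sup>d\<close> intervals,
  the tuple of \<open>W\<close> and the ends of these intervals (group \<open>k + 3 + t\<close>). Element \<open>e\<close> assigns the value
  \<open>e mod group_size\<close> to the unknown \<open>e div group_size\<close>. Coordinate 0 counts invalid values, the next ones
  count the values assigned to each unknown, and the others force entry \<open>i\<close> of tuple \<open>t\<close> to agree
  with the unknown \<open>scope d k t i\<close>: the two contribute \<open>x\<close> and \<open>modulus - x\<close>.
\<close>

definition arity :: "nat \<Rightarrow> nat" where "arity d = 2 * 2 ^ d + 1"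

definition tuples :: "nat \<Rightarrow> nat \<Rightarrow> nat" where "tuples d k = (k + 1) ^ 2 ^ d"

text \<open>A tuple has this many values, a single unknown fewer; the common size lets one division
  decode every element, and surplus values are invalid.\<close>

definition group_size :: "nat \<Rightarrow> nat \<Rightarrow> nat" where "group_size d n = modulus d n ^ arity d"

definition groups :: "nat \<Rightarrow> nat \<Rightarrow> nat" where "groups d k = (k + 3) + tuples d k"

definition dims :: "nat \<Rightarrow> nat \<Rightarrow> nat" where "dims d k = 1 + groups d k + tuples d k * arity d"

text \<open>Entry 0 is \<open>W\<close>. Entries \<open>1 + 2 * l\<close> and
  \<open>2 + 2 * l\<close> are the two ends of the \<open>l\<close>-th chosen interval, whose number
  is digit \<open>l\<close> of \<open>t\<close> to base \<open>k + 1\<close>.\<close>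

definition scope :: "nat \<Rightarrow> nat \<Rightarrow> nat \<Rightarrow> nat \<Rightarrow> nat" where
  "scope d k t i = (if i = 0 then k + 2
     else digit (k + 1) (2 ^ d) t ((i - 1) div 2) + (if i mod 2 = 1 then 0 else 1))"

definition tuple_check :: "nat \<Rightarrow> (nat \<Rightarrow> nat) \<Rightarrow> nat \<Rightarrow> nat \<Rightarrow> bool" where
  "tuple_check d I n a \<longleftrightarrow> check d I n (\<lambda>l. digit (modulus d n) (arity d) a (1 + 2 * l))
     (\<lambda>l. digit (modulus d n) (arity d) a (2 + 2 * l)) (digit (modulus d n) (arity d) a 0)"

definition valid :: "nat \<Rightarrow> (nat \<Rightarrow> nat) \<Rightarrow> nat \<Rightarrow> nat \<Rightarrow> nat \<Rightarrow> nat \<Rightarrow> bool" where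
  "valid d I k n g a \<longleftrightarrow> (if g < k + 3
     then a < modulus d n \<and> (g = 0 \<longrightarrow> a = 0) \<and> (g = k + 1 \<longrightarrow> a = n + 1) \<and>
       (1 \<le> g \<and> g \<le> k \<longrightarrow> 1 \<le> a \<and> a \<le> n \<and> \<not> kind1 I n (a - 1) \<and> \<not> kind2 I n (a - 1))
     else tuple_check d I n a)"

definition link :: "nat \<Rightarrow> nat \<Rightarrow> nat \<Rightarrow> nat \<Rightarrow> nat \<Rightarrow> nat \<Rightarrow> nat \<Rightarrow> nat" where
  "link d k n g a t i = (if g < k + 3 then if scope d k t i = g then a else 0
     else if g = k + 3 + t then modulus d n - digit (modulus d n) (arity d) a i else 0)"

definition vec :: "nat \<Rightarrow> (nat \<Rightarrow> nat) \<Rightarrow> nat \<Rightarrow> nat \<Rightarrow> nat \<Rightarrow> nat \<Rightarrow> nat" where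
  "vec d I k n e p = (let g = e div group_size d n; a = e mod group_size d n in
     if p = 0 then of_bool (\<not> valid d I k n g a)
     else if p < 1 + groups d k then of_bool (g = p - 1)
     else link d k n g a ((p - (1 + groups d k)) div arity d) ((p - (1 + groups d k)) mod arity d))"

definition target :: "nat \<Rightarrow> nat \<Rightarrow> nat \<Rightarrow> nat \<Rightarrow> nat" where
  "target d k n p = (if p = 0 then 0 else if p < 1 + groups d k then 1 else modulus d n)"

lemma cert_cong:
  assumes "\<And>l. l < q \<Longrightarrow> lo l = lo' l \<and> hi l = hi' l"
  shows "cert h I n q lo hi g b = cert h I n q lo' hi' g b"
proof (induction h arbitrary: g b)
  case (Suc h)
  have "(\<exists>l<q. if b = 1 then lo l = Suc g else lo l < Suc g \<and> Suc g < hi l) =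
      (\<exists>l<q. if b = 1 then lo' l = Suc g else lo' l < Suc g \<and> Suc g < hi' l)"
    using assms by (intro ex_cong1 conj_cong refl) simp
  then show ?case by (simp only: cert.simps(2) Suc.IH)
qed simp

lemma check_cong:
  assumes "\<And>l. l < 2 ^ d \<Longrightarrow> lo l = lo' l \<and> hi l = hi' l"
  shows "check d I n lo hi W = check d I n lo' hi' W"
proof -
  have "cert (Suc d) I n (2 ^ d) lo hi = cert (Suc d) I n (2 ^ d) lo' hi'"
    using assms by (intro ext cert_cong)
  then have "justified d I n lo hi = justified d I n lo' hi'" by (intro ext) (simp only: justified_def)
  moreover have "(\<forall>l<2 ^ d. lo l < hi l) = (\<forall>l<2 ^ d. lo' l < hi' l)" using assms by auto
  ultimately show ?thesis by (simp only: check_def)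
qed

lemma modulus_gt: "n + 1 < modulus d n"
proof -
  have "2 * n + 2 \<le> (2 * n + 2) ^ 2 ^ Suc d" by (rule self_le_power) simp_all
  then show ?thesis by (simp add: modulus_def)
qed

lemma digit_less: "0 < B \<Longrightarrow> digit B r y i < B" by (simp add: digit_def)

lemma scope_less: "scope d k t i < k + 3"
  using digit_less[of "k + 1" "2 ^ d" t "(i - 1) div 2"] by (auto simp: scope_def)

lemma scope_tuple:
  "scope d k t (1 + 2 * l) = digit (k + 1) (2 ^ d) t l"
  "scope d k t (2 + 2 * l) = Suc (digit (k + 1) (2 ^ d) t l)"
proof -
  have e: "(1 + 2 * l - 1) div 2 = l" "(2 + 2 * l - 1) div 2 = l" "(1 + 2 * l) mod 2 = 1" "(2 + 2 * l) mod 2 = 0"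
    by simp_all
  show "scope d k t (1 + 2 * l) = digit (k + 1) (2 ^ d) t l"
    "scope d k t (2 + 2 * l) = Suc (digit (k + 1) (2 ^ d) t l)"
    unfolding scope_def e by simp_all
qed

lemma dims_split:
  assumes "t < tuples d k" "i < arity d"
  shows "1 + groups d k + (t * arity d + i) < dims d k"
    "(1 + groups d k + (t * arity d + i) - (1 + groups d k)) div arity d = t"
    "(1 + groups d k + (t * arity d + i) - (1 + groups d k)) mod arity d = i"
proof -
  have "t * arity d + i < Suc t * arity d" using assms by simp
  also have "\<dots> \<le> tuples d k * arity d" using assms by (intro mult_le_mono1) simp
  finally show "1 + groups d k + (t * arity d + i) < dims d k" by (simp add: dims_def)
qed (use assms in simp_all)

lemma sum_link:
  assumes "t < tuples d k"
  shows "(\<Sum>g<groups d k. link d k n g (v g) t i) =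
    v (scope d k t i) + (modulus d n - digit (modulus d n) (arity d) (v (k + 3 + t)) i)"
proof -
  have split: "{..<groups d k} = {..<k + 3} \<union> {k + 3..<groups d k}" by (auto simp: groups_def)
  have "(\<Sum>g<groups d k. link d k n g (v g) t i) =
      (\<Sum>g<k + 3. link d k n g (v g) t i) + (\<Sum>g=k + 3..<groups d k. link d k n g (v g) t i)"
    unfolding split by (rule sum.union_disjoint) auto
  also have "(\<Sum>g<k + 3. link d k n g (v g) t i) = (\<Sum>g<k + 3. if scope d k t i = g then v g else 0)"
    by (intro sum.cong) (auto simp: link_def)
  also have "\<dots> = v (scope d k t i)" using scope_less[of d k t i] by simp
  also have "(\<Sum>g=k + 3..<groups d k. link d k n g (v g) t i) =
      (\<Sum>g=k + 3..<groups d k. if g = k + 3 + t then modulus d n - digit (modulus d n) (arity d) (v g) i else 0)"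
    by (intro sum.cong) (auto simp: link_def)
  also have "\<dots> = modulus d n - digit (modulus d n) (arity d) (v (k + 3 + t)) i"
    using assms by (simp add: groups_def)
  finally show ?thesis .
qed

definition constraints :: "nat \<Rightarrow> (nat \<Rightarrow> nat) \<Rightarrow> nat \<Rightarrow> nat \<Rightarrow> (nat \<Rightarrow> nat) \<Rightarrow> nat \<Rightarrow> bool" where
  "constraints d I k n s W \<longleftrightarrow> W < modulus d n \<and> s 0 = 0 \<and> s (Suc k) = Suc n \<and>
     (\<forall>j\<in>{1..k}. 1 \<le> s j \<and> s j \<le> n \<and> \<not> kind1 I n (s j - 1) \<and> \<not> kind2 I n (s j - 1)) \<and>
     (\<forall>t. (\<forall>l<2 ^ d. t l \<le> k) \<longrightarrow> check d I n (\<lambda>l. s (t l)) (\<lambda>l. s (Suc (t l))) W)"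

lemma tuple_check_iff:
  assumes "\<And>i. i < arity d \<Longrightarrow> digit (modulus d n) (arity d) a i = x (scope d k t i)"
  shows "tuple_check d I n a \<longleftrightarrow> check d I n (\<lambda>l. x (digit (k + 1) (2 ^ d) t l))
     (\<lambda>l. x (Suc (digit (k + 1) (2 ^ d) t l))) (x (k + 2))"
proof -
  have W: "digit (modulus d n) (arity d) a 0 = x (k + 2)" using assms[of 0] by (simp add: arity_def scope_def)
  have "digit (modulus d n) (arity d) a (1 + 2 * l) = x (digit (k + 1) (2 ^ d) t l) \<and>
      digit (modulus d n) (arity d) a (2 + 2 * l) = x (Suc (digit (k + 1) (2 ^ d) t l))" if "l < 2 ^ d" for l
    using assms[of "1 + 2 * l"] assms[of "2 + 2 * l"] that unfolding scope_tuple by (simp add: arity_def)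
  then show ?thesis unfolding tuple_check_def W by (rule check_cong)
qed

lemma group_size_pos: "0 < group_size d n" "modulus d n \<le> group_size d n"
  using modulus_gt[of n d] by (auto simp: group_size_def arity_def intro: self_le_power)

lemma selection:
  assumes S: "0 < (S::nat)" and A: "A \<subseteq> {..<G * S}" and one: "\<And>g. g < G \<Longrightarrow> (\<Sum>e\<in>A. of_bool (e div S = g)) = (1::nat)"
  shows "\<exists>v. (\<forall>g<G. v g < S) \<and> (\<forall>h. (\<Sum>e\<in>A. h (e div S) (e mod S)) = (\<Sum>g<G. h g (v g) :: nat))"
proof -
  have fin: "finite A" using A finite_subset by blast
  have "\<exists>e. {e \<in> A. e div S = g} = {e}" if "g < G" for g
  proof -
    have "card {e \<in> A. e div S = g} = 1" using one[OF that] fin by (simp add: of_bool_def sum.If_cases Int_def)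
    then show ?thesis by (simp add: card_1_singleton_iff)
  qed
  then obtain el where el: "\<And>g. g < G \<Longrightarrow> {e \<in> A. e div S = g} = {el g}" by metis
  have div: "e div S < G" if "e \<in> A" for e using A that by (auto simp: less_mult_imp_div_less)
  have "(\<Sum>e\<in>A. h (e div S) (e mod S)) = (\<Sum>g<G. h g (el g mod S))" for h :: "nat \<Rightarrow> nat \<Rightarrow> nat"
  proof -
    have "(\<Sum>e\<in>A. h (e div S) (e mod S)) = (\<Sum>g\<in>{..<G}. \<Sum>e\<in>{e \<in> A. e div S = g}. h (e div S) (e mod S))"
      using fin div by (intro sum.group[symmetric]) auto
    also have "\<dots> = (\<Sum>g<G. h g (el g mod S))"
    proof (rule sum.cong[OF refl])
      fix g assume "g \<in> {..<G}"
      then have e: "{e \<in> A. e div S = g} = {el g}" using el by simp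
      then have "el g div S = g" by blast
      then show "(\<Sum>e\<in>{e \<in> A. e div S = g}. h (e div S) (e mod S)) = h g (el g mod S)" unfolding e by simp
    qed
    finally show ?thesis .
  qed
  then show ?thesis using S by (intro exI[of _ "\<lambda>g. el g mod S"]) auto
qed

lemma vector_sum_iff:
  "(\<exists>A\<subseteq>{..<groups d k * group_size d n}. card A = groups d k \<and>
      (\<forall>p<dims d k. (\<Sum>e\<in>A. vec d I k n e p) = target d k n p)) \<longleftrightarrow>
   (\<exists>s W. constraints d I k n s W)"
proof
  let ?M = "modulus d n" and ?S = "group_size d n" and ?G = "groups d k" and ?r = "arity d"
  assume "\<exists>A\<subseteq>{..<?G * ?S}. card A = ?G \<and> (\<forall>p<dims d k. (\<Sum>e\<in>A. vec d I k n e p) = target d k n p)"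
  then obtain A where A: "A \<subseteq> {..<?G * ?S}" and sum: "\<And>p. p < dims d k \<Longrightarrow> (\<Sum>e\<in>A. vec d I k n e p) = target d k n p"
    by blast
  have fin: "finite A" using A finite_subset by blast
  have "(\<Sum>e\<in>A. of_bool (e div ?S = g)) = (1::nat)" if "g < ?G" for g
    using sum[of "1 + g"] that by (simp add: vec_def target_def dims_def Let_def)
  then obtain v where v: "\<And>g. g < ?G \<Longrightarrow> v g < ?S"
    and vs: "\<And>h. (\<Sum>e\<in>A. h (e div ?S) (e mod ?S)) = (\<Sum>g<?G. h g (v g) :: nat)"
    using selection[OF group_size_pos(1) A] by blast
  have "(\<Sum>e\<in>A. of_bool (\<not> valid d I k n (e div ?S) (e mod ?S))) = (0::nat)"
    using sum[of 0] by (simp add: vec_def target_def dims_def Let_def)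
  then have "(\<Sum>g<?G. of_bool (\<not> valid d I k n g (v g))) = (0::nat)"
    using vs[of "\<lambda>g a. of_bool (\<not> valid d I k n g a)"] by simp
  then have valid: "valid d I k n g (v g)" if "g < ?G" for g using that by auto
  have small: "v g < ?M" if "g < k + 3" for g
    using valid[of g] that by (simp add: valid_def groups_def)
  have dig: "digit ?M ?r (v (k + 3 + t)) i = v (scope d k t i)" if t: "t < tuples d k" and i: "i < ?r" for t i
  proof -
    have "(\<Sum>e\<in>A. link d k n (e div ?S) (e mod ?S) t i) = ?M"
      using sum[OF dims_split(1)[OF t i]] dims_split(2,3)[OF t i] by (simp add: vec_def target_def Let_def)
    then have "v (scope d k t i) + (?M - digit ?M ?r (v (k + 3 + t)) i) = ?M"
      using vs[of "\<lambda>g a. link d k n g a t i"] sum_link[OF t, of n v i] by simp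
    \<comment> \<open>The subtraction from \<open>?M\<close> is not truncated, so the sum determines
      the entry.\<close>
    moreover have "digit ?M ?r (v (k + 3 + t)) i < ?M" using modulus_gt[of n d] by (intro digit_less) simp
    ultimately show ?thesis by linarith
  qed
  have "check d I n (\<lambda>l. v (\<tau> l)) (\<lambda>l. v (Suc (\<tau> l))) (v (k + 2))" if \<tau>: "\<forall>l<2 ^ d. \<tau> l \<le> k" for \<tau>
  proof -
    \<comment> \<open>Every choice of intervals is the digit sequence of some tuple number.\<close>
    obtain t where t: "t < tuples d k" "\<forall>l<2 ^ d. digit (k + 1) (2 ^ d) t l = \<tau> l"
      using digits_exist[of "2 ^ d" \<tau> "k + 1"] \<tau> unfolding tuples_def by (auto simp: less_Suc_eq_le)
    have "tuple_check d I n (v (k + 3 + t))" using valid[of "k + 3 + t"] t(1) by (simp add: valid_def groups_def)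
    then have "check d I n (\<lambda>l. v (digit (k + 1) (2 ^ d) t l)) (\<lambda>l. v (Suc (digit (k + 1) (2 ^ d) t l))) (v (k + 2))"
      using tuple_check_iff[where a = "v (k + 3 + t)" and x = v and t = t, OF dig[OF t(1)]] by blast
    then show ?thesis using t(2) check_cong[of d "\<lambda>l. v (digit (k + 1) (2 ^ d) t l)" "\<lambda>l. v (\<tau> l)"
      "\<lambda>l. v (Suc (digit (k + 1) (2 ^ d) t l))" "\<lambda>l. v (Suc (\<tau> l))"] by simp
  qed
  moreover have "v 0 = 0" "v (Suc k) = Suc n" "v (k + 2) < ?M"
    using valid[of 0] valid[of "Suc k"] small[of "k + 2"] by (simp_all add: valid_def groups_def)
  moreover have "1 \<le> v j \<and> v j \<le> n \<and> \<not> kind1 I n (v j - 1) \<and> \<not> kind2 I n (v j - 1)" if "j \<in> {1..k}" for j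
    using valid[of j] that by (simp add: valid_def groups_def)
  ultimately have "constraints d I k n v (v (k + 2))" unfolding constraints_def by blast
  then show "\<exists>s W. constraints d I k n s W" by blast
next
  let ?M = "modulus d n" and ?S = "group_size d n" and ?G = "groups d k" and ?r = "arity d"
  assume "\<exists>s W. constraints d I k n s W"
  then obtain s W where c: "constraints d I k n s W" by blast
  define x where "x j = (if j = k + 2 then W else s j)" for j
  have x: "x j < ?M" if jk: "j < k + 3" for j
  proof -
    consider "j = 0" | "j \<in> {1..k}" | "j = Suc k" | "j = k + 2" using jk by force
    then show ?thesis
    proof cases
      case 2
      then have "x j \<le> n" using c by (auto simp: constraints_def x_def)
      then show ?thesis using modulus_gt[of n d] by simp
    qed (use c modulus_gt[of n d] in \<open>simp_all add: constraints_def x_def\<close>)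
  qed
  have "\<exists>y<?S. \<forall>i<?r. digit ?M ?r y i = x (scope d k t i)" for t
    unfolding group_size_def using x scope_less by (intro digits_exist) blast
  then obtain y where y: "\<And>t. y t < ?S" "\<And>t i. i < ?r \<Longrightarrow> digit ?M ?r (y t) i = x (scope d k t i)" by metis
  define v where "v g = (if g < k + 3 then x g else y (g - (k + 3)))" for g
  have v: "v g < ?S" for g using x[of g] y(1) group_size_pos(2)[of d n] by (auto simp: v_def)
  define el where "el g = g * ?S + v g" for g
  have el: "el g div ?S = g" "el g mod ?S = v g" for g
    unfolding el_def using block_div_mod[OF v] by blast+
  have inj: "inj_on el {..<?G}" by (rule inj_on_inverseI[of _ "\<lambda>e. e div ?S"]) (rule el(1))
  let ?A = "el ` {..<?G}"
  have sums: "(\<Sum>e\<in>?A. h (e div ?S) (e mod ?S)) = (\<Sum>g<?G. h g (v g))" for h :: "nat \<Rightarrow> nat \<Rightarrow> nat"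
    by (simp add: sum.reindex[OF inj] el)
  have valid: "valid d I k n g (v g)" if "g < ?G" for g
  proof (cases "g < k + 3")
    case True
    then show ?thesis using c x[of g] by (auto simp: valid_def v_def x_def constraints_def)
  next
    case False
    let ?t = "g - (k + 3)"
    have "digit (k + 1) (2 ^ d) ?t l \<le> k" for l using digit_less[of "k + 1" "2 ^ d" ?t l] by simp
    then have "check d I n (\<lambda>l. s (digit (k + 1) (2 ^ d) ?t l)) (\<lambda>l. s (Suc (digit (k + 1) (2 ^ d) ?t l))) W"
      using c unfolding constraints_def by blast
    moreover have "x (digit (k + 1) (2 ^ d) ?t l) = s (digit (k + 1) (2 ^ d) ?t l)"
      "x (Suc (digit (k + 1) (2 ^ d) ?t l)) = s (Suc (digit (k + 1) (2 ^ d) ?t l))" for l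
      using digit_less[of "k + 1" "2 ^ d" ?t l] by (simp_all add: x_def)
    ultimately have "tuple_check d I n (y ?t)"
      using tuple_check_iff[where a = "y ?t" and x = x and t = ?t, OF y(2)] by (simp add: x_def)
    then show ?thesis using False by (simp add: valid_def v_def)
  qed
  have "(\<Sum>e\<in>?A. vec d I k n e p) = target d k n p" if p: "p < dims d k" for p
  proof -
    consider "p = 0" | "0 < p" "p < 1 + ?G" | "1 + ?G \<le> p" by linarith
    then show ?thesis
    proof cases
      case 1
      have "(\<Sum>e\<in>?A. vec d I k n e p) = (\<Sum>e\<in>?A. of_bool (\<not> valid d I k n (e div ?S) (e mod ?S)))"
        using 1 by (simp add: vec_def Let_def)
      also have "\<dots> = (\<Sum>g<?G. of_bool (\<not> valid d I k n g (v g)))" by (rule sums)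
      also have "\<dots> = 0" using valid by simp
      finally show ?thesis using 1 by (simp add: target_def)
    next
      case 2
      have "(\<Sum>e\<in>?A. vec d I k n e p) = (\<Sum>e\<in>?A. of_bool (e div ?S = p - 1))"
        using 2 by (simp add: vec_def Let_def)
      also have "\<dots> = (\<Sum>g<?G. of_bool (g = p - 1))" by (rule sums)
      also have "\<dots> = 1" using 2 by (simp add: of_bool_def)
      finally show ?thesis using 2 by (simp add: target_def)
    next
      case 3
      define u where "u = p - (1 + ?G)"
      let ?t = "u div ?r" and ?i = "u mod ?r"
      have r: "0 < ?r" by (simp add: arity_def)
      have "u < tuples d k * ?r" using p 3 by (simp add: u_def dims_def)
      then have t: "?t < tuples d k" by (simp add: less_mult_imp_div_less)
      have "(\<Sum>e\<in>?A. vec d I k n e p) = (\<Sum>e\<in>?A. link d k n (e div ?S) (e mod ?S) ?t ?i)"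
        using 3 by (simp add: vec_def Let_def u_def)
      also have "\<dots> = (\<Sum>g<?G. link d k n g (v g) ?t ?i)" by (rule sums)
      also have "\<dots> = v (scope d k ?t ?i) + (?M - digit ?M ?r (v (k + 3 + ?t)) ?i)" by (rule sum_link[OF t])
      also have "digit ?M ?r (v (k + 3 + ?t)) ?i = x (scope d k ?t ?i)" using y(2)[of ?i ?t] r by (simp add: v_def)
      also have "v (scope d k ?t ?i) = x (scope d k ?t ?i)" using scope_less by (simp add: v_def)
      also have "x (scope d k ?t ?i) + (?M - x (scope d k ?t ?i)) = ?M" using x[OF scope_less, of d ?t ?i] by simp
      finally show ?thesis using 3 by (simp add: target_def)
    qed
  qed
  moreover have "?A \<subseteq> {..<?G * ?S}"
  proof
    fix e assume "e \<in> ?A"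
    then obtain g where g: "g < ?G" "e = g * ?S + v g" by (auto simp: el_def)
    have "e < Suc g * ?S" using g(2) v[of g] by simp
    also have "\<dots> \<le> ?G * ?S" using g(1) by (intro mult_le_mono1) simp
    finally show "e \<in> {..<?G * ?S}" by simp
  qed
  moreover have "card ?A = ?G" using inj by (simp add: card_image)
  ultimately show "\<exists>A\<subseteq>{..<?G * ?S}. card A = ?G \<and> (\<forall>p<dims d k. (\<Sum>e\<in>A. vec d I k n e p) = target d k n p)"
    by blast
qed


section \<open>The reduction\<close>

text \<open>Vertices are numbered block by block, the hub first.\<close>

definition block_start :: "(nat \<Rightarrow> nat) \<Rightarrow> nat \<Rightarrow> nat" where
  "block_start \<omega> b = (\<Sum>i<b. Suc (\<omega> i))"

text \<open>Counting the blocks that end before \<open>v\<close> replaces a search by a bounded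
  sum.\<close>

definition block_of :: "(nat \<Rightarrow> nat) \<Rightarrow> nat \<Rightarrow> nat \<Rightarrow> nat" where
  "block_of \<omega> m v = (\<Sum>b<m. of_bool (block_start \<omega> (Suc b) \<le> v))"

lemma block_start_mono: "i \<le> j \<Longrightarrow> block_start \<omega> i \<le> block_start \<omega> j"
  unfolding block_start_def by (rule sum_mono2) auto

lemma block_of_eq:
  assumes "b < m" "block_start \<omega> b \<le> v" "v < block_start \<omega> (Suc b)"
  shows "block_of \<omega> m v = b"
proof -
  have "{i. i < m \<and> block_start \<omega> (Suc i) \<le> v} = {..<b}"
  proof (intro set_eqI iffI)
    fix i assume "i \<in> {i. i < m \<and> block_start \<omega> (Suc i) \<le> v}"
    then have "block_start \<omega> (Suc i) < block_start \<omega> (Suc b)" using assms(3) by simp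
    then show "i \<in> {..<b}" using block_start_mono[of "Suc b" "Suc i" \<omega>] by (cases "i < b") auto
  next
    fix i assume "i \<in> {..<b}"
    then show "i \<in> {i. i < m \<and> block_start \<omega> (Suc i) \<le> v}"
      using block_start_mono[of "Suc i" b \<omega>] assms(1,2) by auto
  qed
  moreover have "block_of \<omega> m v = card {i. i < m \<and> block_start \<omega> (Suc i) \<le> v}"
    by (simp add: block_of_def of_bool_def sum.If_cases Int_def)
  ultimately show ?thesis by simp
qed

lemma block_exists: "v < block_start \<omega> m \<Longrightarrow> \<exists>b<m. block_start \<omega> b \<le> v \<and> v < block_start \<omega> (Suc b)"
proof (induction m)
  case (Suc m)
  then show ?case by (cases "v < block_start \<omega> m") (auto simp: less_Suc_eq)
qed (simp add: block_start_def)

lemma block_of_iff: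
  assumes "v < block_start \<omega> m" "b < m"
  shows "block_of \<omega> m v = b \<longleftrightarrow> block_start \<omega> b \<le> v \<and> v < block_start \<omega> (Suc b)"
  using block_exists[OF assms(1)] block_of_eq assms(2) by metis

lemma block_graph_block_start:
  assumes "1 \<le> K"
  shows "block_graph K n (block_start \<omega> (n * (2 * K))) (block_of \<omega> (n * (2 * K))) (block_start \<omega>) \<omega>"
proof
  let ?m = "n * (2 * K)"
  fix v assume "v < block_start \<omega> ?m"
  then show "block_of \<omega> ?m v < ?m" using block_exists block_of_eq by metis
next
  let ?m = "n * (2 * K)"
  fix b assume b: "b < ?m"
  have s: "block_start \<omega> (Suc b) = block_start \<omega> b + Suc (\<omega> b)" by (simp add: block_start_def)
  have le: "block_start \<omega> (Suc b) \<le> block_start \<omega> ?m" using b by (intro block_start_mono) simp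
  show "block_start \<omega> b < block_start \<omega> ?m \<and> block_of \<omega> ?m (block_start \<omega> b) = b"
    using s le block_of_eq[OF b, of \<omega> "block_start \<omega> b"] by simp
  have "{v. v < block_start \<omega> ?m \<and> block_of \<omega> ?m v = b} = {block_start \<omega> b..<block_start \<omega> (Suc b)}"
    using block_of_iff[OF _ b] le by force
  then show "card {v. v < block_start \<omega> ?m \<and> block_of \<omega> ?m v = b} = Suc (\<omega> b)" using s by simp
qed (rule assms)

text \<open>Inverts \<open>n * (n + 2)\<close>, the length of the code of a circuit with \<open>n\<close> gates.\<close>

definition gate_count :: "nat \<Rightarrow> nat" where
  "gate_count l = (\<Sum>i<l. of_bool (Suc i * (i + 3) \<le> l))"

lemma gate_count: "gate_count (n * (n + 2)) = n"
proof -
  have iff: "Suc i * (i + 3) \<le> n * (n + 2) \<longleftrightarrow> i < n" for i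
  proof
    assume "i < n"
    then show "Suc i * (i + 3) \<le> n * (n + 2)" by (intro mult_le_mono) auto
  next
    assume le: "Suc i * (i + 3) \<le> n * (n + 2)"
    show "i < n"
    proof (rule ccontr)
      assume "\<not> i < n"
      then have "n * (n + 2) < Suc i * (i + 3)" by (intro mult_strict_mono) auto
      then show False using le by simp
    qed
  qed
  have "{i. i < n * (n + 2) \<and> Suc i * (i + 3) \<le> n * (n + 2)} = {..<n}"
    unfolding iff by (auto intro: less_le_trans)
  moreover have "gate_count (n * (n + 2)) = card {i. i < n * (n + 2) \<and> Suc i * (i + 3) \<le> n * (n + 2)}"
    by (simp add: gate_count_def of_bool_def sum.If_cases Int_def del: mult_Suc)
  ultimately show ?thesis by simp
qed

abbreviation "reduced f d I k n \<equiv>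
  f (vec d I k n) (target d k n) (groups d k * group_size d n) (dims d k)"

abbreviation "weights d I k n \<equiv> reduced block_weight d I k n (groups d k)"

definition order :: "nat \<Rightarrow> (nat \<Rightarrow> nat) \<Rightarrow> nat \<Rightarrow> nat \<Rightarrow> nat" where
  "order d I k n = block_start (weights d I k n) (Suc (groups d k * group_size d n) * (2 * Suc (dims d k)))"

text \<open>Restates the adjacency of the block graph as an explicit formula in the input string, so
  that its decidability can be derived.\<close>

definition neighbours :: "nat \<Rightarrow> (nat \<Rightarrow> nat) \<Rightarrow> nat \<Rightarrow> nat \<Rightarrow> nat \<Rightarrow> nat \<Rightarrow> bool" where
  "neighbours d I k n u v \<longleftrightarrow> (let \<omega> = (weights d I k n); K = Suc (dims d k);
       m = Suc (groups d k * group_size d n) * (2 * K); x = block_of \<omega> m u; y = block_of \<omega> m v in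
     x div (2 * K) = y div (2 * K) \<and> x \<noteq> y \<and> (u = block_start \<omega> x \<or> v = block_start \<omega> y))"

text \<open>For parameters under two nested sums or quantifiers.\<close>

lemmas definable_shift2 = definable_shift[THEN definable_shift]

section \<open>Definability of every stage of the reduction\<close>

named_theorems reduction_intros
declare definable_intros [reduction_intros]

lemma definable_modulus [reduction_intros]:
  assumes "definable n"
  shows "definable (\<lambda>I \<sigma>. modulus d (n I \<sigma>))"
  unfolding modulus_def
  by (intro reduction_intros assms assms[THEN definable_shift])

lemma decidable_kind1 [reduction_intros]:
  assumes "definable n" "definable g"
  shows "decidable (\<lambda>I \<sigma>. kind1 I (n I \<sigma>) (g I \<sigma>))"
  unfolding kind1_def
  by (intro reduction_intros assms assms[THEN definable_shift])

lemma decidable_kind2 [reduction_intros]: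
  assumes "definable n" "definable g"
  shows "decidable (\<lambda>I \<sigma>. kind2 I (n I \<sigma>) (g I \<sigma>))"
  unfolding kind2_def
  by (intro reduction_intros assms assms[THEN definable_shift])

lemma decidable_adj [reduction_intros]:
  assumes "definable n" "definable g" "definable i"
  shows "decidable (\<lambda>I \<sigma>. adj I (n I \<sigma>) (g I \<sigma>) (i I \<sigma>))"
  unfolding adj_def
  by (intro reduction_intros assms assms[THEN definable_shift])

lemma definable_digit [reduction_intros]:
  assumes "definable B" "definable y" "definable i"
  shows "definable (\<lambda>I \<sigma>. digit (B I \<sigma>) r (y I \<sigma>) (i I \<sigma>))"
  unfolding digit_def by (intro definable_intros definable_power_min assms)

text \<open>\<open>h\<close> and \<open>d\<close> are constants of the reduction, so the recursion
  unfolds into a fixed expression for each \<open>h\<close>. The interval ends are digits of one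
  number, since definable functions take only numbers as arguments.\<close>

lemma decidable_cert [reduction_intros]:
  assumes "definable n" "definable a" "definable g" "definable b"
  shows "decidable (\<lambda>I \<sigma>. cert h I (n I \<sigma>) (2 ^ d) (\<lambda>l. digit (modulus d (n I \<sigma>)) (arity d) (a I \<sigma>) (1 + 2 * l)) (\<lambda>l. digit (modulus d (n I \<sigma>)) (arity d) (a I \<sigma>) (2 + 2 * l)) (g I \<sigma>) (b I \<sigma>))"
  using assms
proof (induction h arbitrary: n a g b)
  case 0
  then show ?case by (simp only: cert.simps(1)) (rule definable_const)
next
  case (Suc h)
  show ?case unfolding cert.simps(2)
    by (intro reduction_intros Suc.IH Suc.prems Suc.prems[THEN definable_shift])
qed

lemma decidable_claimed [reduction_intros]:
  assumes "definable n" "definable W" "definable g" "definable b"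
  shows "decidable (\<lambda>I \<sigma>. claimed d (n I \<sigma>) (W I \<sigma>) (g I \<sigma>) (b I \<sigma>))"
  unfolding claimed_def
  by (intro reduction_intros assms assms[THEN definable_shift])

lemma decidable_justified [reduction_intros]:
  assumes "definable n" "definable a" "definable g" "definable b"
  shows "decidable (\<lambda>I \<sigma>. justified d I (n I \<sigma>) (\<lambda>l. digit (modulus d (n I \<sigma>)) (arity d) (a I \<sigma>) (1 + 2 * l)) (\<lambda>l. digit (modulus d (n I \<sigma>)) (arity d) (a I \<sigma>) (2 + 2 * l)) (claimed d (n I \<sigma>) (digit (modulus d (n I \<sigma>)) (arity d) (a I \<sigma>) 0)) (g I \<sigma>) (b I \<sigma>))"
  unfolding justified_def
  by (intro reduction_intros assms assms[THEN definable_shift])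

lemma decidable_tuple_check [reduction_intros]:
  assumes "definable n" "definable a"
  shows "decidable (\<lambda>I \<sigma>. tuple_check d I (n I \<sigma>) (a I \<sigma>))"
  unfolding tuple_check_def check_def
  by (intro reduction_intros assms assms[THEN definable_shift] assms[THEN definable_shift2])

lemma definable_tuples [reduction_intros]:
  assumes "definable k"
  shows "definable (\<lambda>I \<sigma>. tuples d (k I \<sigma>))"
  unfolding tuples_def
  by (intro reduction_intros assms assms[THEN definable_shift])

lemma definable_group_size [reduction_intros]:
  assumes "definable n"
  shows "definable (\<lambda>I \<sigma>. group_size d (n I \<sigma>))"
  unfolding group_size_def
  by (intro reduction_intros assms assms[THEN definable_shift])

lemma definable_groups [reduction_intros]:
  assumes "definable k"
  shows "definable (\<lambda>I \<sigma>. groups d (k I \<sigma>))"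
  unfolding groups_def
  by (intro reduction_intros assms assms[THEN definable_shift])

lemma definable_dims [reduction_intros]:
  assumes "definable k"
  shows "definable (\<lambda>I \<sigma>. dims d (k I \<sigma>))"
  unfolding dims_def
  by (intro reduction_intros assms assms[THEN definable_shift])

lemma definable_scope [reduction_intros]:
  assumes "definable k" "definable t" "definable i"
  shows "definable (\<lambda>I \<sigma>. scope d (k I \<sigma>) (t I \<sigma>) (i I \<sigma>))"
  unfolding scope_def
  by (intro reduction_intros assms assms[THEN definable_shift])

lemma decidable_valid [reduction_intros]:
  assumes "definable k" "definable n" "definable g" "definable a"
  shows "decidable (\<lambda>I \<sigma>. valid d I (k I \<sigma>) (n I \<sigma>) (g I \<sigma>) (a I \<sigma>))"
  unfolding valid_def
  by (intro reduction_intros assms assms[THEN definable_shift])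

lemma definable_vec [reduction_intros]:
  assumes "definable k" "definable n" "definable e" "definable p"
  shows "definable (\<lambda>I \<sigma>. vec d I (k I \<sigma>) (n I \<sigma>) (e I \<sigma>) (p I \<sigma>))"
  unfolding vec_def link_def Let_def
  by (intro reduction_intros assms assms[THEN definable_shift])

lemma definable_target [reduction_intros]:
  assumes "definable k" "definable n" "definable p"
  shows "definable (\<lambda>I \<sigma>. target d (k I \<sigma>) (n I \<sigma>) (p I \<sigma>))"
  unfolding target_def
  by (intro reduction_intros assms assms[THEN definable_shift])

lemma definable_nxt [reduction_intros]:
  assumes "definable D" "definable p"
  shows "definable (\<lambda>I \<sigma>. nxt (D I \<sigma>) (p I \<sigma>))"
  unfolding nxt_def
  by (intro reduction_intros assms assms[THEN definable_shift])

lemma definable_xco [reduction_intros]: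
  assumes "definable D" "definable r"
  shows "definable (\<lambda>I \<sigma>. xco (D I \<sigma>) (r I \<sigma>))"
  unfolding xco_def
  by (intro reduction_intros assms assms[THEN definable_shift])

lemma definable_fco [reduction_intros]:
  assumes "definable D" "definable r"
  shows "definable (\<lambda>I \<sigma>. fco (D I \<sigma>) (r I \<sigma>))"
  unfolding fco_def
  by (intro reduction_intros assms assms[THEN definable_shift])

lemma definable_intended_xco [reduction_intros]:
  assumes "definable D" "definable N" "definable m" "definable p"
  shows "definable (\<lambda>I \<sigma>. intended (xco (D I \<sigma>)) (N I \<sigma>) (D I \<sigma>) (m I \<sigma>) (p I \<sigma>))"
  unfolding intended_def
  by (intro reduction_intros assms assms[THEN definable_shift])

lemma definable_intended_fco [reduction_intros]:
  assumes "definable D" "definable N" "definable m" "definable p"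
  shows "definable (\<lambda>I \<sigma>. intended (fco (D I \<sigma>)) (N I \<sigma>) (D I \<sigma>) (m I \<sigma>) (p I \<sigma>))"
  unfolding intended_def
  by (intro reduction_intros assms assms[THEN definable_shift])

lemma definable_vco [reduction_intros]:
  assumes "definable k" "definable n" "definable c" "definable r"
  shows "definable (\<lambda>I \<sigma>. vco (vec d I (k I \<sigma>) (n I \<sigma>)) (c I \<sigma>) (r I \<sigma>))"
  unfolding vco_def
  by (intro reduction_intros assms assms[THEN definable_shift])

lemma definable_radix [reduction_intros]:
  assumes "definable k" "definable n"
  shows "definable (\<lambda>I \<sigma>. reduced radix d I (k I \<sigma>) (n I \<sigma>))"
  unfolding radix_def
  by (intro reduction_intros assms assms[THEN definable_shift] assms[THEN definable_shift2])

lemma definable_item [reduction_intros]: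
  assumes "definable k" "definable n" "definable c" "definable r"
  shows "definable (\<lambda>I \<sigma>. reduced item d I (k I \<sigma>) (n I \<sigma>) (c I \<sigma>) (r I \<sigma>))"
  unfolding item_def
  by (intro reduction_intros assms assms[THEN definable_shift])

lemma definable_capacity [reduction_intros]:
  assumes "definable k" "definable n" "definable p"
  shows "definable (\<lambda>I \<sigma>. reduced capacity d I (k I \<sigma>) (n I \<sigma>) (groups d (k I \<sigma>)) (p I \<sigma>))"
  unfolding capacity_def
  by (intro reduction_intros assms assms[THEN definable_shift])

lemma definable_all_items [reduction_intros]:
  assumes "definable k" "definable n"
  shows "definable (\<lambda>I \<sigma>. reduced all_items d I (k I \<sigma>) (n I \<sigma>))"
  unfolding all_items_def
  by (intro reduction_intros assms assms[THEN definable_shift] assms[THEN definable_shift2])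

lemma definable_all_capacities [reduction_intros]:
  assumes "definable k" "definable n"
  shows "definable (\<lambda>I \<sigma>. reduced all_capacities d I (k I \<sigma>) (n I \<sigma>) (groups d (k I \<sigma>)))"
  unfolding all_capacities_def
  by (intro reduction_intros assms assms[THEN definable_shift])

lemma definable_level [reduction_intros]:
  assumes "definable k" "definable n"
  shows "definable (\<lambda>I \<sigma>. reduced level d I (k I \<sigma>) (n I \<sigma>) (groups d (k I \<sigma>)))"
  unfolding level_def
  by (intro reduction_intros assms assms[THEN definable_shift])

lemma definable_filler [reduction_intros]:
  assumes "definable k" "definable n" "definable r"
  shows "definable (\<lambda>I \<sigma>. reduced filler d I (k I \<sigma>) (n I \<sigma>) (groups d (k I \<sigma>)) (r I \<sigma>))"
  unfolding filler_def
  by (intro reduction_intros assms assms[THEN definable_shift])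

lemma definable_block_weight [reduction_intros]:
  assumes "definable k" "definable n" "definable b"
  shows "definable (\<lambda>I \<sigma>. weights d I (k I \<sigma>) (n I \<sigma>) (b I \<sigma>))"
  unfolding block_weight_def
  by (intro reduction_intros assms assms[THEN definable_shift])

lemma definable_block_start [reduction_intros]:
  assumes "definable k" "definable n" "definable b"
  shows "definable (\<lambda>I \<sigma>. block_start (weights d I (k I \<sigma>) (n I \<sigma>)) (b I \<sigma>))"
  unfolding block_start_def
  by (intro reduction_intros assms assms[THEN definable_shift])

lemma definable_block_of [reduction_intros]:
  assumes "definable k" "definable n" "definable m" "definable v"
  shows "definable (\<lambda>I \<sigma>. block_of (weights d I (k I \<sigma>) (n I \<sigma>)) (m I \<sigma>) (v I \<sigma>))"
  unfolding block_of_def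
  by (intro reduction_intros assms assms[THEN definable_shift])

lemma definable_gate_count [reduction_intros]:
  assumes "definable l"
  shows "definable (\<lambda>I \<sigma>. gate_count (l I \<sigma>))"
  unfolding gate_count_def
  by (intro reduction_intros assms assms[THEN definable_shift])

lemma definable_order [reduction_intros]:
  assumes "definable k" "definable n"
  shows "definable (\<lambda>I \<sigma>. order d I (k I \<sigma>) (n I \<sigma>))"
  unfolding order_def
  by (intro reduction_intros assms assms[THEN definable_shift])

lemma decidable_neighbours [reduction_intros]:
  assumes "definable k" "definable n" "definable u" "definable v"
  shows "decidable (\<lambda>I \<sigma>. neighbours d I (k I \<sigma>) (n I \<sigma>) (u I \<sigma>) (v I \<sigma>))"
  unfolding neighbours_def Let_def
  by (intro reduction_intros assms assms[THEN definable_shift])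

theorem theorem2:
  "W_hard 1 EQUITABLE_TREE_COLORING disjoint_split_inputs"
  unfolding W_hard_def
proof
  fix P assume "P \<in> W_class 1"
  then obtain d where P: "fpt_reducible P weighted_circuit_sat (weft_depth_inputs 1 d)"
    by (auto simp: W_class_def)
  define red where "red = (\<lambda>(x :: bool list, k). (map (\<lambda>p. neighbours d (symbol x) k (gate_count (length x))
      (p div order d (symbol x) k (gate_count (length x))) (p mod order d (symbol x) k (gate_count (length x))))
    [0..<order d (symbol x) k (gate_count (length x)) * order d (symbol x) k (gate_count (length x))], Suc (dims d k)))"
  have main: "red y \<in> disjoint_split_inputs \<and> (y \<in> weighted_circuit_sat \<longleftrightarrow> red y \<in> EQUITABLE_TREE_COLORING)"
    if y: "y \<in> weft_depth_inputs 1 d" for y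
  proof -
    obtain C k where C: "y = (circuit_code C, k)" "wf_circuit C" "weft_at_most C 1" "depth_at_most C d"
      using y by (auto simp: weft_depth_inputs_def)
    interpret shallow_circuit C d using C by unfold_locales
    have cnt: "gate_count (length (circuit_code C)) = n" by (simp only: length_circuit_code gate_count)
    have D: "2 \<le> dims d k" by (simp add: dims_def groups_def)
    have m: "groups d k \<le> groups d k * group_size d n" using group_size_pos(1)[of d n] by simp
    interpret gadget "vec d I k n" "target d k n" "groups d k * group_size d n" "dims d k" "groups d k"
      using D m by unfold_locales
    interpret B: block_graph "Suc (dims d k)" "Suc (groups d k * group_size d n)" "order d I k n"
      "block_of \<omega> (Suc (groups d k * group_size d n) * (2 * Suc (dims d k)))" "block_start \<omega>" \<omega>
      unfolding order_def by (rule block_graph_block_start) simp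
    have adj: "neighbours d I k n u v = B.adjacent u v" for u v
      by (simp only: neighbours_def Let_def B.adjacent_def B.is_hub_def)
    have "map (\<lambda>p. neighbours d I k n (p div order d I k n) (p mod order d I k n)) [0..<order d I k n * order d I k n] =
        graph_code B.G"
    proof -
      have order: "card (fst B.G) = order d I k n" by (simp only: B.G_def fst_conv card_lessThan)
      have edge: "B.adjacent (p div order d I k n) (p mod order d I k n) \<longleftrightarrow>
          {p div order d I k n, p mod order d I k n} \<in> snd B.G" if "p < order d I k n * order d I k n" for p
      proof -
        have "0 < order d I k n" using that by (cases "order d I k n") auto
        then show ?thesis unfolding B.edge_iff using that by (simp add: less_mult_imp_div_less)
      qed
      show ?thesis unfolding graph_code_def Let_def order adj
        by (rule map_cong[OF refl], rule edge) simp
    qed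
    then have red: "red y = (graph_code B.G, Suc (dims d k))" by (simp only: red_def C(1) prod.case cnt)
    have "y \<in> weighted_circuit_sat \<longleftrightarrow> (\<exists>S\<subseteq>input_gates C. card S = k \<and> gate_value C S (n - 1))"
    proof
      assume "y \<in> weighted_circuit_sat"
      then obtain C' k' where C': "(circuit_code C, k) = (circuit_code C', k')" "wf_circuit C'"
        "\<exists>S\<subseteq>input_gates C'. card S = k' \<and> gate_value C' S (length C' - 1)"
        unfolding weighted_circuit_sat_def C(1) by blast
      then have "C' = C" "k' = k" using circuit_code_inject[OF C(2) C'(2)] by simp_all
      then show "\<exists>S\<subseteq>input_gates C. card S = k \<and> gate_value C S (n - 1)" using C'(3) by blast
    next
      assume "\<exists>S\<subseteq>input_gates C. card S = k \<and> gate_value C S (n - 1)"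
      then show "y \<in> weighted_circuit_sat" unfolding weighted_circuit_sat_def C(1) using C(2) by blast
    qed
    also have "\<dots> \<longleftrightarrow> (\<exists>s W. constraints d I k n s W)"
      unfolding satisfiable_iff constraints_def ..
    also have "\<dots> \<longleftrightarrow> (\<exists>c. equitable_tree_coloring B.G (Suc (dims d k)) c)"
      unfolding B.colorable_iff coloring_iff_solution vector_sum_iff ..
    also have "\<dots> \<longleftrightarrow> red y \<in> EQUITABLE_TREE_COLORING"
    proof
      assume "\<exists>c. equitable_tree_coloring B.G (Suc (dims d k)) c"
      moreover have "1 \<le> Suc (dims d k)" by simp
      ultimately show "red y \<in> EQUITABLE_TREE_COLORING"
        unfolding EQUITABLE_TREE_COLORING_def red using B.input by blast
    next
      assume "red y \<in> EQUITABLE_TREE_COLORING"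
      then obtain H k' where H: "(graph_code B.G, Suc (dims d k)) = (graph_code H, k')" "input_graph H"
        "\<exists>c. equitable_tree_coloring H k' c"
        unfolding EQUITABLE_TREE_COLORING_def red by blast
      then have "H = B.G" "k' = Suc (dims d k)" using graph_code_inject[OF B.input H(2)] by blast+
      then show "\<exists>c. equitable_tree_coloring B.G (Suc (dims d k)) c" using H(3) by blast
    qed
    finally have "y \<in> weighted_circuit_sat \<longleftrightarrow> red y \<in> EQUITABLE_TREE_COLORING" .
    moreover have "red y \<in> disjoint_split_inputs"
    proof -
      have "1 \<le> Suc (dims d k)" by simp
      then show ?thesis unfolding disjoint_split_inputs_def red using B.input B.disjoint_union by blast
    qed
    ultimately show ?thesis by blast
  qed
  show "fpt_reducible P EQUITABLE_TREE_COLORING disjoint_split_inputs"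
  proof (rule fpt_reducible_definable[OF P, where K = "\<lambda>k. Suc (dims d k)"
        and L = "\<lambda>I k l. order d I k (gate_count l) * order d I k (gate_count l)"
        and B = "\<lambda>I p k l. neighbours d I k (gate_count l) (p div order d I k (gate_count l)) (p mod order d I k (gate_count l))"])
    show "definable (\<lambda>I \<sigma>. Suc (dims d (\<sigma> 1)))" by (intro reduction_intros)
    show "definable (\<lambda>I \<sigma>. order d I (\<sigma> 1) (gate_count (\<sigma> 2)) * order d I (\<sigma> 1) (gate_count (\<sigma> 2)))"
      by (intro reduction_intros)
    show "decidable (\<lambda>I \<sigma>. neighbours d I (\<sigma> 1) (gate_count (\<sigma> 2)) (\<sigma> 0 div order d I (\<sigma> 1) (gate_count (\<sigma> 2)))
        (\<sigma> 0 mod order d I (\<sigma> 1) (gate_count (\<sigma> 2))))"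
      by (intro reduction_intros)
  qed (use main in \<open>simp_all add: red_def\<close>)
qed

end
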